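(* Let $n\ge 3$, $\beta>0$, $p\in(1,2]$ and $0\le -a<p\beta<n$. For $q>0$ and a double bounded function $R$ on $\mathbb{R}^n$ consider the integral equation $$u(x)=R(x)\,W_{\beta,p}\big(|y|^a u^q(y)\big)(x),\qquad u>0 \ \text{ in } \mathbb{R}^n. \qquad (\mathrm{IE})$$ (0) If $0<q\le \frac{(n+a)(p-1)}{n-p\beta}$, then (IE) has no positive solution, for any double bounded function $R$. Assume in addition that $q>p-1$, put $s_0=\frac{n(q-p+1)}{p\beta+a}$, and let $u$ be a positive solution of (IE) for some double bounded function $R$. Then: (1) $u$ is bounded and decays with the rate $\frac{n-p\beta}{p-1}$ as $|x|\to\infty$ if and only if $u\in L^{s_0}(\mathbb{R}^n)$. (2) If $u$ is bounded, $u\notin L^{s_0}(\mathbb{R}^n)$, and $u$ decays with some rate $\theta>0$ as $|x|\to\infty$, then $\theta=\frac{p\beta+a}{q-p+1}$.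
   Context: For a nonnegative $f\in L^1_{loc}(\mathbb{R}^n)$, $p>1$, $\beta>0$, $p\beta<n$, the Wolff potential is $$W_{\beta,p}(f)(x)=\int_0^\infty\left[\frac{\int_{B_t(x)}f(y)\,dy}{t^{n-p\beta}}\right]^{\frac1{p-1}}\frac{dt}{t},$$ where $B_t(x)$ is the ball of radius $t$ centered at $x$. A measurable function $R$ on $\mathbb{R}^n$ is double bounded if there is $C>0$ with $\frac1C\le R(x)\le C$ for all $x\in\mathbb{R}^n$. A positive solution of (IE) is a measurable function $u:\mathbb{R}^n\to(0,\infty)$ with $|y|^au^q\in L^1_{loc}(\mathbb{R}^n)$ satisfying the equation for a.e. $x$; pointwise statements about $u$ are understood up to null sets, and "bounded" means $u\in L^\infty(\mathbb{R}^n)$. For $s>0$ (possibly $s<1$), $u\in L^s(\mathbb{R}^n)$ means $\int_{\mathbb{R}^n}|u|^s\,dx<\infty$. "$u$ decays with the rate $\theta$" means $u(x)\simeq|x|^{-\theta}$ as $|x|\to\infty$, i.e. there are constants $0<c\le C$ and $\rho>0$ with $c|x|^{-\theta}\le u(x)\le C|x|^{-\theta}$ for $|x|>\rho$. *)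

theory Defs
  imports "HOL-Analysis.Analysis"
begin

definition locally_integrable :: "(real^'n \<Rightarrow> real) \<Rightarrow> bool" where
  "locally_integrable f \<longleftrightarrow> (\<forall>K. compact K \<longrightarrow> set_integrable lebesgue K f)"

text \<open>
  The Wolff potential takes values in \<open>[0,\<infinity>]\<close>, since the outer integral may diverge.  The
  definition is meant for nonnegative locally integrable \<open>f\<close> and \<open>p > 1\<close>; then the inner integral
  over the bounded ball is a finite real number.
\<close>

definition wolff_potential :: "real \<Rightarrow> real \<Rightarrow> (real^'n \<Rightarrow> real) \<Rightarrow> real^'n \<Rightarrow> ennreal" where
  "wolff_potential \<beta> p f x =
     (\<integral>\<^sup>+ t\<in>{0<..}.
        ennreal (((LINT y:ball x t|lebesgue. f y) / t powr (real CARD('n) - p * \<beta>))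
                   powr (1 / (p - 1)) / t) \<partial>lborel)"

definition double_bounded :: "(real^'n \<Rightarrow> real) \<Rightarrow> bool" where
  "double_bounded R \<longleftrightarrow>
     R \<in> borel_measurable lebesgue \<and> (\<exists>C>0. \<forall>x. 1 / C \<le> R x \<and> R x \<le> C)"

text \<open>
  The equation is read in \<open>[0,\<infinity>]\<close>; as \<open>u\<close> is real valued, it includes the finiteness of
  the potential at almost every point.  The weight \<open>norm y powr a\<close> has the value 0 at \<open>y = 0\<close>,
  which is immaterial because only its almost-everywhere class enters.
\<close>

definition positive_solution ::
  "real \<Rightarrow> real \<Rightarrow> real \<Rightarrow> real \<Rightarrow> (real^'n \<Rightarrow> real) \<Rightarrow> (real^'n \<Rightarrow> real) \<Rightarrow> bool" where
  "positive_solution \<beta> p a q R u \<longleftrightarrow>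
     u \<in> borel_measurable lebesgue \<and>
     (\<forall>x. 0 < u x) \<and>
     locally_integrable (\<lambda>y. norm y powr a * u y powr q) \<and>
     (AE x in lebesgue.
        ennreal (u x) =
          ennreal (R x) * wolff_potential \<beta> p (\<lambda>y. norm y powr a * u y powr q) x)"

definition in_L :: "real \<Rightarrow> (real^'n \<Rightarrow> real) \<Rightarrow> bool" where
  "in_L s u \<longleftrightarrow>
     u \<in> borel_measurable lebesgue \<and> (\<integral>\<^sup>+ x. ennreal (\<bar>u x\<bar> powr s) \<partial>lebesgue) < \<infinity>"

definition in_L_infinity :: "(real^'n \<Rightarrow> real) \<Rightarrow> bool" where
  "in_L_infinity u \<longleftrightarrow>
     u \<in> borel_measurable lebesgue \<and> (\<exists>M. AE x in lebesgue. \<bar>u x\<bar> \<le> M)"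

definition decays_with_rate :: "real \<Rightarrow> (real^'n \<Rightarrow> real) \<Rightarrow> bool" where
  "decays_with_rate \<theta> u \<longleftrightarrow>
     (\<exists>c C \<rho>. 0 < c \<and> c \<le> C \<and> 0 < \<rho> \<and>
        (AE x in lebesgue. norm x > \<rho> \<longrightarrow>
           c * norm x powr (- \<theta>) \<le> u x \<and> u x \<le> C * norm x powr (- \<theta>)))"

end

theory Submission
  imports Defs
begin

text \<open>Let \<open>f = |y|\<^sup>a u\<^sup>q\<close>, let \<open>F r\<close> be the integral of \<open>f\<close> over the ball of radius \<open>r\<close> about the origin, and
  let \<open>H r\<close> be the part of the Wolff potential at the origin coming from radii beyond \<open>r\<close>.  Comparing balls
  gives \<open>u x \<ge> c H |x|\<close>, and inserting this into \<open>f\<close> yields a growth inequality for \<open>F\<close> that is incompatible with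
  finiteness of \<open>H\<close> in the subcritical and critical cases.  The same lower bound forces any decay rate to be at
  least the slow one; a solution decaying faster than the slow rate is in \<open>L\<^bsup>s0\<^esup>\<close>.

  If \<open>u\<close> is in \<open>L\<^bsup>s0\<^esup>\<close>, Hedberg's splitting bounds \<open>u\<close>, wherever its \<open>L\<^bsup>s0\<^esup>\<close> mass nearby is small, by a large multiple
  of the far part of the potential or by a small multiple of a maximal function of a power of \<open>u\<close>.  The maximal
  theorem excludes the second alternative.  Small balls give boundedness, and the balls \<open>B(x, |x|/2)\<close> far out give
  \<open>u x \<le> C H |x|\<close>.  The problem is now one-dimensional: \<open>F\<close> and \<open>H\<close> determine each other, and as \<open>H\<close> is of smaller
  order than the slow rate, a comparison argument shows that \<open>F\<close> is bounded, whence \<open>H\<close> has the fast rate.\<close>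

section \<open>A maximal function estimate\<close>

text \<open>The exponent \<open>s0\<close> is the one for which passing from \<open>u x\<close> to
  \<open>\<lambda> powr \<sigma> * u (\<lambda> x)\<close>, with \<open>\<sigma>\<close> the slow
  rate, preserves both the form of the equation and the integral of \<open>u powr s0\<close>. Scale
  invariance leaves nothing to gain from integrability of this order alone; the lever is that the
  mass is small on small balls and near infinity. The bound obtained from small mass behaves like
  \<open>t powr (- \<sigma> - 1)\<close> in the radius \<open>t\<close>, which is not integrable at
  0. Small radii therefore need a second bound, by means of a lower power of \<open>u\<close>, and
  this is where a maximal function enters. As \<open>s0\<close> may be below 1, the maximal theorem
  is applied to \<open>u powr (q * e1)\<close>, for which the exponent \<open>s0 / (q * e1)\<close>
  exceeds 1. Supercriticality \<open>n + a < q * b\<close> is derived for every solution and then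
  acts in three forms: the fast rate beats the slow one (\<open>sigma_less_b\<close>), there is room
  for an exponent between \<open>n / (n + a)\<close> and \<open>s0 / q\<close>
  (\<open>s0_q\<close>), and the increments of \<open>F\<close> are summable along doubling
  (\<open>F_bounded\<close>).\<close>

lemma emeasure_le_of_disjoint_cover:
  assumes "countable C" "disjoint_family_on A C"
    and A: "\<And>i. i \<in> C \<Longrightarrow> A i \<in> sets N" and B: "\<And>i. i \<in> C \<Longrightarrow> B i \<in> sets M"
    and le: "\<And>i. i \<in> C \<Longrightarrow> emeasure M (B i) \<le> c * emeasure N (A i)"
    and E: "E \<subseteq> (\<Union>i\<in>C. B i)"
  shows "emeasure M E \<le> c * emeasure N (space N)"
proof -
  \<comment> \<open>The index set is moved into \<open>nat\<close> and padded with empty sets,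
    because countable additivity and subadditivity are used for sequences.\<close>
  define f where "f = to_nat_on C"
  have inj: "inj_on f C" unfolding f_def using assms(1) by (rule inj_on_to_nat_on)
  define g where "g = inv_into C f"
  define A' where "A' n = (if n \<in> f ` C then A (g n) else {})" for n
  define B' where "B' n = (if n \<in> f ` C then B (g n) else {})" for n
  have gC: "g n \<in> C" if "n \<in> f ` C" for n using that by (simp add: g_def inv_into_into)
  have gf: "g (f i) = i" if "i \<in> C" for i using that inj by (simp add: g_def)
  have fg: "f (g n) = n" if "n \<in> f ` C" for n using that by (simp add: g_def f_inv_into_f)
  have EB: "E \<subseteq> (\<Union>n. B' n)"
  proof
    fix x assume "x \<in> E"
    then obtain i where "i \<in> C" "x \<in> B i" using E by blast
    then have "x \<in> B' (f i)" by (simp add: B'_def gf)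
    then show "x \<in> (\<Union>n. B' n)" by blast
  qed
  have B'M: "range B' \<subseteq> sets M" using B gC by (auto simp: B'_def)
  have A'N: "range A' \<subseteq> sets N" using A gC by (auto simp: A'_def)
  have dis: "disjoint_family A'"
    using assms(2) gC fg unfolding disjoint_family_on_def A'_def by (metis inf_bot_left inf_bot_right)
  have "emeasure M E \<le> emeasure M (\<Union>n. B' n)"
    using EB B'M by (intro emeasure_mono) auto
  also have "\<dots> \<le> (\<Sum>n. emeasure M (B' n))"
    using B'M by (rule emeasure_subadditive_countably)
  also have "\<dots> \<le> (\<Sum>n. c * emeasure N (A' n))"
    using le gC by (intro suminf_le) (auto simp: A'_def B'_def)
  also have "\<dots> = c * (\<Sum>n. emeasure N (A' n))"
    by simp
  also have "(\<Sum>n. emeasure N (A' n)) = emeasure N (\<Union>n. A' n)"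
    using A'N dis by (rule suminf_emeasure)
  also have "c * \<dots> \<le> c * emeasure N (space N)"
    using A'N by (intro mult_left_mono emeasure_space) auto
  finally show ?thesis .
qed

lemma emeasure_lborel_ball_powr:
  fixes x :: "'a::euclidean_space"
  assumes "t > 0"
  shows "emeasure lborel (ball x t) = ennreal (unit_ball_vol (real DIM('a)) * t powr real DIM('a))"
  using assms by (simp add: emeasure_ball powr_realpow)

lemma measurable_ball_lebesgue [measurable, simp]: "ball x t \<in> sets lebesgue"
  by (rule fmeasurableD) (rule lmeasurable_ball)

text \<open>Needed for Fubini on \<open>lebesgue\<close> times \<open>lborel\<close> in the two
  layer-cake arguments below.\<close>

lemma sigma_finite_lebesgue: "sigma_finite_measure (lebesgue :: 'a::euclidean_space measure)"
proof
  show "\<exists>A::'a set set. countable A \<and> A \<subseteq> sets lebesgue \<and> \<Union>A = space lebesgue \<and> (\<forall>a\<in>A. emeasure lebesgue a \<noteq> \<infinity>)"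
  proof (intro exI conjI ballI)
    let ?A = "range (\<lambda>n::nat. ball (0::'a) (real n + 1))"
    show "countable ?A" by simp
    show "?A \<subseteq> sets lebesgue" by auto
    show "\<Union>?A = space lebesgue"
    proof -
      have "\<exists>n::nat. norm (x::'a) < real n + 1" for x
        using real_nat_ceiling_ge[of "norm x"] by (intro exI[of _ "nat \<lceil>norm x\<rceil>"]) linarith
      then show ?thesis by auto
    qed
    fix a :: "'a set" assume "a \<in> ?A"
    then show "emeasure lebesgue a \<noteq> \<infinity>"
      by (auto simp: emeasure_lborel_ball_powr)
  qed
qed

lemma nn_integral_powr_Ici:
  assumes "r > 0" "b > 0"
  shows "(\<integral>\<^sup>+ t\<in>{r..}. ennreal (t powr (- b - 1)) \<partial>lborel) = ennreal (r powr (- b) / b)"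
proof -
  have "((\<lambda>t. t powr (- b - 1)) has_integral (- (r powr (- b - 1 + 1)) / (- b - 1 + 1))) {r..}"
    using assms by (intro has_integral_powr_to_inf) auto
  then have "integral\<^sup>N lborel (\<lambda>t. ennreal (t powr (- b - 1)) * indicator {r..} t) = ennreal (- (r powr (- b - 1 + 1)) / (- b - 1 + 1))"
    by (intro nn_integral_has_integral_lebesgue') auto
  then show ?thesis using assms by simp
qed

lemma nn_integral_powr_Icc:
  assumes "r \<ge> 0" "b > 0"
  shows "(\<integral>\<^sup>+ t\<in>{0..r}. ennreal (t powr (b - 1)) \<partial>lborel) = ennreal (r powr b / b)"
proof -
  have "((\<lambda>t. t powr (b - 1)) has_integral (r powr (b - 1 + 1) / (b - 1 + 1))) {0..r}"
    using assms by (intro has_integral_powr_from_0) auto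
  then have "integral\<^sup>N lborel (\<lambda>t. ennreal (t powr (b - 1)) * indicator {0..r} t) = ennreal (r powr (b - 1 + 1) / (b - 1 + 1))"
    by (intro nn_integral_has_integral_lebesgue') auto
  then show ?thesis using assms by simp
qed

text \<open>Layer-cake argument: writing the integral of \<open>w powr r\<close> over levels,
  inserting \<open>level\<close> and exchanging the integrals returns the same integral times
  \<open>r * c * (1 / k) powr (r - 1) / (r - 1)\<close>, which \<open>coef\<close> makes at most
  1/2. A finite number bounded by its own half is 0.\<close>

lemma AE_eq_0_if_level_sets_small:
  fixes r c k :: real and w :: "'a::euclidean_space \<Rightarrow> real"
  defines "J \<equiv> \<lambda>l. (\<integral>\<^sup>+ x. ennreal (w x) * indicator {x. k * l < w x} x \<partial>lebesgue)"
  assumes "r > 1" and c0: "c > 0" and k: "k > 0"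
    and coef: "c * (1 / k) powr (r - 1) / (r - 1) \<le> 1 / (2 * r)"
    and w[measurable]: "w \<in> borel_measurable lebesgue" and w0: "\<forall>x. 0 \<le> w x"
    and fin: "(\<integral>\<^sup>+ x. ennreal (w x powr r) \<partial>lebesgue) < \<infinity>"
    and level: "\<And>l. l > 0 \<Longrightarrow> emeasure lebesgue {x. l < w x} \<le> ennreal (c / l) * J l"
  shows "AE x in lebesgue. w x = 0"
proof -
  define X where "X = (\<integral>\<^sup>+ x. ennreal (w x powr r) \<partial>lebesgue)"
  have LL: "pair_sigma_finite (lebesgue :: 'a measure) (lborel :: real measure)"
    by (intro pair_sigma_finite.intro sigma_finite_lebesgue sigma_finite_lborel)
  have X1: "X = (\<integral>\<^sup>+ x. ennreal r * (\<integral>\<^sup>+ l. ennreal (l powr (r - 1)) * indicator {0<..<w x} l \<partial>lborel) \<partial>lebesgue)"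
    unfolding X_def
  proof (intro nn_integral_cong)
    fix x
    have "(\<integral>\<^sup>+ l. ennreal (l powr (r - 1)) * indicator {0<..<w x} l \<partial>lborel) = (\<integral>\<^sup>+ l\<in>{0..w x}. ennreal (l powr (r - 1)) \<partial>lborel)"
    proof (rule nn_integral_cong_AE)
      have "AE l in lborel. l \<noteq> 0" "AE l in lborel. l \<noteq> w x" by (rule AE_lborel_singleton)+
      then show "AE l in lborel. ennreal (l powr (r - 1)) * indicator {0<..<w x} l = ennreal (l powr (r - 1)) * indicator {0..w x} l"
        by eventually_elim (auto simp: indicator_def)
    qed
    also have "\<dots> = ennreal (w x powr r / r)" using w0 assms by (intro nn_integral_powr_Icc) auto
    finally show "ennreal (w x powr r) = ennreal r * (\<integral>\<^sup>+ l. ennreal (l powr (r - 1)) * indicator {0<..<w x} l \<partial>lborel)"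
      using assms by (simp add: ennreal_mult'[symmetric])
  qed
  have X2: "\<dots> = ennreal r * (\<integral>\<^sup>+ x. (\<integral>\<^sup>+ l. ennreal (l powr (r - 1)) * indicator {0<..<w x} l \<partial>lborel) \<partial>lebesgue)"
    by (intro nn_integral_cmult) (simp add: indicator_def)
  have X3: "(\<integral>\<^sup>+ x. (\<integral>\<^sup>+ l. ennreal (l powr (r - 1)) * indicator {0<..<w x} l \<partial>lborel) \<partial>lebesgue)
      = (\<integral>\<^sup>+ l. (\<integral>\<^sup>+ x. ennreal (l powr (r - 1)) * indicator {0<..<w x} l \<partial>lebesgue) \<partial>lborel)"
    by (intro pair_sigma_finite.Fubini'[OF LL, symmetric]) (simp add: indicator_def)
  have X4: "\<dots> \<le> (\<integral>\<^sup>+ l. (\<integral>\<^sup>+ x. ennreal (c * l powr (r - 2)) * indicator {0<..} l * (ennreal (w x) * indicator {x. k * l < w x} x) \<partial>lebesgue) \<partial>lborel)"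
  proof (rule nn_integral_mono)
    fix l :: real
    show "(\<integral>\<^sup>+ x. ennreal (l powr (r - 1)) * indicator {0<..<w x} l \<partial>lebesgue) \<le>
      (\<integral>\<^sup>+ x. ennreal (c * l powr (r - 2)) * indicator {0<..} l * (ennreal (w x) * indicator {x. k * l < w x} x) \<partial>lebesgue)"
    proof (cases "l > 0")
      case True
      have "(\<integral>\<^sup>+ x. ennreal (l powr (r - 1)) * indicator {0<..<w x} l \<partial>lebesgue) =
          (\<integral>\<^sup>+ x. ennreal (l powr (r - 1)) * indicator {x. l < w x} x \<partial>lebesgue)"
        using True by (intro nn_integral_cong) (auto simp: indicator_def)
      also have "\<dots> = ennreal (l powr (r - 1)) * emeasure lebesgue {x. l < w x}"
        using borel_measurable_less[of "\<lambda>_. l" lebesgue w] by (intro nn_integral_cmult_indicator) auto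
      also have "\<dots> \<le> ennreal (l powr (r - 1)) * (ennreal (c / l) * J l)"
        by (intro mult_left_mono level True) auto
      also have "\<dots> = ennreal (l powr (r - 1) * (c / l)) * J l"
        by (subst ennreal_mult') (auto simp: mult.assoc)
      also have "l powr (r - 1) * (c / l) = c * l powr (r - 2)"
        using True powr_diff[of l "r - 1" 1] by (simp add: algebra_simps)
      also have "ennreal (c * l powr (r - 2)) * J l = (\<integral>\<^sup>+ x. ennreal (c * l powr (r - 2)) * (ennreal (w x) * indicator {x. k * l < w x} x) \<partial>lebesgue)"
        unfolding J_def by (intro nn_integral_cmult[symmetric]) auto
      finally show ?thesis using True by simp
    qed (auto simp: indicator_def)
  qed
  have X5: "\<dots> = (\<integral>\<^sup>+ x. (\<integral>\<^sup>+ l. ennreal (c * l powr (r - 2)) * indicator {0<..} l * (ennreal (w x) * indicator {x. k * l < w x} x) \<partial>lborel) \<partial>lebesgue)"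
    by (intro pair_sigma_finite.Fubini'[OF LL]) (simp add: indicator_def)
  have X6: "\<dots> \<le> (\<integral>\<^sup>+ x. ennreal (c * (1 / k) powr (r - 1) / (r - 1)) * ennreal (w x powr r) \<partial>lebesgue)"
  proof (rule nn_integral_mono)
    fix x
    \<comment> \<open>After the exchange, \<open>x\<close> is counted only at levels below
      \<open>b\<close>.\<close>
    define b where "b = 1 / k * w x"
    have b: "b \<ge> 0" using w0 k by (simp add: b_def)
    have "(\<integral>\<^sup>+ l. ennreal (c * l powr (r - 2)) * indicator {0<..} l * (ennreal (w x) * indicator {x. k * l < w x} x) \<partial>lborel)
      \<le> (\<integral>\<^sup>+ l. ennreal (c * w x) * (ennreal (l powr (r - 1 - 1)) * indicator {0..b} l) \<partial>lborel)"
    proof (rule nn_integral_mono)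
      fix l
      show "ennreal (c * l powr (r - 2)) * indicator {0<..} l * (ennreal (w x) * indicator {x. k * l < w x} x)
        \<le> ennreal (c * w x) * (ennreal (l powr (r - 1 - 1)) * indicator {0..b} l)"
      proof (cases "0 < l \<and> k * l < w x")
        case True
        then have "l \<le> b" using k by (simp add: b_def field_simps)
        then show ?thesis using True w0 c0 by (simp add: ennreal_mult'[symmetric] mult_ac)
      qed (auto simp: indicator_def)
    qed
    also have "\<dots> = ennreal (c * w x) * ennreal (b powr (r - 1) / (r - 1))"
      using nn_integral_powr_Icc[OF b, of "r - 1"] assms(2) by (subst nn_integral_cmult) auto
    also have "\<dots> = ennreal (c * w x * (b powr (r - 1) / (r - 1)))"
      using assms by (intro ennreal_mult'[symmetric]) (auto simp: c0 w0 less_imp_le)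
    also have "c * w x * (b powr (r - 1) / (r - 1)) = c * (1 / k) powr (r - 1) / (r - 1) * w x powr r"
    proof (cases "w x = 0")
      case False
      then have "w x > 0" using w0 by (simp add: order_less_le)
      then have "w x * w x powr (r - 1) = w x powr r" by (simp add: powr_mult_base)
      then show ?thesis unfolding b_def using k w0 by (subst powr_mult) auto
    qed auto
    also have "ennreal \<dots> = ennreal (c * (1 / k) powr (r - 1) / (r - 1)) * ennreal (w x powr r)"
      by (subst ennreal_mult'') auto
    finally show "(\<integral>\<^sup>+ l. ennreal (c * l powr (r - 2)) * indicator {0<..} l * (ennreal (w x) * indicator {x. k * l < w x} x) \<partial>lborel)
      \<le> \<dots>" .
  qed
  have X7: "\<dots> = ennreal (c * (1 / k) powr (r - 1) / (r - 1)) * X"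
    unfolding X_def by (intro nn_integral_cmult) auto
  have X8: "\<dots> \<le> ennreal (1 / (2 * r)) * X"
    by (intro mult_right_mono ennreal_leI coef) auto
  note X3 also note X4 also note X5 also note X6 also note X7 also note X8
  finally have "X \<le> ennreal r * (ennreal (1 / (2 * r)) * X)"
    unfolding X1[unfolded X2] by (intro mult_left_mono) auto
  also have "\<dots> = ennreal (1 / 2) * X"
    using assms by (simp add: mult.assoc[symmetric] ennreal_mult'[symmetric])
  finally have "X \<le> ennreal (1 / 2) * X" .
  moreover obtain y where y: "X = ennreal y" "y \<ge> 0"
    using fin unfolding X_def by (metis ennreal_cases infinity_ennreal_def less_irrefl)
  ultimately have "ennreal y \<le> ennreal (1 / 2 * y)"
    by (subst ennreal_mult') simp_all
  then have "y \<le> 1 / 2 * y" using y(2) by (subst (asm) ennreal_le_iff) auto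
  then have "X = 0" using y by simp
  then have "AE x in lebesgue. ennreal (w x powr r) = 0"
    unfolding X_def by (subst (asm) nn_integral_0_iff_AE) auto
  then show ?thesis
    by eventually_elim (use w0 in auto)
qed

text \<open>The hypothesis says \<open>w \<le> M w / K\<close> on \<open>w > 0\<close> for the maximal function \<open>M w\<close>, up to a constant,
  which contradicts the maximal theorem in \<open>L\<^sup>r\<close> for large \<open>K\<close>.\<close>

lemma AE_eq_0_if_below_maximal_function:
  fixes r :: real
  assumes "r > 1"
  shows "\<exists>K>0. \<forall>w :: 'a::euclidean_space \<Rightarrow> real. w \<in> borel_measurable lebesgue \<longrightarrow> (\<forall>x. 0 \<le> w x) \<longrightarrow>
     (\<integral>\<^sup>+ x. ennreal (w x powr r) \<partial>lebesgue) < \<infinity> \<longrightarrow>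
     (AE x in lebesgue. 0 < w x \<longrightarrow> (\<exists>t>0. ennreal (K * t powr real DIM('a) * w x) < (\<integral>\<^sup>+ y\<in>ball x t. ennreal (w y) \<partial>lebesgue))) \<longrightarrow>
     (AE x in lebesgue. w x = 0)"
proof -
  define n where "n = real DIM('a)"
  define \<omega> where "\<omega> = unit_ball_vol n"
  have "\<omega> > 0" "n > 0" by (auto simp: \<omega>_def n_def)
  \<comment> \<open>The first entry bounds \<open>(2 * \<omega> / K) powr (r - 1)\<close> by 1; the
    second then brings \<open>c / (r - 1)\<close> below \<open>1 / (2 * r)\<close>, as the
    absorption requires.\<close>
  define K where "K = max (2 * \<omega>) (4 * \<omega> * 5 powr n * r / (r - 1))"
  have K: "K \<ge> 2 * \<omega>" "K \<ge> 4 * \<omega> * 5 powr n * r / (r - 1)" "K > 0"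
    using \<open>\<omega> > 0\<close> by (auto simp: K_def)
  \<comment> \<open>A selected ball of radius \<open>t\<close> has \<open>N\<close>-measure at least
    \<open>K * l / 2 * t powr n\<close>, and its fivefold enlargement from the Vitali lemma has
    volume \<open>\<omega> * 5 powr n * t powr n\<close>; the quotient is
    \<open>c / l\<close>.\<close>
  define c where "c = 2 * \<omega> * 5 powr n / K"
  have c0: "c > 0" using \<open>\<omega> > 0\<close> K by (simp add: c_def)
  have "c * (2 * \<omega> / K) powr (r - 1) / (r - 1) \<le> c * 1 / (r - 1)"
    using K \<open>\<omega> > 0\<close> assms c0 by (intro divide_right_mono mult_left_mono powr_le1) auto
  also have "\<dots> \<le> 1 / (2 * r)"
  proof -
    have "4 * \<omega> * 5 powr n * r \<le> K * (r - 1)"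
      using K(2) assms by (simp add: field_simps)
    then show ?thesis using assms K by (simp add: c_def field_simps)
  qed
  finally have coef: "c * (2 * \<omega> / K) powr (r - 1) / (r - 1) \<le> 1 / (2 * r)" .
  show ?thesis
  proof (intro exI conjI allI impI)
    show "K > 0" by fact
    fix w :: "'a \<Rightarrow> real"
    assume w[measurable]: "w \<in> borel_measurable lebesgue" and w0: "\<forall>x. 0 \<le> w x"
      and fin: "(\<integral>\<^sup>+ x. ennreal (w x powr r) \<partial>lebesgue) < \<infinity>"
      and AE: "AE x in lebesgue. 0 < w x \<longrightarrow> (\<exists>t>0. ennreal (K * t powr real DIM('a) * w x) < (\<integral>\<^sup>+ y\<in>ball x t. ennreal (w y) \<partial>lebesgue))"
    define X where "X = (\<integral>\<^sup>+ x. ennreal (w x powr r) \<partial>lebesgue)"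
    define J where "J l = (\<integral>\<^sup>+ x. ennreal (w x) * indicator {x. K * l / (2 * \<omega>) < w x} x \<partial>lebesgue)" for l
    \<comment> \<open>Above a cutoff \<open>h\<close>, \<open>w\<close> is at most
      \<open>h powr (1 - r) * w powr r\<close>. Finiteness of \<open>J l\<close> bounds the radii,
      which the Vitali lemma needs.\<close>
    have Jfin: "J l < \<infinity>" if "l > 0" for l
    proof -
      define h where "h = K * l / (2 * \<omega>)"
      have h: "h > 0" using that K \<open>\<omega> > 0\<close> by (simp add: h_def)
      have "J l \<le> (\<integral>\<^sup>+ x. ennreal (h powr (1 - r)) * ennreal (w x powr r) \<partial>lebesgue)"
        unfolding J_def h_def[symmetric]
      proof (rule nn_integral_mono)
        fix x
        show "ennreal (w x) * indicator {x. h < w x} x \<le> ennreal (h powr (1 - r)) * ennreal (w x powr r)"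
        proof (cases "h < w x")
          case True
          have "w x = w x powr (1 - r) * w x powr r" using True h by (simp add: powr_add[symmetric])
          also have "\<dots> \<le> h powr (1 - r) * w x powr r"
            using True h assms by (intro mult_right_mono powr_mono2') auto
          finally show ?thesis using True by (simp add: ennreal_mult'[symmetric])
        qed auto
      qed
      also have "\<dots> = ennreal (h powr (1 - r)) * X"
        unfolding X_def by (intro nn_integral_cmult) auto
      also have "\<dots> < \<infinity>" using fin by (simp add: X_def ennreal_mult_less_top)
      finally show ?thesis .
    qed
    have level: "emeasure lebesgue {x. l < w x} \<le> ennreal (c / l) * J l" if l: "l > 0" for l
    proof -
      \<comment> \<open>The values of \<open>w\<close> up to \<open>h\<close> account for at most
        half of the integral that a ball chosen for a point with \<open>l < w x\<close> must carry,
        so the other half comes from the part of \<open>w\<close> above \<open>h\<close>, which is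
        the density of \<open>N\<close>.\<close>
      define h where "h = K * l / (2 * \<omega>)"
      have h: "h > 0" using that K \<open>\<omega> > 0\<close> by (simp add: h_def)
      define N where "N = density lebesgue (\<lambda>x. ennreal (w x) * indicator {x. h < w x} x)"
      have spN: "emeasure N (space N) = J l"
        unfolding N_def J_def h_def by (subst emeasure_density) auto
      define P where "P x t \<longleftrightarrow> t > 0 \<and> ennreal (K * l / 2 * t powr n) \<le> emeasure N (ball x t)" for x t
      have "AE x in lebesgue. l < w x \<longrightarrow> (\<exists>t. P x t)"
        using AE
      proof eventually_elim
        case (elim x)
        show ?case
        proof
          assume lx: "l < w x"
          then obtain t where t: "t > 0" "ennreal (K * t powr n * w x) < (\<integral>\<^sup>+ y\<in>ball x t. ennreal (w y) \<partial>lebesgue)"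
            using elim l unfolding n_def by force
          have "(\<integral>\<^sup>+ y\<in>ball x t. ennreal (w y) \<partial>lebesgue) \<le>
            (\<integral>\<^sup>+ y. ennreal h * indicator (ball x t) y + (ennreal (w y) * indicator {x. h < w x} y) * indicator (ball x t) y \<partial>lebesgue)"
            by (intro nn_integral_mono) (auto simp: indicator_def intro!: ennreal_leI)
          also have "\<dots> = ennreal h * emeasure lebesgue (ball x t) + emeasure N (ball x t)"
            unfolding N_def by (subst nn_integral_add) (auto simp: emeasure_density nn_integral_cmult_indicator)
          also have "ennreal h * emeasure lebesgue (ball x t) = ennreal (K * l / 2 * t powr n)"
            using t h \<open>\<omega> > 0\<close> by (simp add: emeasure_lborel_ball_powr \<omega>_def[symmetric] n_def[symmetric] ennreal_mult'[symmetric] h_def mult_ac)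
          finally have 1: "(\<integral>\<^sup>+ y\<in>ball x t. ennreal (w y) \<partial>lebesgue) \<le> ennreal (K * l / 2 * t powr n) + emeasure N (ball x t)" .
          have "ennreal (K * l / 2 * t powr n) + ennreal (K * l / 2 * t powr n) = ennreal (K * t powr n * l)"
            using K l by (subst ennreal_plus[symmetric]) (auto simp: field_simps)
          also have "\<dots> \<le> ennreal (K * t powr n * w x)"
            using K lx by (intro ennreal_leI mult_left_mono) auto
          also have "\<dots> \<le> ennreal (K * l / 2 * t powr n) + emeasure N (ball x t)"
            using 1 t(2) by auto
          finally have "ennreal (K * l / 2 * t powr n) \<le> emeasure N (ball x t)"
            by (simp add: ennreal_add_left_cancel_le)
          then show "\<exists>t. P x t" using t unfolding P_def by blast
        qed
      qed
      then obtain Z where Z: "Z \<in> null_sets lebesgue" "{x. \<not> (l < w x \<longrightarrow> (\<exists>t. P x t))} \<subseteq> Z"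
        by (auto simp: eventually_ae_filter)
      define E where "E = {x. l < w x} - Z"
      have "{x \<in> space lebesgue. l < w x} \<in> sets lebesgue" by measurable
      then have EM: "E \<in> sets lebesgue" unfolding E_def using Z(1) by (auto intro: sets.Diff)
      define \<rho> where "\<rho> x = (SOME t. P x t)" for x
      have \<rho>: "P x (\<rho> x)" if "x \<in> E" for x
        using that Z(2) unfolding E_def \<rho>_def by (metis (mono_tags, lifting) Diff_iff mem_Collect_eq someI subset_iff)
      define B where "B = (2 * enn2real (J l) / (K * l)) powr (1 / n)"
      have \<rho>B: "\<rho> x \<le> B" if "x \<in> E" for x
      proof -
        have p: "\<rho> x > 0" "ennreal (K * l / 2 * \<rho> x powr n) \<le> emeasure N (ball x (\<rho> x))"
          using \<rho>[OF that] by (auto simp: P_def)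
        note p(2)
        also have "\<dots> \<le> emeasure N (space N)" by (rule emeasure_space)
        also have "\<dots> = ennreal (enn2real (J l))" using Jfin[OF l] by (simp add: spN less_top)
        finally have "K * l / 2 * \<rho> x powr n \<le> enn2real (J l)"
          by (subst (asm) ennreal_le_iff) auto
        then have "\<rho> x powr n \<le> 2 * enn2real (J l) / (K * l)"
          using K l by (simp add: field_simps)
        then have "(\<rho> x powr n) powr (1 / n) \<le> B"
          unfolding B_def using \<open>n > 0\<close> by (intro powr_mono2) auto
        then show ?thesis using p(1) \<open>n > 0\<close> by (simp add: powr_powr)
      qed
      have cov: "E \<subseteq> (\<Union>i\<in>E. ball i (\<rho> i))" using \<rho> by (force simp: P_def)
      have bnd: "\<And>i. i \<in> E \<Longrightarrow> 0 < \<rho> i \<and> \<rho> i \<le> B" using \<rho> \<rho>B by (auto simp: P_def)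
      obtain C where C: "countable C" "C \<subseteq> E"
        "pairwise (\<lambda>i j. disjnt (ball i (\<rho> i)) (ball j (\<rho> j))) C"
        "E \<subseteq> (\<Union>i\<in>C. ball i (5 * \<rho> i))"
        by (rule Vitali_covering_lemma_balls[OF cov bnd])
      have "emeasure lebesgue {x. l < w x} \<le> emeasure lebesgue (E \<union> Z)"
        using sets.Un[OF EM null_setsD2[OF Z(1)]] by (intro emeasure_mono) (auto simp: E_def)
      also have "\<dots> = emeasure lebesgue E"
        using EM Z(1) by (simp add: emeasure_Un_null_set)
      also have "\<dots> \<le> ennreal (c / l) * emeasure N (space N)"
      proof (rule emeasure_le_of_disjoint_cover[where A = "\<lambda>i. ball i (\<rho> i)" and B = "\<lambda>i. ball i (5 * \<rho> i)" and C = C])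
        show "disjoint_family_on (\<lambda>i. ball i (\<rho> i)) C"
          using C(3) by (auto simp: disjoint_family_on_def pairwise_def disjnt_def)
        fix i assume "i \<in> C"
        then have p: "\<rho> i > 0" "ennreal (K * l / 2 * \<rho> i powr n) \<le> emeasure N (ball i (\<rho> i))"
          using \<rho>[of i] C(2) by (auto simp: P_def)
        have "emeasure lebesgue (ball i (5 * \<rho> i)) = ennreal (\<omega> * (5 * \<rho> i) powr n)"
          using p by (simp add: emeasure_lborel_ball_powr \<omega>_def n_def)
        also have "\<omega> * (5 * \<rho> i) powr n = c / l * (K * l / 2 * \<rho> i powr n)"
          using K l p by (simp add: c_def powr_mult)
        also have "ennreal \<dots> = ennreal (c / l) * ennreal (K * l / 2 * \<rho> i powr n)"
          using c0 l by (intro ennreal_mult') auto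
        also have "\<dots> \<le> ennreal (c / l) * emeasure N (ball i (\<rho> i))"
          by (intro mult_left_mono p) auto
        finally show "emeasure lebesgue (ball i (5 * \<rho> i)) \<le> \<dots>" .
      qed (use C in \<open>auto simp: N_def\<close>)
      finally show ?thesis by (simp add: spN)
    qed
    show "AE x in lebesgue. w x = 0"
    proof (rule AE_eq_0_if_level_sets_small[where c = c and r = r and k = "K / (2 * \<omega>)"])
      fix l :: real assume "l > 0"
      then show "emeasure lebesgue {x. l < w x} \<le> ennreal (c / l) * (\<integral>\<^sup>+ x. ennreal (w x) * indicator {x. K / (2 * \<omega>) * l < w x} x \<partial>lebesgue)"
        using level[of l] by (simp add: J_def)
    qed (use assms c0 K \<open>\<omega> > 0\<close> coef w0 fin in auto)
  qed
qed

section \<open>Integrals of powers of the norm\<close>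

text \<open>Fubini after writing \<open>norm y powr (- s)\<close> as the integral of
  \<open>s * l powr (- s - 1)\<close> over \<open>l > norm y\<close>. Stating only an inequality
  disposes of \<open>y = 0\<close>, where \<open>powr\<close> gives 0.\<close>

lemma nn_integral_norm_powr_neg:
  fixes B :: "'a::euclidean_space set"
  assumes s: "s > 0" and B[measurable]: "B \<in> sets lebesgue"
  shows "(\<integral>\<^sup>+ y\<in>B. ennreal (norm y powr (- s)) \<partial>lebesgue) \<le>
    (\<integral>\<^sup>+ l\<in>{0<..}. ennreal (s * l powr (- s - 1)) * emeasure lebesgue (B \<inter> ball 0 l) \<partial>lborel)"
proof -
  have LL: "pair_sigma_finite (lebesgue :: 'a measure) (lborel :: real measure)"
    by (intro pair_sigma_finite.intro sigma_finite_lebesgue sigma_finite_lborel)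
  have [measurable]: "norm \<in> borel_measurable (lebesgue :: 'a measure)"
    by (rule measurable_completion) simp
  have "(\<integral>\<^sup>+ y\<in>B. ennreal (norm y powr (- s)) \<partial>lebesgue) \<le>
    (\<integral>\<^sup>+ y. (\<integral>\<^sup>+ l. ennreal (s * l powr (- s - 1)) * (indicator {0<..} l * indicator B y * indicator {norm y<..} l) \<partial>lborel) \<partial>lebesgue)"
  proof (rule nn_integral_mono)
    fix y :: 'a
    show "ennreal (norm y powr (- s)) * indicator B y \<le>
      (\<integral>\<^sup>+ l. ennreal (s * l powr (- s - 1)) * (indicator {0<..} l * indicator B y * indicator {norm y<..} l) \<partial>lborel)"
    proof (cases "y = 0 \<or> y \<notin> B")
      case False
      then have y: "norm y > 0" "y \<in> B" by auto
      have "ennreal (norm y powr (- s)) = ennreal s * ennreal (norm y powr (- s) / s)"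
        using s by (subst ennreal_mult'[symmetric]) auto
      also have "\<dots> = ennreal s * (\<integral>\<^sup>+ l\<in>{norm y..}. ennreal (l powr (- s - 1)) \<partial>lborel)"
        using y s by (subst nn_integral_powr_Ici) auto
      also have "\<dots> = (\<integral>\<^sup>+ l. ennreal s * (ennreal (l powr (- s - 1)) * indicator {norm y..} l) \<partial>lborel)"
        by (intro nn_integral_cmult[symmetric]) auto
      also have "\<dots> = (\<integral>\<^sup>+ l. ennreal (s * l powr (- s - 1)) * (indicator {0<..} l * indicator B y * indicator {norm y<..} l) \<partial>lborel)"
      proof (rule nn_integral_cong_AE)
        have "AE l in lborel. l \<noteq> norm y" by (rule AE_lborel_singleton)
        then show "AE l in lborel. ennreal s * (ennreal (l powr (- s - 1)) * indicator {norm y..} l) =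
          ennreal (s * l powr (- s - 1)) * (indicator {0<..} l * indicator B y * indicator {norm y<..} l)"
        proof eventually_elim
          case (elim l)
          show ?case
          proof (cases "norm y < l")
            case True
            then have "0 < l" using y(1) by linarith
            then have "l \<in> {0<..}" "l \<in> {norm y<..}" "l \<in> {norm y..}" using True by simp_all
            then show ?thesis using y(2) s by (simp add: ennreal_mult' del: greaterThan_iff atLeast_iff)
          qed (use elim in \<open>auto simp: indicator_def\<close>)
        qed
      qed
      finally show ?thesis using y by simp
    qed auto
  qed
  also have "\<dots> = (\<integral>\<^sup>+ l. (\<integral>\<^sup>+ y. ennreal (s * l powr (- s - 1)) * (indicator {0<..} l * indicator B y * indicator {norm y<..} l) \<partial>lebesgue) \<partial>lborel)"
    by (intro pair_sigma_finite.Fubini'[OF LL, symmetric]) (simp add: indicator_def)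
  also have "\<dots> = (\<integral>\<^sup>+ l\<in>{0<..}. ennreal (s * l powr (- s - 1)) * emeasure lebesgue (B \<inter> ball 0 l) \<partial>lborel)"
  proof (rule nn_integral_cong)
    fix l :: real
    have "(\<integral>\<^sup>+ y. ennreal (s * l powr (- s - 1)) * (indicator {0<..} l * indicator B y * indicator {norm y<..} l) \<partial>lebesgue) =
       (\<integral>\<^sup>+ y. ennreal (s * l powr (- s - 1)) * indicator {0<..} l * indicator (B \<inter> ball 0 l) y \<partial>lebesgue)"
      by (intro nn_integral_cong) (auto simp: indicator_def)
    also have "\<dots> = ennreal (s * l powr (- s - 1)) * indicator {0<..} l * emeasure lebesgue (B \<inter> ball 0 l)"
      by (intro nn_integral_cmult_indicator) auto
    finally show "(\<integral>\<^sup>+ y. ennreal (s * l powr (- s - 1)) * (indicator {0<..} l * indicator B y * indicator {norm y<..} l) \<partial>lebesgue) =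
      ennreal (s * l powr (- s - 1)) * emeasure lebesgue (B \<inter> ball 0 l) * indicator {0<..} l"
      by (simp add: mult_ac)
  qed
  finally show ?thesis .
qed

text \<open>The measure of \<open>ball x t \<inter> ball 0 l\<close> is bounded by the volume of
  either ball, which makes the constant independent of the centre. Splitting the layer-cake integral
  at \<open>l = t\<close>, the part below converges since \<open>s < n\<close> and the part above
  since \<open>s > 0\<close>; for \<open>s = 0\<close> the claim is the volume formula.\<close>

lemma nn_integral_ball_norm_powr_neg_le:
  fixes s :: real
  assumes s: "0 \<le> s" "s < real DIM('a::euclidean_space)"
  shows "\<exists>K>0. \<forall>(x::'a) t. t > 0 \<longrightarrow>
    (\<integral>\<^sup>+ y\<in>ball x t. ennreal (norm y powr (- s)) \<partial>lebesgue) \<le> ennreal (K * t powr (real DIM('a) - s))"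
proof (cases "s = 0")
  case True
  show ?thesis
  proof (intro exI[of _ "unit_ball_vol (real DIM('a))"] conjI allI impI)
    fix x :: 'a and t :: real assume t: "t > 0"
    have "(\<integral>\<^sup>+ y\<in>ball x t. ennreal (norm y powr (- s)) \<partial>lebesgue) \<le> (\<integral>\<^sup>+ y. indicator (ball x t) y \<partial>lebesgue)"
      using True by (intro nn_integral_mono) (auto simp: indicator_def)
    also have "\<dots> = emeasure lebesgue (ball x t)" by (intro nn_integral_indicator) auto
    finally show "(\<integral>\<^sup>+ y\<in>ball x t. ennreal (norm y powr (- s)) \<partial>lebesgue) \<le> ennreal (unit_ball_vol (real DIM('a)) * t powr (real DIM('a) - s))"
      using t True by (simp add: emeasure_lborel_ball_powr)
  qed simp
next
  case False
  define n where "n = real DIM('a)"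
  define \<omega> where "\<omega> = unit_ball_vol n"
  have s: "s > 0" "s < n" using False assms by (auto simp: n_def)
  have \<omega>: "\<omega> > 0" by (simp add: \<omega>_def n_def)
  show ?thesis
  proof (intro exI[of _ "s * \<omega> / (n - s) + \<omega>"] conjI allI impI)
    show "0 < s * \<omega> / (n - s) + \<omega>" using s \<omega> by (intro add_nonneg_pos) auto
    fix x :: 'a and t :: real assume t: "t > 0"
    have "(\<integral>\<^sup>+ y\<in>ball x t. ennreal (norm y powr (- s)) \<partial>lebesgue) \<le>
      (\<integral>\<^sup>+ l\<in>{0<..}. ennreal (s * l powr (- s - 1)) * emeasure lebesgue (ball x t \<inter> ball 0 l) \<partial>lborel)"
      using s by (intro nn_integral_norm_powr_neg) auto
    also have "\<dots> \<le> (\<integral>\<^sup>+ l. ennreal (s * \<omega>) * (ennreal (l powr (n - s - 1)) * indicator {0..t} l) +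
        ennreal (s * \<omega> * t powr n) * (ennreal (l powr (- s - 1)) * indicator {t..} l) \<partial>lborel)"
    proof (rule nn_integral_mono)
      fix l
      show "ennreal (s * l powr (- s - 1)) * emeasure lebesgue (ball x t \<inter> ball 0 l) * indicator {0<..} l \<le>
        ennreal (s * \<omega>) * (ennreal (l powr (n - s - 1)) * indicator {0..t} l) +
        ennreal (s * \<omega> * t powr n) * (ennreal (l powr (- s - 1)) * indicator {t..} l)"
      proof -
        consider "l \<le> 0" | "0 < l" "l < t" | "t \<le> l" "0 < l" using t by linarith
        then show ?thesis
        proof cases
          case 2
          have "ennreal (s * l powr (- s - 1)) * emeasure lebesgue (ball x t \<inter> ball 0 l) \<le> ennreal (s * l powr (- s - 1)) * emeasure lebesgue (ball (0::'a) l)"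
            by (intro mult_left_mono emeasure_mono) auto
          also have "\<dots> = ennreal (s * \<omega> * l powr (n - s - 1))"
          proof -
            have "l powr (n - s - 1) = l powr (- s - 1) * l powr n"
              by (simp add: powr_add[symmetric] algebra_simps)
            then show ?thesis using 2 s \<omega>
              by (simp add: emeasure_lborel_ball_powr n_def[symmetric] \<omega>_def[symmetric] ennreal_mult'[symmetric] mult_ac)
          qed
          finally show ?thesis using 2 s \<omega> by (simp add: ennreal_mult')
        next
          case 3
          have "ennreal (s * l powr (- s - 1)) * emeasure lebesgue (ball x t \<inter> ball 0 l) \<le> ennreal (s * l powr (- s - 1)) * emeasure lebesgue (ball x t)"
            by (intro mult_left_mono emeasure_mono) auto
          also have "\<dots> = ennreal (s * \<omega> * t powr n) * ennreal (l powr (- s - 1))"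
            using t s \<omega>
            by (simp add: emeasure_lborel_ball_powr n_def[symmetric] \<omega>_def[symmetric] ennreal_mult'[symmetric] mult_ac)
          finally have le: "ennreal (s * l powr (- s - 1)) * emeasure lebesgue (ball x t \<inter> ball 0 l) \<le>
            ennreal (s * \<omega> * t powr n) * ennreal (l powr (- s - 1))" .
          have "ennreal (s * l powr (- s - 1)) * emeasure lebesgue (ball x t \<inter> ball 0 l) * indicator {0<..} l \<le>
            ennreal (s * \<omega> * t powr n) * (ennreal (l powr (- s - 1)) * indicator {t..} l)"
            using 3 le by (simp del: emeasure_completion)
          then show ?thesis by (rule add_increasing[OF zero_le])
        qed auto
      qed
    qed
    also have "\<dots> = ennreal (s * \<omega>) * (\<integral>\<^sup>+ l\<in>{0..t}. ennreal (l powr (n - s - 1)) \<partial>lborel) +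
        ennreal (s * \<omega> * t powr n) * (\<integral>\<^sup>+ l\<in>{t..}. ennreal (l powr (- s - 1)) \<partial>lborel)"
      by (simp add: nn_integral_add nn_integral_cmult)
    also have "\<dots> = ennreal (s * \<omega>) * ennreal (t powr (n - s) / (n - s)) + ennreal (s * \<omega> * t powr n) * ennreal (t powr (- s) / s)"
      using nn_integral_powr_Icc[of t "n - s"] t s by (simp add: nn_integral_powr_Ici)
    also have "\<dots> = ennreal (s * \<omega> * (t powr (n - s) / (n - s)) + s * \<omega> * t powr n * (t powr (- s) / s))"
      using s \<omega> by (simp add: ennreal_mult'[symmetric])
    also have "s * \<omega> * (t powr (n - s) / (n - s)) + s * \<omega> * t powr n * (t powr (- s) / s) = (s * \<omega> / (n - s) + \<omega>) * t powr (n - s)"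
    proof -
      have "t powr n * t powr (- s) = t powr (n - s)" by (simp add: powr_add[symmetric])
      then show ?thesis using s by (simp add: field_simps)
    qed
    finally show "(\<integral>\<^sup>+ y\<in>ball x t. ennreal (norm y powr (- s)) \<partial>lebesgue) \<le> ennreal ((s * \<omega> / (n - s) + \<omega>) * t powr (real DIM('a) - s))"
      by (simp add: n_def)
  qed
qed

text \<open>In the layer-cake integral the levels \<open>l < t\<close> contribute nothing, and
  \<open>s > n\<close> makes the others converge.\<close>

lemma nn_integral_norm_powr_neg_at_infinity:
  fixes s :: real
  assumes s: "s > real DIM('a::euclidean_space)" and t: "t > 0"
  shows "(\<integral>\<^sup>+ (y::'a)\<in>- ball 0 t. ennreal (norm y powr (- s)) \<partial>lebesgue) < \<infinity>"
proof -
  define n where "n = real DIM('a)"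
  define \<omega> where "\<omega> = unit_ball_vol n"
  have s: "s > 0" "s > n" "n > 0" using assms unfolding n_def by (auto intro: le_less_trans[of 0])
  have \<omega>: "\<omega> > 0" by (simp add: \<omega>_def n_def)
  have "(\<integral>\<^sup>+ (y::'a)\<in>- ball 0 t. ennreal (norm y powr (- s)) \<partial>lebesgue) \<le>
      (\<integral>\<^sup>+ l\<in>{0<..}. ennreal (s * l powr (- s - 1)) * emeasure lebesgue (- ball 0 t \<inter> ball (0::'a) l) \<partial>lborel)"
    using s by (intro nn_integral_norm_powr_neg) auto
  also have "\<dots> \<le> (\<integral>\<^sup>+ l. ennreal (s * \<omega>) * (ennreal (l powr (- (s - n) - 1)) * indicator {t..} l) \<partial>lborel)"
  proof (rule nn_integral_mono)
    fix l
    show "ennreal (s * l powr (- s - 1)) * emeasure lebesgue (- ball 0 t \<inter> ball (0::'a) l) * indicator {0<..} l \<le>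
        ennreal (s * \<omega>) * (ennreal (l powr (- (s - n) - 1)) * indicator {t..} l)"
    proof (cases "t \<le> l")
      case True
      have "ennreal (s * l powr (- s - 1)) * emeasure lebesgue (- ball 0 t \<inter> ball (0::'a) l) \<le> ennreal (s * l powr (- s - 1)) * emeasure lebesgue (ball (0::'a) l)"
        by (intro mult_left_mono emeasure_mono) auto
      also have "\<dots> = ennreal (s * \<omega> * l powr (- (s - n) - 1))"
      proof -
        have "l powr (- (s - n) - 1) = l powr (- s - 1) * l powr n"
          by (simp add: powr_add[symmetric] algebra_simps)
        then show ?thesis using True t s \<omega>
          by (simp add: emeasure_lborel_ball_powr n_def[symmetric] \<omega>_def[symmetric] ennreal_mult'[symmetric] mult_ac)
      qed
      finally show ?thesis using True t s \<omega> by (simp add: ennreal_mult')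
    next
      case False
      then have "- ball 0 t \<inter> ball (0::'a) l = {}" by auto
      then show ?thesis by (simp only:) simp
    qed
  qed
  also have "\<dots> = ennreal (s * \<omega>) * ennreal (t powr (- (s - n)) / (s - n))"
    using nn_integral_powr_Ici[OF t, of "s - n"] s by (subst nn_integral_cmult) auto
  also have "\<dots> < \<infinity>" by (simp add: ennreal_mult_less_top)
  finally show ?thesis .
qed

section \<open>The lower bound for solutions\<close>

lemma ex_le_mult_powr:
  fixes c e L :: real
  assumes "c > 0" "e > 0"
  shows "\<exists>r1. \<forall>r\<ge>r1. L \<le> c * r powr e"
proof (intro exI allI impI)
  fix r assume r: "(\<bar>L\<bar> / c) powr (1 / e) \<le> r"
  have "((\<bar>L\<bar> / c) powr (1 / e)) powr e \<le> r powr e"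
    using r assms by (intro powr_mono2) auto
  then show "L \<le> c * r powr e"
    using assms by (simp add: powr_powr field_simps)
qed

text \<open>The equation with its coefficient \<open>R\<close> is weakened to two inequalities with
  one constant \<open>C\<close>; the analysis of solutions uses only these.\<close>

locale wolff_solution =
  fixes \<beta> p a q C n :: real and u :: "real^'n \<Rightarrow> real"
  assumes n_def: "n = real CARD('n)"
    and \<beta>: "\<beta> > 0" and p: "p > 1" and a: "a \<le> 0" "- a < p * \<beta>" and pb: "p * \<beta> < n"
    and q: "q > 0" and C: "C > 0"
    and u_meas [measurable]: "u \<in> borel_measurable lebesgue" and u_pos: "\<And>x. 0 < u x"
    and loc: "locally_integrable (\<lambda>y. norm y powr a * u y powr q)"
    and upper: "AE x in lebesgue. ennreal (u x) \<le> ennreal C * wolff_potential \<beta> p (\<lambda>y. norm y powr a * u y powr q) x"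
    and lower: "AE x in lebesgue. wolff_potential \<beta> p (\<lambda>y. norm y powr a * u y powr q) x \<le> ennreal C * ennreal (u x)"
begin

abbreviation \<omega> :: real where "\<omega> \<equiv> unit_ball_vol n"

definition \<alpha> :: real where "\<alpha> = p * \<beta>"
definition \<gamma> :: real where "\<gamma> = 1 / (p - 1)"
text \<open>The fast rate \<open>(n - p * \<beta>) / (p - 1)\<close>. In terms of it the integrand
  of the potential becomes \<open>m x t powr \<gamma> * t powr (- b - 1)\<close>.\<close>

definition b :: real where "b = (n - \<alpha>) * \<gamma>"
definition f :: "real^'n \<Rightarrow> real" where "f y = norm y powr a * u y powr q"
definition m :: "real^'n \<Rightarrow> real \<Rightarrow> real" where "m x t = (LINT y:ball x t|lebesgue. f y)"
abbreviation F :: "real \<Rightarrow> real" where "F \<equiv> m 0"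

lemma params: "0 < \<alpha>" "\<alpha> < n" "0 < \<alpha> + a" "0 < n + a" "0 < \<gamma>" "0 < b" "0 < n" "0 < \<omega>"
  using \<beta> p a pb by (auto simp: \<alpha>_def \<gamma>_def b_def)

lemma emeasure_ball_n: "t > 0 \<Longrightarrow> emeasure lborel (ball (x::real^'n) t) = ennreal (\<omega> * t powr n)"
  by (simp add: emeasure_lborel_ball_powr n_def)

lemma f_nonneg: "0 \<le> f y" by (simp add: f_def)

lemma measurable_norm_lebesgue [measurable]: "norm \<in> borel_measurable (lebesgue :: (real^'n) measure)"
  by (rule measurable_completion) simp

lemma f_meas [measurable]: "f \<in> borel_measurable lebesgue"
  unfolding f_def[abs_def] by measurable

lemma f_integrable: "set_integrable lebesgue (ball x t) f"
proof (rule set_integrable_subset)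
  show "set_integrable lebesgue (cball x t) f"
    using loc unfolding locally_integrable_def f_def[abs_def] by (simp add: compact_cball)
qed auto

lemma nn_integral_f: "(\<integral>\<^sup>+ y\<in>ball x t. ennreal (f y) \<partial>lebesgue) = ennreal (m x t)"
proof -
  have "(\<integral>\<^sup>+ y\<in>ball x t. ennreal (f y) \<partial>lebesgue) = (\<integral>\<^sup>+ y. ennreal (indicator (ball x t) y *\<^sub>R f y) \<partial>lebesgue)"
    by (intro nn_integral_cong) (auto simp: indicator_def)
  also have "\<dots> = ennreal (m x t)"
    unfolding m_def set_lebesgue_integral_def
    using f_integrable[of x t] unfolding set_integrable_def
    by (intro nn_integral_eq_integral) (auto simp: f_nonneg)
  finally show ?thesis .
qed

lemma m_nonneg: "0 \<le> m x t"
  unfolding m_def set_lebesgue_integral_def by (intro integral_nonneg_AE) (auto simp: f_nonneg)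

lemma m_le: "ball x s \<subseteq> ball y t \<Longrightarrow> m x s \<le> m y t"
  by (subst ennreal_le_iff[symmetric, OF m_nonneg], unfold nn_integral_f[symmetric], intro nn_integral_mono)
    (auto simp: indicator_def)

lemma m_mono: "s \<le> t \<Longrightarrow> m x s \<le> m x t"
  by (intro m_le subset_ball)

lemma m_meas [measurable]: "m x \<in> borel_measurable borel"
  by (intro borel_measurable_mono monoI m_mono)

lemma AE_norm_pos: "AE x::real^'n in lebesgue. 0 < norm x"
proof -
  have "AE x::real^'n in lborel. x \<noteq> 0" by (rule AE_lborel_singleton)
  then have "AE x::real^'n in lebesgue. x \<noteq> 0" by (rule AE_completion)
  then show ?thesis by eventually_elim auto
qed

lemma m_pos: assumes "t > 0" shows "0 < m x t"
proof (rule ccontr)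
  assume "\<not> 0 < m x t"
  then have "m x t = 0" using m_nonneg[of x t] by simp
  then have "(\<integral>\<^sup>+ y\<in>ball x t. ennreal (f y) \<partial>lebesgue) = 0" by (simp add: nn_integral_f)
  then have "AE y in lebesgue. ennreal (f y) * indicator (ball x t) y = 0"
    by (subst (asm) nn_integral_0_iff_AE) auto
  then have "AE y in lebesgue. y \<notin> ball x t"
    using AE_norm_pos
  proof eventually_elim
    case (elim y)
    moreover have "0 < f y" using elim(2) u_pos[of y] by (simp add: f_def)
    ultimately show ?case by (auto simp: indicator_def split: if_splits)
  qed
  then have "emeasure lebesgue (ball x t) = 0"
    by (subst (asm) AE_iff_null) (auto simp: null_sets_def ball_def)
  then show False using assms params(8) by (simp add: emeasure_ball_n)
qed

definition W :: "real^'n \<Rightarrow> ennreal" where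
  "W x = (\<integral>\<^sup>+ t\<in>{0<..}. ennreal (m x t powr \<gamma> * t powr (- b - 1)) \<partial>lborel)"

lemma W_eq: "wolff_potential \<beta> p (\<lambda>y. norm y powr a * u y powr q) x = W x"
  unfolding wolff_potential_def W_def f_def[symmetric] m_def[symmetric] n_def[symmetric]
proof (rule nn_integral_cong)
  fix t
  have "(m x t / t powr (n - p * \<beta>)) powr (1 / (p - 1)) / t = m x t powr \<gamma> * t powr (- b - 1)" if "t > 0"
  proof -
    have "(m x t / t powr (n - p * \<beta>)) powr (1 / (p - 1)) / t = m x t powr \<gamma> / t powr b / t"
      using m_nonneg[of x t] that by (simp add: powr_divide powr_powr \<gamma>_def b_def \<alpha>_def)
    also have "\<dots> = m x t powr \<gamma> * t powr (- b - 1)"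
      using that by (simp add: powr_diff powr_minus field_simps)
    finally show ?thesis .
  qed
  then show "ennreal ((m x t / t powr (n - p * \<beta>)) powr (1 / (p - 1)) / t) * indicator {0<..} t =
    ennreal (m x t powr \<gamma> * t powr (- b - 1)) * indicator {0<..} t"
    by (auto simp: indicator_def)
qed

lemma AE_upper: "AE x in lebesgue. ennreal (u x) \<le> ennreal C * W x"
  using upper by (simp add: W_eq)

lemma AE_lower: "AE x in lebesgue. W x \<le> ennreal C * ennreal (u x)"
  using lower by (simp add: W_eq)

text \<open>The tail of the Wolff potential at the origin.  Solutions dominate a multiple of \<open>H (norm x)\<close>; for
  solutions in \<open>L\<^bsup>s0\<^esup>\<close> the converse bound holds as well.\<close>

definition HH :: "real \<Rightarrow> ennreal" where
  "HH r = (\<integral>\<^sup>+ t\<in>{r..}. ennreal (F t powr \<gamma> * t powr (- b - 1)) \<partial>lborel)"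

definition H :: "real \<Rightarrow> real" where "H r = enn2real (HH r)"

lemma HH_antimono: "r \<le> s \<Longrightarrow> HH s \<le> HH r"
  unfolding HH_def by (intro nn_integral_mono) (auto simp: indicator_def)

text \<open>For \<open>t \<ge> 2 * norm x\<close> the ball of radius \<open>t / 2\<close> about 0
  lies in \<open>ball x t\<close>; the substitution of \<open>t / 2\<close> for \<open>t\<close>
  costs the factor \<open>2 powr (- b)\<close>.\<close>

lemma HH_le_W:
  fixes x :: "real^'n"
  assumes "x \<noteq> 0"
  shows "ennreal (2 powr (- b)) * HH (norm x) \<le> W x"
proof -
  have "HH (norm x) = ennreal (1 / 2) * (\<integral>\<^sup>+ t. ennreal (F (t / 2) powr \<gamma> * (t / 2) powr (- b - 1)) * indicator {norm x..} (t / 2) \<partial>lborel)"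
    unfolding HH_def by (subst nn_integral_real_affine[where c = "1 / 2" and t = 0]) auto
  then have "ennreal (2 powr (- b)) * HH (norm x) =
    ennreal (2 powr (- b) * (1 / 2)) * (\<integral>\<^sup>+ t. ennreal (F (t / 2) powr \<gamma> * (t / 2) powr (- b - 1)) * indicator {norm x..} (t / 2) \<partial>lborel)"
    by (subst ennreal_mult') (auto simp: mult.assoc)
  also have "\<dots> = (\<integral>\<^sup>+ t. ennreal (2 powr (- b) * (1 / 2)) * (ennreal (F (t / 2) powr \<gamma> * (t / 2) powr (- b - 1)) * indicator {norm x..} (t / 2)) \<partial>lborel)"
    by (intro nn_integral_cmult[symmetric]) measurable
  also have "\<dots> \<le> W x"
    unfolding W_def
  proof (rule nn_integral_mono)
    fix t
    show "ennreal (2 powr (- b) * (1 / 2)) * (ennreal (F (t / 2) powr \<gamma> * (t / 2) powr (- b - 1)) * indicator {norm x..} (t / 2))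
      \<le> ennreal (m x t powr \<gamma> * t powr (- b - 1)) * indicator {0<..} t"
    proof (cases "norm x \<le> t / 2")
      case True
      moreover have "norm x > 0" using assms by simp
      ultimately have t: "t > 0" by linarith
      have "ball (0::real^'n) (t / 2) \<subseteq> ball x t"
      proof
        fix y :: "real^'n" assume "y \<in> ball 0 (t / 2)"
        then show "y \<in> ball x t" using True norm_triangle_ineq4[of x y] by (auto simp: dist_norm)
      qed
      then have "F (t / 2) \<le> m x t" by (rule m_le)
      then have le: "F (t / 2) powr \<gamma> \<le> m x t powr \<gamma>"
        using params m_nonneg by (intro powr_mono2) auto
      have "2 powr (- b) * (1 / 2) * (t / 2) powr (- b - 1) = t powr (- b - 1)"
        using t by (simp add: powr_divide powr_diff powr_minus field_simps)
      then have "2 powr (- b) * (1 / 2) * (F (t / 2) powr \<gamma> * (t / 2) powr (- b - 1)) = F (t / 2) powr \<gamma> * t powr (- b - 1)"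
        by (metis mult.left_commute)
      also have "\<dots> \<le> m x t powr \<gamma> * t powr (- b - 1)"
        using le by (intro mult_right_mono) auto
      finally show ?thesis using True t by (simp add: ennreal_mult'[symmetric])
    qed auto
  qed
  finally show ?thesis .
qed

lemma AE_HH_le: "AE x in lebesgue. HH (norm x) \<le> ennreal (2 powr b * C * u x)"
  using AE_lower AE_norm_pos
proof eventually_elim
  case (elim x)
  have "ennreal (2 powr (- b)) * HH (norm x) \<le> ennreal C * ennreal (u x)"
    using HH_le_W[of x] elim by auto
  then have "ennreal (2 powr b) * (ennreal (2 powr (- b)) * HH (norm x)) \<le> ennreal (2 powr b) * (ennreal C * ennreal (u x))"
    by (rule mult_left_mono) auto
  moreover have "ennreal (2 powr b) * (ennreal (2 powr (- b)) * HH (norm x)) = HH (norm x)"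
    by (simp add: mult.assoc[symmetric] ennreal_mult'[symmetric] powr_add[symmetric])
  ultimately show ?case
    using C by (simp add: ennreal_mult' mult.assoc)
qed

lemma exists_AE_in_ball:
  fixes P :: "real^'n \<Rightarrow> bool"
  assumes "AE x in lebesgue. P x" "r > 0"
  shows "\<exists>x\<in>ball 0 r. P x"
proof (rule ccontr)
  assume "\<not> ?thesis"
  then have nP: "\<And>x. P x \<Longrightarrow> x \<notin> ball 0 r" by blast
  have "AE x in lebesgue. x \<notin> ball (0::real^'n) r"
    using assms(1) by eventually_elim (rule nP)
  then have "emeasure lebesgue (ball (0::real^'n) r) = 0"
    by (subst (asm) AE_iff_null) (auto simp: null_sets_def ball_def)
  then show False using assms params(8) by (simp add: emeasure_ball_n)
qed

text \<open>As \<open>u\<close> is real valued, one good point \<open>x\<close> with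
  \<open>norm x < r\<close> suffices: \<open>HH r\<close> is at most \<open>HH (norm x)\<close>,
  hence at most a multiple of \<open>u x\<close>.\<close>

lemma HH_finite: assumes "r > 0" shows "HH r < \<infinity>"
proof -
  obtain x where "norm x < r" "HH (norm x) \<le> ennreal (2 powr b * C * u x)"
    using exists_AE_in_ball[OF AE_HH_le assms] by auto
  then have "HH r \<le> ennreal (2 powr b * C * u x)"
    using HH_antimono[of "norm x" r] by simp
  also have "\<dots> < \<infinity>" by simp
  finally show ?thesis .
qed

lemma HH_eq: "r > 0 \<Longrightarrow> HH r = ennreal (H r)"
  using HH_finite[of r] by (simp add: H_def less_top)

lemma H_nonneg: "0 \<le> H r" by (simp add: H_def)

lemma H_antimono: assumes "0 < r" "r \<le> s" shows "H s \<le> H r"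
  using HH_antimono[of r s] assms by (simp add: HH_eq H_nonneg)

text \<open>For \<open>t \<ge> r\<close> replace \<open>F t\<close> by the smaller
  \<open>F r\<close> and integrate the power.\<close>

lemma F_le_H: assumes "r > 0" shows "F r powr \<gamma> * r powr (- b) / b \<le> H r"
proof -
  have "ennreal (F r powr \<gamma> * r powr (- b) / b) = ennreal (F r powr \<gamma>) * (\<integral>\<^sup>+ t\<in>{r..}. ennreal (t powr (- b - 1)) \<partial>lborel)"
    using assms params by (subst nn_integral_powr_Ici) (auto simp: ennreal_mult'[symmetric])
  also have "\<dots> = (\<integral>\<^sup>+ t. ennreal (F r powr \<gamma>) * (ennreal (t powr (- b - 1)) * indicator {r..} t) \<partial>lborel)"
    by (intro nn_integral_cmult[symmetric]) auto
  also have "\<dots> \<le> HH r"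
    unfolding HH_def
  proof (rule nn_integral_mono)
    fix t
    show "ennreal (F r powr \<gamma>) * (ennreal (t powr (- b - 1)) * indicator {r..} t) \<le> ennreal (F t powr \<gamma> * t powr (- b - 1)) * indicator {r..} t"
      using params m_nonneg by (auto simp: indicator_def ennreal_mult'[symmetric] intro!: ennreal_leI mult_right_mono powr_mono2 m_mono)
  qed
  finally show ?thesis using assms by (simp add: HH_eq H_nonneg)
qed

lemma H_pos: assumes "r > 0" shows "0 < H r"
proof -
  have "0 < F r powr \<gamma> * r powr (- b) / b" using assms params m_pos[of r 0] by simp
  then show ?thesis using F_le_H[OF assms] by linarith
qed

text \<open>On the radii from \<open>r\<close> to \<open>2 * r\<close>, bound \<open>F t\<close> by
  \<open>F (2 * r)\<close>; this piece is then a multiple of \<open>H (2 * r)\<close> by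
  \<open>F_le_H\<close>. Doubling is what later qualifies \<open>H\<close> as a slowly varying
  weight.\<close>

lemma H_doubling: assumes "r > 0" shows "H r \<le> (1 + 2 powr b) * H (2 * r)"
proof -
  have "HH r \<le> (\<integral>\<^sup>+ t. ennreal (F (2 * r) powr \<gamma>) * (ennreal (t powr (- b - 1)) * indicator {r..} t) +
      ennreal (F t powr \<gamma> * t powr (- b - 1)) * indicator {2 * r..} t \<partial>lborel)"
    unfolding HH_def
  proof (rule nn_integral_mono)
    fix t
    show "ennreal (F t powr \<gamma> * t powr (- b - 1)) * indicator {r..} t \<le>
      ennreal (F (2 * r) powr \<gamma>) * (ennreal (t powr (- b - 1)) * indicator {r..} t) +
      ennreal (F t powr \<gamma> * t powr (- b - 1)) * indicator {2 * r..} t"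
    proof (cases "t < 2 * r")
      case True
      then have "ennreal (F t powr \<gamma> * t powr (- b - 1)) \<le> ennreal (F (2 * r) powr \<gamma>) * ennreal (t powr (- b - 1))"
        using params m_nonneg by (auto simp: ennreal_mult'[symmetric] intro!: ennreal_leI mult_right_mono powr_mono2 m_mono)
      then show ?thesis using True by (auto simp: indicator_def)
    next
      case False
      then show ?thesis using assms by (auto simp: indicator_def add_increasing)
    qed
  qed
  also have "\<dots> = ennreal (F (2 * r) powr \<gamma>) * (\<integral>\<^sup>+ t\<in>{r..}. ennreal (t powr (- b - 1)) \<partial>lborel) + HH (2 * r)"
    unfolding HH_def by (simp add: nn_integral_add nn_integral_cmult)
  also have "\<dots> = ennreal (F (2 * r) powr \<gamma> * (r powr (- b) / b) + H (2 * r))"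
    using assms params by (simp add: nn_integral_powr_Ici HH_eq ennreal_mult'[symmetric] H_nonneg)
  also have "F (2 * r) powr \<gamma> * (r powr (- b) / b) = 2 powr b * (F (2 * r) powr \<gamma> * (2 * r) powr (- b) / b)"
    using assms by (simp add: powr_mult powr_minus)
  finally have "H r \<le> 2 powr b * (F (2 * r) powr \<gamma> * (2 * r) powr (- b) / b) + H (2 * r)"
    using assms params H_nonneg by (simp add: HH_eq ennreal_plus[symmetric] del: ennreal_plus)
  also have "\<dots> \<le> 2 powr b * H (2 * r) + H (2 * r)"
    using F_le_H[of "2 * r"] assms by (intro add_right_mono mult_left_mono) auto
  finally show ?thesis by (simp add: algebra_simps)
qed

lemma AE_u_ge_H: "AE x in lebesgue. H (norm x) \<le> 2 powr b * C * u x"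
  using AE_HH_le AE_norm_pos
proof eventually_elim
  case (elim x)
  moreover have "0 \<le> 2 powr b * C * u x" using C u_pos[of x] by simp
  ultimately show ?case by (simp add: HH_eq)
qed

lemma AE_u_ge_F: "\<exists>c>0. AE x in lebesgue. c * F (norm x) powr \<gamma> * norm x powr (- b) \<le> u x"
proof (intro exI conjI)
  show "1 / (b * (2 powr b * C)) > 0" using params C by simp
  show "AE x in lebesgue. 1 / (b * (2 powr b * C)) * F (norm x) powr \<gamma> * norm x powr (- b) \<le> u x"
    using AE_u_ge_H AE_norm_pos
  proof eventually_elim
    case (elim x)
    then have "F (norm x) powr \<gamma> * norm x powr (- b) / b \<le> 2 powr b * C * u x"
      using F_le_H[of "norm x"] by linarith
    then show ?case using params C by (simp add: field_simps)
  qed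
qed

section \<open>Growth of \<open>F\<close> across dyadic shells\<close>

lemma emeasure_shell:
  assumes "r > 0"
  shows "emeasure lebesgue (ball 0 (2 * r) - ball (0::real^'n) r) = ennreal (\<omega> * (2 powr n - 1) * r powr n)"
proof -
  have "emeasure lebesgue (ball 0 (2 * r) - ball (0::real^'n) r) = emeasure lebesgue (ball (0::real^'n) (2 * r)) - emeasure lebesgue (ball (0::real^'n) r)"
    using assms by (intro emeasure_Diff) (auto simp: emeasure_ball_n)
  also have "\<dots> = ennreal (\<omega> * (2 * r) powr n - \<omega> * r powr n)"
    using assms params(8) by (simp add: emeasure_ball_n ennreal_minus)
  also have "\<omega> * (2 * r) powr n - \<omega> * r powr n = \<omega> * (2 powr n - 1) * r powr n"
    using assms by (simp add: powr_mult algebra_simps)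
  finally show ?thesis .
qed

lemma F_shell: "r > 0 \<Longrightarrow> ennreal (F (2 * r)) = ennreal (F r) + (\<integral>\<^sup>+ y\<in>ball 0 (2 * r) - ball 0 r. ennreal (f y) \<partial>lebesgue)"
proof -
  assume r: "r > 0"
  have "ennreal (F (2 * r)) = (\<integral>\<^sup>+ y. ennreal (f y) * indicator (ball 0 r) y + ennreal (f y) * indicator (ball 0 (2 * r) - ball 0 r) y \<partial>lebesgue)"
    unfolding nn_integral_f[symmetric] using r by (intro nn_integral_cong) (auto simp: indicator_def)
  also have "\<dots> = (\<integral>\<^sup>+ y\<in>ball 0 r. ennreal (f y) \<partial>lebesgue) + (\<integral>\<^sup>+ y\<in>ball 0 (2 * r) - ball 0 r. ennreal (f y) \<partial>lebesgue)"
    by (intro nn_integral_add) auto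
  finally show ?thesis by (simp add: nn_integral_f)
qed

text \<open>On a dyadic shell the weight \<open>norm y powr a\<close> is comparable to
  \<open>r powr a\<close>. As \<open>a \<le> 0\<close>, it is least at the outer radius, whence the
  factor \<open>2 powr a\<close> in the constant; the companion upper bound uses the inner radius
  instead.\<close>

lemma F_shell_lower: "\<exists>c>0. \<forall>r M. r > 0 \<longrightarrow> M \<ge> 0 \<longrightarrow> (AE x in lebesgue. r \<le> norm x \<and> norm x < 2 * r \<longrightarrow> M \<le> u x)
    \<longrightarrow> F r + c * r powr (n + a) * M powr q \<le> F (2 * r)"
proof (intro exI conjI allI impI)
  have "2 powr n > (1::real)" using params by simp
  then show "2 powr a * \<omega> * (2 powr n - 1) > 0" using params by simp
  fix r M :: real
  assume r: "r > 0" and M: "M \<ge> 0" and AE: "AE x in lebesgue. r \<le> norm x \<and> norm x < 2 * r \<longrightarrow> M \<le> u x"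
  let ?S = "ball 0 (2 * r) - ball (0::real^'n) r"
  have "ennreal ((2 * r) powr a * M powr q) * emeasure lebesgue ?S =
    (\<integral>\<^sup>+ y. ennreal ((2 * r) powr a * M powr q) * indicator ?S y \<partial>lebesgue)"
    by (intro nn_integral_cmult_indicator[symmetric]) auto
  also have "\<dots> \<le> (\<integral>\<^sup>+ y\<in>?S. ennreal (f y) \<partial>lebesgue)"
  proof (rule nn_integral_mono_AE)
    show "AE y in lebesgue. ennreal ((2 * r) powr a * M powr q) * indicator ?S y \<le> ennreal (f y) * indicator ?S y"
      using AE
    proof eventually_elim
      case (elim y)
      show ?case
      proof (cases "y \<in> ?S")
        case True
        then have "(2 * r) powr a * M powr q \<le> f y"
          unfolding f_def using elim M q a r by (intro mult_mono powr_mono2 powr_mono2') auto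
        then show ?thesis using True by (simp add: ennreal_leI)
      qed simp
    qed
  qed
  finally have "ennreal (F r) + ennreal ((2 * r) powr a * M powr q) * emeasure lebesgue ?S \<le> ennreal (F (2 * r))"
    unfolding F_shell[OF r] by (intro add_left_mono)
  moreover have "ennreal ((2 * r) powr a * M powr q) * emeasure lebesgue ?S = ennreal (2 powr a * \<omega> * (2 powr n - 1) * r powr (n + a) * M powr q)"
    unfolding emeasure_shell[OF r] using r by (subst ennreal_mult'[symmetric]) (simp_all add: powr_mult powr_add mult_ac)
  moreover have nn: "0 \<le> 2 powr a * \<omega> * (2 powr n - 1) * r powr (n + a) * M powr q"
    using params ge_one_powr_ge_zero[of 2 n] by (intro mult_nonneg_nonneg) auto
  ultimately have "ennreal (F r + 2 powr a * \<omega> * (2 powr n - 1) * r powr (n + a) * M powr q) \<le> ennreal (F (2 * r))"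
    using m_nonneg[of 0 r] nn by (subst ennreal_plus) auto
  then show "F r + 2 powr a * \<omega> * (2 powr n - 1) * r powr (n + a) * M powr q \<le> F (2 * r)"
    by (subst (asm) ennreal_le_iff) (auto simp: m_nonneg)
qed

lemma F_shell_upper: "\<exists>c>0. \<forall>r M. r > 0 \<longrightarrow> M \<ge> 0 \<longrightarrow> (AE x in lebesgue. r \<le> norm x \<and> norm x < 2 * r \<longrightarrow> u x \<le> M)
    \<longrightarrow> F (2 * r) \<le> F r + c * r powr (n + a) * M powr q"
proof (intro exI conjI allI impI)
  have "2 powr n > (1::real)" using params by simp
  then show "\<omega> * (2 powr n - 1) > 0" using params by simp
  fix r M :: real
  assume r: "r > 0" and M: "M \<ge> 0" and AE: "AE x in lebesgue. r \<le> norm x \<and> norm x < 2 * r \<longrightarrow> u x \<le> M"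
  let ?S = "ball 0 (2 * r) - ball (0::real^'n) r"
  have "(\<integral>\<^sup>+ y\<in>?S. ennreal (f y) \<partial>lebesgue) \<le> (\<integral>\<^sup>+ y. ennreal (r powr a * M powr q) * indicator ?S y \<partial>lebesgue)"
  proof (rule nn_integral_mono_AE)
    show "AE y in lebesgue. ennreal (f y) * indicator ?S y \<le> ennreal (r powr a * M powr q) * indicator ?S y"
      using AE
    proof eventually_elim
      case (elim y)
      show ?case
      proof (cases "y \<in> ?S")
        case True
        then have "f y \<le> r powr a * M powr q"
          unfolding f_def using elim M q a r less_imp_le[OF u_pos] by (intro mult_mono powr_mono2 powr_mono2') auto
        then show ?thesis using True by (simp add: ennreal_leI)
      qed simp
    qed
  qed
  also have "\<dots> = ennreal (r powr a * M powr q) * emeasure lebesgue ?S"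
    by (intro nn_integral_cmult_indicator) auto
  finally have "ennreal (F (2 * r)) \<le> ennreal (F r) + ennreal (r powr a * M powr q) * emeasure lebesgue ?S"
    unfolding F_shell[OF r] by (intro add_left_mono)
  moreover have "ennreal (r powr a * M powr q) * emeasure lebesgue ?S = ennreal (\<omega> * (2 powr n - 1) * r powr (n + a) * M powr q)"
    unfolding emeasure_shell[OF r] using r by (subst ennreal_mult'[symmetric]) (simp_all add: powr_add mult_ac)
  moreover have nn: "0 \<le> \<omega> * (2 powr n - 1) * r powr (n + a) * M powr q" using params ge_one_powr_ge_zero[of 2 n] by (intro mult_nonneg_nonneg) auto
  ultimately have "ennreal (F (2 * r)) \<le> ennreal (F r + \<omega> * (2 powr n - 1) * r powr (n + a) * M powr q)"
    using m_nonneg[of 0 r] by (subst ennreal_plus) auto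
  then show "F (2 * r) \<le> F r + \<omega> * (2 powr n - 1) * r powr (n + a) * M powr q"
    using nn m_nonneg[of 0 r] by (subst (asm) ennreal_le_iff) auto
qed

section \<open>The critical exponent and decay rates\<close>

lemma b_eq: "b / \<gamma> = n - \<alpha>"
  using params by (simp add: b_def)

lemma F_le_H_powr: assumes "r > 0" shows "F r \<le> (b * H r) powr (1 / \<gamma>) * r powr (n - \<alpha>)"
proof -
  have "F r powr \<gamma> \<le> b * H r * r powr b"
    using F_le_H[OF assms] params assms by (simp add: powr_minus field_simps)
  then have "(F r powr \<gamma>) powr (1 / \<gamma>) \<le> (b * H r * r powr b) powr (1 / \<gamma>)"
    using params by (intro powr_mono2) auto
  then show ?thesis
    using params m_nonneg[of 0 r] H_nonneg[of r] assms by (simp add: powr_powr powr_mult b_eq)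
qed

text \<open>Convergence of the tail limits the growth of \<open>F\<close>: \<open>H\<close> is
  decreasing, so \<open>H 1\<close> serves in \<open>F_le_H_powr\<close> for all
  \<open>r \<ge> 1\<close>. The iteration for subcritical exponents runs into this bound.\<close>

lemma F_le_powr: "\<exists>K>0. \<forall>r\<ge>1. F r \<le> K * r powr (n - \<alpha>)"
proof (intro exI conjI allI impI)
  show "0 < (b * H 1) powr (1 / \<gamma>)" using H_pos[of 1] params by simp
  fix r :: real assume r: "r \<ge> 1"
  then have "(b * H r) powr (1 / \<gamma>) \<le> (b * H 1) powr (1 / \<gamma>)"
    using params H_nonneg H_antimono[of 1 r] by (intro powr_mono2 mult_left_mono) auto
  then have "(b * H r) powr (1 / \<gamma>) * r powr (n - \<alpha>) \<le> (b * H 1) powr (1 / \<gamma>) * r powr (n - \<alpha>)"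
    by (intro mult_right_mono) auto
  then show "F r \<le> (b * H 1) powr (1 / \<gamma>) * r powr (n - \<alpha>)" using F_le_H_powr[of r] r by linarith
qed

text \<open>On the shell, \<open>u\<close> is at least a multiple of
  \<open>F r powr \<gamma> * r powr (- b)\<close>. Its power \<open>q\<close> times
  \<open>r powr (n + a)\<close> produces the exponent \<open>n + a - q * b\<close>, which is
  nonnegative exactly for critical and subcritical \<open>q\<close>.\<close>

lemma F_growth: "\<exists>c>0. \<forall>r>0. F r + c * r powr (n + a - q * b) * F r powr (\<gamma> * q) \<le> F (2 * r)"
proof -
  obtain c where c: "c > 0" and lo: "AE x in lebesgue. c * F (norm x) powr \<gamma> * norm x powr (- b) \<le> u x"
    using AE_u_ge_F by blast
  obtain d where d: "d > 0" and sh: "\<And>r M. r > 0 \<Longrightarrow> M \<ge> 0 \<Longrightarrow> (AE x in lebesgue. r \<le> norm x \<and> norm x < 2 * r \<longrightarrow> M \<le> u x)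
    \<Longrightarrow> F r + d * r powr (n + a) * M powr q \<le> F (2 * r)"
    using F_shell_lower by blast
  show ?thesis
  proof (intro exI conjI allI impI)
    show "d * (c * 2 powr (- b)) powr q > 0" using c d by simp
    fix r :: real assume r: "r > 0"
    let ?M = "c * 2 powr (- b) * F r powr \<gamma> * r powr (- b)"
    have "F r + d * r powr (n + a) * ?M powr q \<le> F (2 * r)"
    proof (rule sh[OF r])
      show "0 \<le> ?M" using c by simp
      show "AE x in lebesgue. r \<le> norm x \<and> norm x < 2 * r \<longrightarrow> ?M \<le> u x"
        using lo
      proof (eventually_elim, intro impI)
        fix x :: "real^'n" assume x: "c * F (norm x) powr \<gamma> * norm x powr (- b) \<le> u x" "r \<le> norm x \<and> norm x < 2 * r"
        have "?M = c * F r powr \<gamma> * (2 * r) powr (- b)" using r by (simp add: powr_mult)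
        also have "\<dots> \<le> c * F (norm x) powr \<gamma> * norm x powr (- b)"
          using x r c params m_nonneg by (intro mult_mono powr_mono2 powr_mono2' m_mono) auto
        finally show "?M \<le> u x" using x by simp
      qed
    qed
    moreover have "d * r powr (n + a) * ?M powr q = d * (c * 2 powr (- b)) powr q * r powr (n + a - q * b) * F r powr (\<gamma> * q)"
    proof -
      have "?M powr q = (c * 2 powr (- b)) powr q * F r powr (\<gamma> * q) * r powr (- (q * b))"
        using c r m_nonneg by (simp add: powr_mult powr_powr mult_ac)
      moreover have "r powr (n + a - q * b) = r powr (n + a) * r powr (- (q * b))"
        by (simp add: powr_add[symmetric])
      ultimately show ?thesis by (simp only: mult_ac)
    qed
    ultimately show "F r + d * (c * 2 powr (- b)) powr q * r powr (n + a - q * b) * F r powr (\<gamma> * q) \<le> F (2 * r)"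
      by simp
  qed
qed

text \<open>\<open>F_le_powr\<close> permits only a factor \<open>2 powr (n - \<alpha>)\<close> per
  doubling on average; the extra factor 2 accumulates to \<open>2 ^ i\<close>.\<close>

lemma not_eventually_doubling:
  assumes r0: "r0 \<ge> 1" and dbl: "\<And>r. r \<ge> r0 \<Longrightarrow> 2 * 2 powr (n - \<alpha>) * F r \<le> F (2 * r)"
  shows False
proof -
  obtain K where FK: "\<And>r. r \<ge> 1 \<Longrightarrow> F r \<le> K * r powr (n - \<alpha>)"
    using F_le_powr by blast
  have it: "2 ^ i * ((2 ^ i) powr (n - \<alpha>) * F r0) \<le> F (2 ^ i * r0)" for i :: nat
  proof (induction i)
    case (Suc i)
    have "2 ^ Suc i * ((2 ^ Suc i) powr (n - \<alpha>) * F r0) = 2 * 2 powr (n - \<alpha>) * (2 ^ i * ((2 ^ i) powr (n - \<alpha>) * F r0))"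
      by (simp add: powr_mult)
    also have "\<dots> \<le> 2 * 2 powr (n - \<alpha>) * F (2 ^ i * r0)"
      by (intro mult_left_mono Suc) auto
    also have "\<dots> \<le> F (2 * (2 ^ i * r0))"
      using r0 by (intro dbl) (simp add: mult_le_cancel_right1)
    finally show ?case by (simp add: mult.assoc)
  qed auto
  have "2 ^ i * F r0 \<le> K * r0 powr (n - \<alpha>)" for i :: nat
  proof -
    have "2 ^ i * ((2 ^ i) powr (n - \<alpha>) * F r0) \<le> K * (2 ^ i * r0) powr (n - \<alpha>)"
      using it[of i] FK[of "2 ^ i * r0"] r0 mult_mono[of 1 "2 ^ i" 1 r0] by force
    also have "\<dots> = (2 ^ i) powr (n - \<alpha>) * (K * r0 powr (n - \<alpha>))"
      using r0 by (simp add: powr_mult)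
    finally have "(2 ^ i) powr (n - \<alpha>) * (2 ^ i * F r0) \<le> (2 ^ i) powr (n - \<alpha>) * (K * r0 powr (n - \<alpha>))"
      by (simp add: mult_ac)
    then show ?thesis by (subst (asm) mult_le_cancel_left_pos) auto
  qed
  moreover obtain i :: nat where "K * r0 powr (n - \<alpha>) / F r0 < 2 ^ i"
    using real_arch_pow[of 2] by auto
  ultimately show False
    using m_pos[of r0 0] r0 by (simp add: divide_less_eq) (meson not_less)
qed

text \<open>Iterating the growth inequality for \<open>F\<close> along \<open>F r, F (2r), \<dots>\<close> violates the bound
  \<open>F r = O(r\<^bsup>n - \<alpha>\<^esup>)\<close> unless the exponent is supercritical.\<close>

lemma exponent_supercritical: "n + a < q * b"
proof (rule ccontr)
  assume "\<not> n + a < q * b"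
  then have e: "n + a - q * b \<ge> 0" by simp
  define k where "k = \<gamma> * q"
  have kpos: "k > 0" using params q by (simp add: k_def)
  obtain c where c: "c > 0" and gr: "\<And>r. r > 0 \<Longrightarrow> F r + c * r powr (n + a - q * b) * F r powr k \<le> F (2 * r)"
    using F_growth unfolding k_def by blast
  define L where "L = 2 * 2 powr (n - \<alpha>)"
  have Fpos: "F r > 0" if "r > 0" for r using m_pos[OF that] .
  show False
  proof (cases "k \<le> 1")
    case True
    obtain K where Kpos: "K > 0" and FK: "\<And>r. r \<ge> 1 \<Longrightarrow> F r \<le> K * r powr (n - \<alpha>)"
      using F_le_powr by blast
    \<comment> \<open>For \<open>k \<le> 1\<close> the factor \<open>F r powr (k - 1)\<close> is
      bounded below through the upper bound on \<open>F\<close>. The powers of \<open>r\<close>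
      combine to \<open>\<alpha> + a > 0\<close>, because
      \<open>q * b = (n - \<alpha>) * k\<close>.\<close>
    obtain r1 where r1: "\<And>r. r \<ge> r1 \<Longrightarrow> L \<le> c * K powr (k - 1) * r powr (\<alpha> + a)"
      using ex_le_mult_powr[of "c * K powr (k - 1)" "\<alpha> + a" L] c Kpos params by auto
    show False
    proof (rule not_eventually_doubling[of "max 1 r1"])
      fix r assume r: "r \<ge> max 1 r1"
      have "(K * r powr (n - \<alpha>)) powr (k - 1) \<le> F r powr (k - 1)"
        using True r Fpos FK by (intro powr_mono2') auto
      then have "K powr (k - 1) * r powr ((n - \<alpha>) * (k - 1)) \<le> F r powr (k - 1)"
        using r Kpos by (simp add: powr_mult powr_powr)
      have "L * F r \<le> c * K powr (k - 1) * r powr (\<alpha> + a) * F r"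
        using r1[of r] r Fpos[of r] by (intro mult_right_mono) auto
      also have "r powr (\<alpha> + a) = r powr (n + a - q * b) * r powr ((n - \<alpha>) * (k - 1))"
        by (simp add: powr_add[symmetric] k_def b_def algebra_simps)
      also have "c * K powr (k - 1) * (r powr (n + a - q * b) * r powr ((n - \<alpha>) * (k - 1))) * F r =
        c * r powr (n + a - q * b) * (F r * (K powr (k - 1) * r powr ((n - \<alpha>) * (k - 1))))"
        by simp
      also have "\<dots> \<le> c * r powr (n + a - q * b) * (F r * F r powr (k - 1))"
        using c Fpos[of r] r \<open>K powr (k - 1) * r powr ((n - \<alpha>) * (k - 1)) \<le> F r powr (k - 1)\<close>
        by (intro mult_left_mono) auto
      also have "F r * F r powr (k - 1) = F r powr k"
        using Fpos[of r] r by (simp add: powr_mult_base)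
      also have "c * r powr (n + a - q * b) * F r powr k \<le> F (2 * r)"
        using gr[of r] r Fpos[of r] by simp
      finally show "2 * 2 powr (n - \<alpha>) * F r \<le> F (2 * r)" by (simp add: L_def)
    qed simp
  next
    case False
    \<comment> \<open>For \<open>k > 1\<close> the inequality is superlinear in \<open>F\<close>, so
      it suffices that \<open>F\<close> is unbounded. Even at the critical exponent every doubling
      adds at least the fixed amount \<open>d\<close>.\<close>
    define d where "d = c * F 1 powr k"
    have dpos: "d > 0" using c Fpos[of 1] by (simp add: d_def)
    have lin: "real i * d \<le> F (2 ^ i)" for i :: nat
    proof (induction i)
      case (Suc i)
      have "F 1 powr k \<le> F (2 ^ i) powr k"
        using kpos m_nonneg by (intro powr_mono2 m_mono) auto
      moreover have "1 \<le> (2 ^ i) powr (n + a - q * b)"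
        using e by (intro ge_one_powr_ge_zero) auto
      ultimately have "1 * F 1 powr k \<le> (2 ^ i) powr (n + a - q * b) * F (2 ^ i) powr k"
        by (intro mult_mono) auto
      then have "d \<le> c * ((2 ^ i) powr (n + a - q * b) * F (2 ^ i) powr k)"
        unfolding d_def using c by (intro mult_left_mono) auto
      then show ?case using Suc gr[of "2 ^ i"] by (simp add: algebra_simps)
    qed (simp add: m_nonneg)
    obtain i :: nat where i: "(L / c) powr (1 / (k - 1)) \<le> real i * d"
      using reals_Archimedean3[OF dpos] less_imp_le by blast
    show False
    proof (rule not_eventually_doubling[of "2 ^ i"])
      fix r :: real assume r: "r \<ge> 2 ^ i"
      then have r1: "r \<ge> 1" using order_trans[of 1 "2 ^ i" r] by simp
      have "(L / c) powr (1 / (k - 1)) \<le> F r"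
        using i lin[of i] m_mono[OF r] by (smt (verit))
      then have "((L / c) powr (1 / (k - 1))) powr (k - 1) \<le> F r powr (k - 1)"
        using False by (intro powr_mono2) auto
      then have "L \<le> c * F r powr (k - 1)"
        using False c by (simp add: powr_powr L_def field_simps)
      then have "L * F r \<le> c * F r powr (k - 1) * F r"
        using Fpos[of r] r1 by (intro mult_right_mono) auto
      also have "\<dots> = c * F r powr k"
        using Fpos[of r] r1 by (simp add: powr_mult_base mult.commute[of _ "F r"] mult.left_commute)
      also have "\<dots> \<le> c * r powr (n + a - q * b) * F r powr k"
        using c e r1 ge_one_powr_ge_zero[of r "n + a - q * b"] by (simp add: mult_le_cancel_right1 mult_right_mono)
      also have "\<dots> \<le> F (2 * r)"
        using gr[of r] r1 Fpos[of r] by simp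
      finally show "2 * 2 powr (n - \<alpha>) * F r \<le> F (2 * r)" by (simp add: L_def)
    qed simp
  qed
qed

section \<open>Constraints on decay rates\<close>

lemma exists_AE_in_shell:
  fixes P :: "real^'n \<Rightarrow> bool"
  assumes "AE x in lebesgue. P x" "r > 0"
  shows "\<exists>x. r \<le> norm x \<and> P x"
proof (rule ccontr)
  assume "\<not> ?thesis"
  then have nP: "\<And>x. P x \<Longrightarrow> x \<notin> ball 0 (2 * r) - ball 0 r"
    by (metis Diff_iff mem_ball_0 not_less)
  have "AE x in lebesgue. x \<notin> ball 0 (2 * r) - ball (0::real^'n) r"
    using assms(1) by eventually_elim (rule nP)
  then have "emeasure lebesgue (ball 0 (2 * r) - ball (0::real^'n) r) = 0"
    by (subst (asm) AE_iff_null_sets[symmetric]) auto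
  then have "\<omega> * (2 powr n - 1) * r powr n \<le> 0"
    unfolding emeasure_shell[OF assms(2)] by (simp only: ennreal_eq_0_iff)
  moreover have "2 powr n > (1::real)" using params(7) by simp
  then have "0 < \<omega> * (2 powr n - 1) * r powr n"
    using assms params(8) by (intro mult_pos_pos) auto
  ultimately show False by linarith
qed

text \<open>The lower decay bound makes \<open>F s\<close> at least a multiple of
  \<open>s powr (n + a - q * \<theta>)\<close>, and \<open>AE_u_ge_F\<close> turns this into a new
  lower bound for \<open>u\<close>. It must not outgrow the upper decay bound, which is a condition
  on the exponents alone.\<close>

lemma decay_rate_ge:
  assumes "decays_with_rate \<theta> u"
  shows "\<alpha> + a \<le> (q - (p - 1)) * \<theta>"
proof -
  obtain c C' \<rho> where c: "0 < c" "0 < \<rho>" "c \<le> C'"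
    and dec: "AE x in lebesgue. norm x > \<rho> \<longrightarrow> c * norm x powr (- \<theta>) \<le> u x \<and> u x \<le> C' * norm x powr (- \<theta>)"
    using assms unfolding decays_with_rate_def by blast
  obtain c2 where c2: "c2 > 0" and lo: "AE x in lebesgue. c2 * F (norm x) powr \<gamma> * norm x powr (- b) \<le> u x"
    using AE_u_ge_F by blast
  obtain d where d: "d > 0" and sh: "\<And>r M. r > 0 \<Longrightarrow> M \<ge> 0 \<Longrightarrow> (AE x in lebesgue. r \<le> norm x \<and> norm x < 2 * r \<longrightarrow> M \<le> u x)
    \<Longrightarrow> F r + d * r powr (n + a) * M powr q \<le> F (2 * r)"
    using F_shell_lower by blast
  \<comment> \<open>The minimum treats both signs of \<open>\<theta>\<close>: on the shell
    \<open>norm x powr (- \<theta>)\<close> is least at the outer radius if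
    \<open>\<theta> \<ge> 0\<close> and at the inner one otherwise.\<close>
  define k where "k = c * min 1 (2 powr (- \<theta>))"
  have k: "k > 0" using c by (simp add: k_def)
  define d2 where "d2 = d * k powr q * 2 powr (- (n + a - q * \<theta>))"
  have d2: "d2 > 0" using d k by (simp add: d2_def)
  have Flow: "d2 * s powr (n + a - q * \<theta>) \<le> F s" if "s > 2 * \<rho>" for s
  proof -
    define r where "r = s / 2"
    have r: "r > \<rho>" "r > 0" "s = 2 * r" using that c by (auto simp: r_def)
    have "F r + d * r powr (n + a) * (k * r powr (- \<theta>)) powr q \<le> F (2 * r)"
    proof (rule sh)
      show "AE x in lebesgue. r \<le> norm x \<and> norm x < 2 * r \<longrightarrow> k * r powr (- \<theta>) \<le> u x"
        using dec
      proof (eventually_elim, intro impI)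
        fix x :: "real^'n"
        assume x: "norm x > \<rho> \<longrightarrow> c * norm x powr (- \<theta>) \<le> u x \<and> u x \<le> C' * norm x powr (- \<theta>)" "r \<le> norm x \<and> norm x < 2 * r"
        have "min 1 (2 powr (- \<theta>)) * r powr (- \<theta>) \<le> norm x powr (- \<theta>)"
        proof (cases "\<theta> \<ge> 0")
          case True
          have "min 1 (2 powr (- \<theta>)) * r powr (- \<theta>) \<le> 2 powr (- \<theta>) * r powr (- \<theta>)"
            by (intro mult_right_mono) auto
          also have "\<dots> = (2 * r) powr (- \<theta>)" using r by (simp add: powr_mult)
          also have "\<dots> \<le> norm x powr (- \<theta>)" using x r True by (intro powr_mono2') auto
          finally show ?thesis .
        next
          case False
          have "min 1 (2 powr (- \<theta>)) * r powr (- \<theta>) \<le> 1 * r powr (- \<theta>)"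
            by (intro mult_right_mono) auto
          also have "\<dots> \<le> norm x powr (- \<theta>)" using x r False by (simp add: powr_mono2)
          finally show ?thesis .
        qed
        then have "k * r powr (- \<theta>) \<le> c * norm x powr (- \<theta>)"
          unfolding k_def using c by (simp add: mult.assoc)
        then show "k * r powr (- \<theta>) \<le> u x" using x r by auto
      qed
    qed (use k r in auto)
    moreover have "d * r powr (n + a) * (k * r powr (- \<theta>)) powr q = d2 * s powr (n + a - q * \<theta>)"
    proof -
      have "d * r powr (n + a) * (k * r powr (- \<theta>)) powr q = d * k powr q * (r powr (n + a) * r powr (- (q * \<theta>)))"
        using k r by (simp add: powr_mult powr_powr mult_ac)
      also have "r powr (n + a) * r powr (- (q * \<theta>)) = r powr (n + a - q * \<theta>)"
        by (simp add: powr_add[symmetric])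
      also have "\<dots> = 2 powr (- (n + a - q * \<theta>)) * s powr (n + a - q * \<theta>)"
        unfolding r(3) using r by (simp add: powr_mult mult.assoc[symmetric] powr_add[symmetric])
      finally show ?thesis by (simp add: d2_def mult_ac)
    qed
    ultimately show ?thesis using m_nonneg[of 0 r] r by simp
  qed
  \<comment> \<open>The exponent of the new lower bound relative to the upper bound
    \<open>norm x powr (- \<theta>)\<close>; a positive \<open>e\<close> would contradict the two
    bounds far out.\<close>
  define e where "e = \<gamma> * (\<alpha> + a - q * \<theta>) + \<theta>"
  define c3 where "c3 = c2 * d2 powr \<gamma>"
  have c3: "c3 > 0" using c2 d2 by (simp add: c3_def)
  have AE: "AE x::real^'n in lebesgue. norm x > 2 * \<rho> \<longrightarrow> c3 * norm x powr e \<le> C'"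
    using dec lo
  proof eventually_elim
    case (elim x)
    show ?case
    proof
      assume "norm x > 2 * \<rho>"
      note x = elim this
      define s where "s = norm x"
      have s: "s > 0" using x c unfolding s_def by linarith
      have "d2 powr \<gamma> * s powr (\<gamma> * (n + a - q * \<theta>)) = (d2 * s powr (n + a - q * \<theta>)) powr \<gamma>"
        using d2 by (simp add: powr_mult powr_powr mult.commute)
      also have "\<dots> \<le> F s powr \<gamma>"
        using Flow[of s] x(3) d2 params unfolding s_def by (intro powr_mono2) auto
      finally have "c2 * (d2 powr \<gamma> * s powr (\<gamma> * (n + a - q * \<theta>))) * s powr (- b) \<le> c2 * F s powr \<gamma> * s powr (- b)"
        using c2 by (intro mult_right_mono mult_left_mono) auto
      also have "\<dots> \<le> u x" using x by (simp add: s_def)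
      also have "\<dots> \<le> C' * s powr (- \<theta>)" using x c by (auto simp: s_def)
      finally have "c2 * (d2 powr \<gamma> * s powr (\<gamma> * (n + a - q * \<theta>))) * s powr (- b) * s powr \<theta> \<le> C' * s powr (- \<theta>) * s powr \<theta>"
        by (intro mult_right_mono) auto
      also have "C' * s powr (- \<theta>) * s powr \<theta> = C'" using s by (simp add: powr_minus)
      also have "c2 * (d2 powr \<gamma> * s powr (\<gamma> * (n + a - q * \<theta>))) * s powr (- b) * s powr \<theta> =
        c3 * (s powr (\<gamma> * (n + a - q * \<theta>)) * s powr (- b) * s powr \<theta>)" by (simp add: c3_def)
      also have "s powr (\<gamma> * (n + a - q * \<theta>)) * s powr (- b) * s powr \<theta> = s powr e"
        by (simp add: powr_add[symmetric] e_def b_def algebra_simps)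
      finally show "c3 * norm x powr e \<le> C'" by (simp add: s_def)
    qed
  qed
  have "e \<le> 0"
  proof (rule ccontr)
    assume "\<not> e \<le> 0"
    then obtain r1 where r1: "\<And>r. r \<ge> r1 \<Longrightarrow> C' + 1 \<le> c3 * r powr e"
      using ex_le_mult_powr[OF c3, of e "C' + 1"] by auto
    obtain x :: "real^'n" where "max r1 (2 * \<rho> + 1) \<le> norm x" "norm x > 2 * \<rho> \<longrightarrow> c3 * norm x powr e \<le> C'"
    proof -
      have "0 < max r1 (2 * \<rho> + 1)" using c by (simp add: less_max_iff_disj)
      then show ?thesis using exists_AE_in_shell[OF AE] that by blast
    qed
    then show False using r1[of "norm x"] by auto
  qed
  then have "(p - 1) * e \<le> 0" using p by (simp add: mult_le_0_iff)
  moreover have "(p - 1) * e = \<alpha> + a - q * \<theta> + (p - 1) * \<theta>"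
    using p by (simp add: e_def \<gamma>_def distrib_left)
  ultimately show ?thesis by (simp add: algebra_simps)
qed

lemma in_L_if_fast_decay:
  assumes "in_L_infinity u" "decays_with_rate \<theta> u" "n < \<theta> * s" "s > 0"
  shows "in_L s u"
proof -
  obtain M where M: "AE x in lebesgue. \<bar>u x\<bar> \<le> M" using assms(1) by (auto simp: in_L_infinity_def)
  obtain c C' \<rho> where c: "0 < c" "0 < \<rho>" "c \<le> C'"
    and dec: "AE x in lebesgue. norm x > \<rho> \<longrightarrow> c * norm x powr (- \<theta>) \<le> u x \<and> u x \<le> C' * norm x powr (- \<theta>)"
    using assms(2) unfolding decays_with_rate_def by blast
  define r where "r = \<rho> + 1"
  have r: "r > \<rho>" "r > 0" using c by (auto simp: r_def)
  have "(\<integral>\<^sup>+ x. ennreal (\<bar>u x\<bar> powr s) \<partial>lebesgue) \<le>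
    (\<integral>\<^sup>+ (x::real^'n). ennreal (\<bar>M\<bar> powr s) * indicator (ball 0 r) x + ennreal (C' powr s) * (ennreal (norm x powr (- (\<theta> * s))) * indicator (- ball 0 r) x) \<partial>lebesgue)"
  proof (rule nn_integral_mono_AE)
    show "AE x in lebesgue. ennreal (\<bar>u x\<bar> powr s) \<le> ennreal (\<bar>M\<bar> powr s) * indicator (ball 0 r) x + ennreal (C' powr s) * (ennreal (norm x powr (- (\<theta> * s))) * indicator (- ball 0 r) x)"
      using M dec
    proof eventually_elim
      case (elim x)
      show ?case
      proof (cases "norm x < r")
        case True
        have "\<bar>u x\<bar> powr s \<le> \<bar>M\<bar> powr s" using elim assms by (intro powr_mono2) auto
        then show ?thesis using True by (simp add: ennreal_leI)
      next
        case False
        then have "\<bar>u x\<bar> powr s \<le> (C' * norm x powr (- \<theta>)) powr s"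
          using elim assms r u_pos[of x] by (intro powr_mono2) auto
        also have "\<dots> = C' powr s * norm x powr (- (\<theta> * s))"
          using c by (simp add: powr_mult powr_powr)
        finally show ?thesis using False by (simp add: ennreal_mult'[symmetric] ennreal_leI)
      qed
    qed
  qed
  also have "\<dots> = ennreal (\<bar>M\<bar> powr s) * emeasure lebesgue (ball (0::real^'n) r) +
      ennreal (C' powr s) * (\<integral>\<^sup>+ (x::real^'n)\<in>- ball 0 r. ennreal (norm x powr (- (\<theta> * s))) \<partial>lebesgue)"
    by (subst nn_integral_add) (auto simp: nn_integral_cmult nn_integral_cmult_indicator)
  also have "\<dots> < \<infinity>"
    using nn_integral_norm_powr_neg_at_infinity[where 'a="real^'n", of "\<theta> * s" r] assms r
    by (simp add: emeasure_ball_n ennreal_mult_less_top n_def[symmetric])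
  finally show ?thesis by (simp add: in_L_def)
qed

text \<open>This is supercriticality rewritten: the power \<open>s0\<close> of a function with the
  fast rate is integrable at infinity.\<close>

lemma n_less_b_s0:
  assumes "q > p - 1"
  shows "n < b * (n * (q - p + 1) / (p * \<beta> + a))"
proof -
  have "(p - 1) * b = n - \<alpha>" using p by (simp add: b_def \<gamma>_def)
  then have "\<alpha> + a < b * (q - p + 1)" using exponent_supercritical by (simp add: algebra_simps)
  then have "n * (\<alpha> + a) < n * (b * (q - p + 1))" using params by simp
  then have "n < n * (b * (q - p + 1)) / (\<alpha> + a)" using params by (subst pos_less_divide_eq) auto
  also have "\<dots> = b * (n * (q - p + 1) / (p * \<beta> + a))" by (simp add: \<alpha>_def)
  finally show ?thesis .
qed

text \<open>A converse to \<open>F_le_H\<close>, by integrating the assumed power bound. The bound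
  is normalised at \<open>r\<close>, so \<open>V\<close> plays the role of \<open>F r\<close>; it is
  used with \<open>s1\<close>, with a small exponent, and with 0.\<close>

lemma H_le_of_growth:
  assumes r: "r > 0" and s: "s * \<gamma> < b" and V: "V \<ge> 0"
    and F: "\<And>t. t \<ge> r \<Longrightarrow> F t \<le> V * (t / r) powr s"
  shows "H r \<le> V powr \<gamma> * r powr (- b) / (b - s * \<gamma>)"
proof -
  have "HH r \<le> (\<integral>\<^sup>+ t. ennreal (V powr \<gamma> * r powr (- (s * \<gamma>))) * (ennreal (t powr (- (b - s * \<gamma>) - 1)) * indicator {r..} t) \<partial>lborel)"
    unfolding HH_def
  proof (rule nn_integral_mono)
    fix t
    show "ennreal (F t powr \<gamma> * t powr (- b - 1)) * indicator {r..} t \<le>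
      ennreal (V powr \<gamma> * r powr (- (s * \<gamma>))) * (ennreal (t powr (- (b - s * \<gamma>) - 1)) * indicator {r..} t)"
    proof (cases "r \<le> t")
      case True
      have "F t powr \<gamma> \<le> (V * (t / r) powr s) powr \<gamma>"
        using params m_nonneg F[OF True] by (intro powr_mono2) auto
      also have "\<dots> = V powr \<gamma> * r powr (- (s * \<gamma>)) * t powr (s * \<gamma>)"
        using r V True by (simp add: powr_mult powr_powr powr_divide powr_minus field_simps)
      finally have "F t powr \<gamma> * t powr (- b - 1) \<le> V powr \<gamma> * r powr (- (s * \<gamma>)) * t powr (s * \<gamma>) * t powr (- b - 1)"
        by (intro mult_right_mono) auto
      also have "\<dots> = V powr \<gamma> * r powr (- (s * \<gamma>)) * t powr (s * \<gamma> + (- b - 1))"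
        by (simp add: powr_add)
      also have "s * \<gamma> + (- b - 1) = - (b - s * \<gamma>) - 1" by simp
      finally show ?thesis using True by (simp add: ennreal_mult'[symmetric] ennreal_leI)
    qed simp
  qed
  also have "\<dots> = ennreal (V powr \<gamma> * r powr (- (s * \<gamma>))) * ennreal (r powr (- (b - s * \<gamma>)) / (b - s * \<gamma>))"
    using nn_integral_powr_Ici[OF r, of "b - s * \<gamma>"] s by (subst nn_integral_cmult) auto
  also have "\<dots> = ennreal (V powr \<gamma> * r powr (- (s * \<gamma>)) * (r powr (- (b - s * \<gamma>)) / (b - s * \<gamma>)))"
    by (intro ennreal_mult'[symmetric]) auto
  also have "V powr \<gamma> * r powr (- (s * \<gamma>)) * (r powr (- (b - s * \<gamma>)) / (b - s * \<gamma>)) = V powr \<gamma> * r powr (- b) / (b - s * \<gamma>)"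
  proof -
    have "r powr (- (s * \<gamma>)) * r powr (- (b - s * \<gamma>)) = r powr (- b)" by (simp add: powr_add[symmetric])
    then show ?thesis by simp
  qed
  finally show ?thesis using r s by (simp add: HH_eq)
qed

section \<open>Integrable solutions\<close>

lemma nn_integral_ball_norm_powr:
  assumes "0 \<le> s" "s < n"
  shows "\<exists>K>0. \<forall>(x::real^'n) t. t > 0 \<longrightarrow>
    (\<integral>\<^sup>+ y\<in>ball x t. ennreal (norm y powr (- s)) \<partial>lebesgue) \<le> ennreal (K * t powr (n - s))"
  using nn_integral_ball_norm_powr_neg_le[where 'a="real^'n", of s] assms by (simp add: n_def)

text \<open>In substance Hoelder's inequality with exponents \<open>e\<close> and
  \<open>e' = e / (e - 1)\<close>: the hypothesis on \<open>e\<close> says exactly that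
  \<open>- a * e' < n\<close>, so the weight raised to \<open>e'\<close> is locally integrable. Up
  to a volume constant, \<open>g\<close> bounds the mean of \<open>u\<close> of order
  \<open>q * e\<close>.\<close>

lemma m_le_of_power_mean:
  assumes e: "n < e * (n + a)"
  shows "\<exists>K>0. \<forall>x t g. t > 0 \<longrightarrow> g > 0 \<longrightarrow>
    (\<integral>\<^sup>+ y\<in>ball x t. ennreal (u y powr (q * e)) \<partial>lebesgue) \<le> ennreal (t powr n * g powr (q * e)) \<longrightarrow>
    m x t \<le> K * t powr (n + a) * g powr q"
proof -
  have e1: "e > 1"
  proof (rule ccontr)
    assume "\<not> e > 1"
    then have "e * (n + a) \<le> 1 * (n + a)" using params by (intro mult_right_mono) auto
    then show False using e a by simp
  qed
  define e' where "e' = e / (e - 1)"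
  have e': "e' > 1" "1 / e' + 1 / e = 1" using e1 by (auto simp: e'_def field_simps)
  have s: "0 \<le> - a * e'" "- a * e' < n"
    using a e1 e by (auto simp: e'_def field_simps mult_nonpos_nonneg)
  obtain K where K: "K > 0" and KI: "\<And>(x::real^'n) t. t > 0 \<Longrightarrow>
    (\<integral>\<^sup>+ y\<in>ball x t. ennreal (norm y powr (- (- a * e'))) \<partial>lebesgue) \<le> ennreal (K * t powr (n - (- a * e')))"
    using nn_integral_ball_norm_powr[OF s] by blast
  show ?thesis
  proof (intro exI conjI allI impI)
    show "K + 1 > 0" using K by simp
    fix x :: "real^'n" and t g :: real
    assume t: "t > 0" and g: "g > 0"
      and I: "(\<integral>\<^sup>+ y\<in>ball x t. ennreal (u y powr (q * e)) \<partial>lebesgue) \<le> ennreal (t powr n * g powr (q * e))"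
    define c1 where "c1 = t powr a * g powr q * t powr (- a * e')"
    define c2 where "c2 = t powr a * g powr q * g powr (- (q * e))"
    have c12: "c1 \<ge> 0" "c2 \<ge> 0" by (auto simp: c1_def c2_def)
    \<comment> \<open>Young's inequality, applied after rescaling \<open>norm y\<close> by \<open>t\<close> and \<open>u\<close> by \<open>g\<close>\<close>
    have fle: "f y \<le> c1 * norm y powr (a * e') + c2 * u y powr (q * e)" for y
    proof -
      have "(norm y / t) powr a * (u y / g) powr q \<le> ((norm y / t) powr a) powr e' / e' + ((u y / g) powr q) powr e / e"
        using e' e1 by (intro Youngs_inequality) auto
      also have "\<dots> \<le> ((norm y / t) powr a) powr e' + ((u y / g) powr q) powr e"
        using e' e1 by (intro add_mono) (auto simp: divide_le_eq mult_le_cancel_left1)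
      also have "\<dots> = t powr (- a * e') * norm y powr (a * e') + g powr (- (q * e)) * u y powr (q * e)"
        using t g less_imp_le[OF u_pos[of y]] by (simp add: powr_powr powr_divide powr_minus field_simps)
      finally have "t powr a * g powr q * ((norm y / t) powr a * (u y / g) powr q) \<le>
        t powr a * g powr q * (t powr (- a * e') * norm y powr (a * e') + g powr (- (q * e)) * u y powr (q * e))"
        by (intro mult_left_mono) auto
      moreover have "t powr a * g powr q * ((norm y / t) powr a * (u y / g) powr q) = f y"
        using t g less_imp_le[OF u_pos[of y]] by (simp add: f_def powr_divide)
      ultimately show ?thesis by (simp add: c1_def c2_def algebra_simps)
    qed
    have "ennreal (m x t) = (\<integral>\<^sup>+ y\<in>ball x t. ennreal (f y) \<partial>lebesgue)" by (simp add: nn_integral_f)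
    also have "\<dots> \<le> (\<integral>\<^sup>+ y. ennreal c1 * (ennreal (norm y powr (a * e')) * indicator (ball x t) y) +
       ennreal c2 * (ennreal (u y powr (q * e)) * indicator (ball x t) y) \<partial>lebesgue)"
    proof (rule nn_integral_mono)
      fix y
      show "ennreal (f y) * indicator (ball x t) y \<le> ennreal c1 * (ennreal (norm y powr (a * e')) * indicator (ball x t) y) +
       ennreal c2 * (ennreal (u y powr (q * e)) * indicator (ball x t) y)"
        using fle[of y] c12 by (auto simp: indicator_def ennreal_mult'[symmetric] ennreal_plus[symmetric] simp del: ennreal_plus intro!: ennreal_leI)
    qed
    also have "\<dots> = ennreal c1 * (\<integral>\<^sup>+ y\<in>ball x t. ennreal (norm y powr (a * e')) \<partial>lebesgue) +
       ennreal c2 * (\<integral>\<^sup>+ y\<in>ball x t. ennreal (u y powr (q * e)) \<partial>lebesgue)"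
      by (subst nn_integral_add) (auto simp: nn_integral_cmult)
    also have "\<dots> \<le> ennreal c1 * ennreal (K * t powr (n + a * e')) + ennreal c2 * ennreal (t powr n * g powr (q * e))"
      using KI[OF t, of x] I by (intro add_mono mult_left_mono) auto
    also have "\<dots> = ennreal (c1 * (K * t powr (n + a * e')) + c2 * (t powr n * g powr (q * e)))"
      using c12 K by (simp add: ennreal_mult'[symmetric])
    also have "c1 * (K * t powr (n + a * e')) + c2 * (t powr n * g powr (q * e)) = (K + 1) * t powr (n + a) * g powr q"
    proof -
      have "t powr (- a * e') * t powr (n + a * e') = t powr n" by (simp add: powr_add[symmetric])
      then have 1: "c1 * (K * t powr (n + a * e')) = K * (t powr a * t powr n) * g powr q" by (simp add: c1_def mult_ac)
      have "g powr (- (q * e)) * g powr (q * e) = 1" using g by (simp add: powr_add[symmetric])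
      then have 2: "c2 * (t powr n * g powr (q * e)) = (t powr a * t powr n) * g powr q" by (simp add: c2_def mult_ac)
      have "t powr a * t powr n = t powr (n + a)" by (simp add: powr_add mult.commute)
      then show ?thesis using 1 2 by (simp add: algebra_simps)
    qed
    finally show "m x t \<le> (K + 1) * t powr (n + a) * g powr q"
      using K by (subst (asm) ennreal_le_iff) auto
  qed
qed

end

locale integrable_wolff_solution = wolff_solution \<beta> p a q C n u
  for \<beta> p a q C n :: real and u :: "real^'n \<Rightarrow> real" +
  fixes s0 :: real
  assumes q_gt: "q > p - 1" and s0_def: "s0 = n * (q - p + 1) / (p * \<beta> + a)"
    and integrable: "(\<integral>\<^sup>+ x. ennreal (u x powr s0) \<partial>lebesgue) < \<infinity>"
begin

text \<open>The slow rate \<open>(p * \<beta> + a) / (q - p + 1)\<close>;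
  \<open>t powr (- \<sigma>)\<close> is the typical size of a function with mass of order 1 in a
  ball of radius \<open>t\<close>.\<close>

definition \<sigma> :: real where "\<sigma> = n / s0"
definition far :: "real^'n \<Rightarrow> real \<Rightarrow> ennreal" where
  "far x r = (\<integral>\<^sup>+ t\<in>{r..}. ennreal (m x t powr \<gamma> * t powr (- b - 1)) \<partial>lborel)"
definition mass :: "(real^'n) set \<Rightarrow> ennreal" where
  "mass A = (\<integral>\<^sup>+ y\<in>A. ennreal (u y powr s0) \<partial>lebesgue)"

lemma s0_pos: "s0 > 0" "\<sigma> > 0"
proof -
  have "0 < n * (q - p + 1) / (\<alpha> + a)" using q_gt params by (intro divide_pos_pos mult_pos_pos) auto
  then show "s0 > 0" by (simp add: s0_def \<alpha>_def)
  then show "\<sigma> > 0" using params by (simp add: \<sigma>_def)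
qed

lemma gamma_q: "\<gamma> * q > 1" using q_gt p by (simp add: \<gamma>_def)

text \<open>The scaling relation: rescaling \<open>u x\<close> to
  \<open>\<lambda> powr \<sigma> * u (\<lambda> x)\<close> preserves the form of the equation
  precisely because of it. All cancellations of powers below rest on it.\<close>

lemma sigma_eq: "\<gamma> * (\<alpha> + a) = (\<gamma> * q - 1) * \<sigma>"
proof -
  have "\<sigma> = (\<alpha> + a) / (q - p + 1)" unfolding \<sigma>_def using params q_gt by (subst s0_def) (simp add: \<alpha>_def)
  moreover have "\<gamma> * q - 1 = \<gamma> * (q - p + 1)" using p by (simp add: \<gamma>_def field_simps)
  ultimately show ?thesis using q_gt by simp
qed

text \<open>Supercriticality in another form. It makes \<open>s0 / q\<close> admissible in
  \<open>m_le_of_power_mean\<close> and leaves room for a smaller admissible exponent.\<close>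

lemma s0_q: "n < s0 / q * (n + a)"
proof -
  have "(n + a) * (p - 1) < q * (n - \<alpha>)"
  proof -
    have "(p - 1) * (n + a) < (p - 1) * (q * b)" using exponent_supercritical p by simp
    also have "\<dots> = q * (n - \<alpha>)" using p by (simp add: b_def \<gamma>_def)
    finally show ?thesis by (simp add: mult.commute)
  qed
  then have "q * (\<alpha> + a) < (q - p + 1) * (n + a)" by (simp add: algebra_simps)
  then have "n * (q * (\<alpha> + a)) < n * ((q - p + 1) * (n + a))" using params by simp
  then have "n < n * ((q - p + 1) * (n + a)) / (q * (\<alpha> + a))"
    using q params by (subst pos_less_divide_eq) auto
  also have "\<dots> = s0 / q * (n + a)" by (subst s0_def) (simp add: \<alpha>_def mult.assoc mult.commute[of q])
  finally show ?thesis .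
qed

text \<open>The case \<open>e = s0 / q\<close> of \<open>m_le_of_power_mean\<close>. The resulting
  power of \<open>t\<close> is integrable at infinity but not at 0, so this bound serves only away
  from small radii.\<close>

lemma morrey:
  "\<exists>K>0. \<forall>x t I. t > 0 \<longrightarrow> I > 0 \<longrightarrow> mass (ball x t) \<le> ennreal I \<longrightarrow>
     m x t powr \<gamma> * t powr (- b - 1) \<le> K * I powr (\<gamma> * q / s0) * t powr (- \<sigma> - 1)"
proof -
  obtain K where K: "K > 0" and KI: "\<And>x t g. t > 0 \<Longrightarrow> g > 0 \<Longrightarrow>
    (\<integral>\<^sup>+ y\<in>ball x t. ennreal (u y powr (q * (s0 / q))) \<partial>lebesgue) \<le> ennreal (t powr n * g powr (q * (s0 / q))) \<Longrightarrow>
    m x t \<le> K * t powr (n + a) * g powr q"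
    using m_le_of_power_mean[OF s0_q] by blast
  have qs: "q * (s0 / q) = s0" using q by simp
  show ?thesis
  proof (intro exI conjI allI impI)
    show "K powr \<gamma> > 0" using K by simp
    fix x t I assume t: "t > 0" and I: "(I::real) > 0" and le: "mass (ball x t) \<le> ennreal I"
    \<comment> \<open>Chosen so that \<open>t powr n * g powr s0 = I\<close>.\<close>
    define g where "g = I powr (1 / s0) * t powr (- \<sigma>)"
    have g: "g > 0" using I t by (simp add: g_def)
    have "\<sigma> * s0 = n" using s0_pos by (simp add: \<sigma>_def)
    then have "g powr s0 = I * t powr (- n)"
      using t I s0_pos by (simp add: g_def powr_mult powr_powr)
    then have "t powr n * g powr s0 = I"
      using t by (simp add: powr_minus)
    then have "m x t \<le> K * t powr (n + a) * g powr q"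
      using le by (intro KI[OF t g]) (simp only: qs mass_def)
    then have "m x t powr \<gamma> \<le> (K * t powr (n + a) * g powr q) powr \<gamma>"
      using params m_nonneg by (intro powr_mono2) auto
    also have "\<dots> = K powr \<gamma> * t powr (\<gamma> * (n + a)) * (I powr (\<gamma> * q / s0) * t powr (- (\<gamma> * q * \<sigma>)))"
      using K I t by (simp add: g_def powr_mult powr_powr mult_ac)
    finally have "m x t powr \<gamma> * t powr (- b - 1) \<le> K powr \<gamma> * t powr (\<gamma> * (n + a)) * (I powr (\<gamma> * q / s0) * t powr (- (\<gamma> * q * \<sigma>))) * t powr (- b - 1)"
      by (intro mult_right_mono) auto
    also have "\<dots> = K powr \<gamma> * I powr (\<gamma> * q / s0) * (t powr (\<gamma> * (n + a)) * t powr (- (\<gamma> * q * \<sigma>)) * t powr (- b - 1))"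
      by simp
    also have "t powr (\<gamma> * (n + a)) * t powr (- (\<gamma> * q * \<sigma>)) * t powr (- b - 1) = t powr (- \<sigma> - 1)"
    proof -
      have "\<gamma> * (n + a) + (- (\<gamma> * q * \<sigma>)) + (- b - 1) = - \<sigma> - 1"
        using sigma_eq by (simp add: b_def algebra_simps)
      then show ?thesis by (simp only: powr_add[symmetric])
    qed
    finally show "m x t powr \<gamma> * t powr (- b - 1) \<le> K powr \<gamma> * I powr (\<gamma> * q / s0) * t powr (- \<sigma> - 1)" .
  qed
qed

section \<open>Hedberg's splitting and comparison with a weight\<close>

lemma W_le: 
  assumes "r > 0"
  shows "W x \<le> (\<integral>\<^sup>+ t\<in>{0<..r}. ennreal (m x t powr \<gamma> * t powr (- b - 1)) \<partial>lborel) + far x r"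
proof -
  have "W x \<le> (\<integral>\<^sup>+ t. ennreal (m x t powr \<gamma> * t powr (- b - 1)) * indicator {0<..r} t + ennreal (m x t powr \<gamma> * t powr (- b - 1)) * indicator {r..} t \<partial>lborel)"
    unfolding W_def by (intro nn_integral_mono) (auto simp: indicator_def)
  also have "\<dots> = (\<integral>\<^sup>+ t\<in>{0<..r}. ennreal (m x t powr \<gamma> * t powr (- b - 1)) \<partial>lborel) + far x r"
    unfolding far_def by (intro nn_integral_add) auto
  finally show ?thesis .
qed

text \<open>Any exponent strictly between \<open>n / (n + a)\<close> and \<open>s0 / q\<close> would do.\<close>

definition e1 :: real where "e1 = (n / (n + a) + s0 / q) / 2"

text \<open>The first inequality makes \<open>e1\<close> admissible in
  \<open>m_le_of_power_mean\<close>; the second puts \<open>u powr (q * e1)\<close> into a Lebesgue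
  space of exponent above 1, where the maximal theorem holds.\<close>

lemma e1: "n < e1 * (n + a)" "q * e1 < s0" "e1 > 0"
proof -
  have "n / (n + a) < s0 / q" using s0_q params by (simp add: field_simps)
  moreover have "X < (X + Y) / 2 \<and> (X + Y) / 2 < Y" if "X < Y" for X Y :: real using that by simp
  ultimately have *: "n / (n + a) < e1 \<and> e1 < s0 / q" unfolding e1_def by blast
  then show "n < e1 * (n + a)" "q * e1 < s0" using * params q by (auto simp: field_simps)
  show "e1 > 0" using * divide_pos_pos[of n "n + a"] params by linarith
qed

text \<open>Hedberg's splitting of the potential at the radius \<open>\<delta> \<sim> u x powr (- 1 / \<sigma>)\<close>: scales below \<open>\<delta>\<close> are controlled
  by the means of \<open>u powr (q * e1)\<close>, the scales between \<open>\<delta>\<close> and \<open>r\<close> by the small mass, so that both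
  contribute at most \<open>u x / 4\<close>.\<close>

lemma near_or_far:
  assumes L: "L > 0"
  shows "\<exists>\<epsilon>>0. AE x in lebesgue. \<forall>r>0. mass (ball x r) \<le> ennreal \<epsilon> \<longrightarrow>
    (\<forall>t\<in>{0<..r}. (\<integral>\<^sup>+ y\<in>ball x t. ennreal (u y powr (q * e1)) \<partial>lebesgue) \<le> ennreal (L * t powr n * u x powr (q * e1))) \<longrightarrow>
    ennreal (u x) \<le> ennreal (2 * C) * far x r"
proof -
  obtain K1 where K1: "K1 > 0" and KI1: "\<And>x t g. t > 0 \<Longrightarrow> g > 0 \<Longrightarrow>
    (\<integral>\<^sup>+ y\<in>ball x t. ennreal (u y powr (q * e1)) \<partial>lebesgue) \<le> ennreal (t powr n * g powr (q * e1)) \<Longrightarrow>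
    m x t \<le> K1 * t powr (n + a) * g powr q"
    using m_le_of_power_mean[OF e1(1)] by blast
  obtain K2 where K2: "K2 > 0" and KI2: "\<And>x t I. t > 0 \<Longrightarrow> I > 0 \<Longrightarrow> mass (ball x t) \<le> ennreal I \<Longrightarrow>
     m x t powr \<gamma> * t powr (- b - 1) \<le> K2 * I powr (\<gamma> * q / s0) * t powr (- \<sigma> - 1)"
    using morrey by blast
  define d where "d = \<gamma> * (\<alpha> + a)"
  have d: "d > 0" using params by (simp add: d_def)
  define A where "A = (K1 * L powr (1 / e1)) powr \<gamma>"
  have A: "A > 0" using K1 L by (simp add: A_def)
  \<comment> \<open>The scales below and above \<open>\<delta>\<close> will contribute
    \<open>C * (A * \<eta> powr d / d)\<close> and
    \<open>C * (B * \<eta> powr (- \<sigma>) / \<sigma>)\<close> times \<open>u x\<close>. Here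
    \<open>\<eta>\<close> makes the first coefficient 1/4; \<open>\<epsilon>\<close>, chosen after
    it, does the same for the second.\<close>
  define \<eta> where "\<eta> = (d / (4 * C * A)) powr (1 / d)"
  have \<eta>: "\<eta> > 0" using A C d by (simp add: \<eta>_def)
  have \<eta>d: "C * (A * \<eta> powr d / d) = 1 / 4" using A C d by (simp add: \<eta>_def powr_powr)
  define \<epsilon> where "\<epsilon> = (\<sigma> * \<eta> powr \<sigma> / (4 * C * K2)) powr (s0 / (\<gamma> * q))"
  have \<epsilon>: "\<epsilon> > 0" using \<eta> K2 C s0_pos by (simp add: \<epsilon>_def)
  define B where "B = K2 * \<epsilon> powr (\<gamma> * q / s0)"
  have B: "B > 0" using K2 \<epsilon> by (simp add: B_def)
  have B\<eta>: "C * (B * \<eta> powr (- \<sigma>) / \<sigma>) = 1 / 4"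
    using C K2 \<eta> s0_pos params q by (simp add: B_def \<epsilon>_def powr_powr powr_minus field_simps)
  show ?thesis
  proof (intro exI conjI)
    show "\<epsilon> > 0" by fact
    show "AE x in lebesgue. \<forall>r>0. mass (ball x r) \<le> ennreal \<epsilon> \<longrightarrow>
      (\<forall>t\<in>{0<..r}. (\<integral>\<^sup>+ y\<in>ball x t. ennreal (u y powr (q * e1)) \<partial>lebesgue) \<le> ennreal (L * t powr n * u x powr (q * e1))) \<longrightarrow>
      ennreal (u x) \<le> ennreal (2 * C) * far x r"
      using AE_upper
    proof (eventually_elim, intro allI impI)
      fix x :: "real^'n" and r :: real
      assume up: "ennreal (u x) \<le> ennreal C * W x" and r: "r > 0" and ms: "mass (ball x r) \<le> ennreal \<epsilon>"
        and mean: "\<forall>t\<in>{0<..r}. (\<integral>\<^sup>+ y\<in>ball x t. ennreal (u y powr (q * e1)) \<partial>lebesgue) \<le> ennreal (L * t powr n * u x powr (q * e1))"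
      define U where "U = u x"
      have U: "U > 0" by (simp add: U_def u_pos)
      have b1: "m x t powr \<gamma> * t powr (- b - 1) \<le> A * U powr (\<gamma> * q) * t powr (d - 1)" if t: "0 < t" "t \<le> r" for t
      proof -
        define g where "g = L powr (1 / (q * e1)) * U"
        have g: "g > 0" using L U by (simp add: g_def)
        have "t powr n * g powr (q * e1) = L * t powr n * u x powr (q * e1)"
          using L U q e1 by (simp add: g_def powr_mult powr_powr U_def)
        then have "m x t \<le> K1 * t powr (n + a) * g powr q"
          using mean t by (intro KI1[OF t(1) g]) (simp add: mult_ac)
        also have "g powr q = L powr (1 / e1) * U powr q"
          using L U q e1 by (simp add: g_def powr_mult powr_powr)
        finally have "m x t powr \<gamma> \<le> (K1 * t powr (n + a) * (L powr (1 / e1) * U powr q)) powr \<gamma>"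
          using params m_nonneg by (intro powr_mono2) auto
        also have "\<dots> = A * U powr (\<gamma> * q) * t powr (\<gamma> * (n + a))"
          using K1 L U t by (simp add: A_def powr_mult powr_powr mult_ac)
        finally have "m x t powr \<gamma> * t powr (- b - 1) \<le> A * U powr (\<gamma> * q) * t powr (\<gamma> * (n + a)) * t powr (- b - 1)"
          by (intro mult_right_mono) auto
        also have "\<dots> = A * U powr (\<gamma> * q) * t powr (\<gamma> * (n + a) + (- b - 1))"
          by (simp add: powr_add)
        also have "\<gamma> * (n + a) + (- b - 1) = d - 1" by (simp add: d_def b_def algebra_simps)
        finally show ?thesis .
      qed
      have b2: "m x t powr \<gamma> * t powr (- b - 1) \<le> B * t powr (- \<sigma> - 1)" if t: "0 < t" "t \<le> r" for t
      proof -
        have "mass (ball x t) \<le> mass (ball x r)"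
          unfolding mass_def using t by (intro nn_integral_mono) (auto simp: indicator_def)
        then show ?thesis using KI2[OF t(1) \<epsilon>, of x] ms by (simp add: B_def)
      qed
      \<comment> \<open>At this radius both bounds are linear in \<open>U\<close>:
        \<open>\<delta> powr (- \<sigma>)\<close> is a multiple of \<open>U\<close>, and by
        \<open>sigma_eq\<close> so is
        \<open>U powr (\<gamma> * q) * \<delta> powr d\<close>.\<close>
      define \<delta> where "\<delta> = \<eta> * U powr (- (1 / \<sigma>))"
      have \<delta>: "\<delta> > 0" using \<eta> U by (simp add: \<delta>_def)
      have "(\<integral>\<^sup>+ t\<in>{0<..r}. ennreal (m x t powr \<gamma> * t powr (- b - 1)) \<partial>lborel) \<le>
        (\<integral>\<^sup>+ t. ennreal (A * U powr (\<gamma> * q)) * (ennreal (t powr (d - 1)) * indicator {0..\<delta>} t) + ennreal B * (ennreal (t powr (- \<sigma> - 1)) * indicator {\<delta>..} t) \<partial>lborel)"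
      proof (rule nn_integral_mono)
        fix t
        show "ennreal (m x t powr \<gamma> * t powr (- b - 1)) * indicator {0<..r} t \<le>
          ennreal (A * U powr (\<gamma> * q)) * (ennreal (t powr (d - 1)) * indicator {0..\<delta>} t) + ennreal B * (ennreal (t powr (- \<sigma> - 1)) * indicator {\<delta>..} t)"
        proof (cases "t \<in> {0<..r}")
          case t: True
          show ?thesis
          proof (cases "t \<le> \<delta>")
            case True
            have "ennreal (m x t powr \<gamma> * t powr (- b - 1)) \<le> ennreal (A * U powr (\<gamma> * q)) * ennreal (t powr (d - 1))"
              using b1[of t] t A by (subst ennreal_mult'[symmetric]) (auto intro!: ennreal_leI)
            then show ?thesis using t True by (simp add: add_increasing2)
          next
            case False
            have "ennreal (m x t powr \<gamma> * t powr (- b - 1)) \<le> ennreal B * ennreal (t powr (- \<sigma> - 1))"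
              using b2[of t] t B by (subst ennreal_mult'[symmetric]) (auto intro!: ennreal_leI)
            then show ?thesis using t False by (simp add: add_increasing)
          qed
        qed simp
      qed
      also have "\<dots> = ennreal (A * U powr (\<gamma> * q)) * ennreal (\<delta> powr d / d) + ennreal B * ennreal (\<delta> powr (- \<sigma>) / \<sigma>)"
        using nn_integral_powr_Icc[of \<delta> d] nn_integral_powr_Ici[of \<delta> \<sigma>] \<delta> d s0_pos
        by (simp add: nn_integral_add nn_integral_cmult)
      also have "\<dots> = ennreal (A * U powr (\<gamma> * q) * (\<delta> powr d / d) + B * (\<delta> powr (- \<sigma>) / \<sigma>))"
        using A B d s0_pos by (simp add: ennreal_mult'[symmetric])
      also have "A * U powr (\<gamma> * q) * (\<delta> powr d / d) + B * (\<delta> powr (- \<sigma>) / \<sigma>) = (A * \<eta> powr d / d + B * \<eta> powr (- \<sigma>) / \<sigma>) * U"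
      proof -
        have "\<delta> powr d = \<eta> powr d * U powr (- (d / \<sigma>))"
          using \<eta> U by (simp add: \<delta>_def powr_mult powr_powr)
        also have "d / \<sigma> = \<gamma> * q - 1" using sigma_eq s0_pos by (simp add: d_def field_simps)
        finally have "U powr (\<gamma> * q) * \<delta> powr d = \<eta> powr d * (U powr (\<gamma> * q) * U powr (- (\<gamma> * q - 1)))" by simp
        also have "U powr (\<gamma> * q) * U powr (- (\<gamma> * q - 1)) = U" using U by (simp add: powr_add[symmetric])
        finally have 1: "U powr (\<gamma> * q) * \<delta> powr d = \<eta> powr d * U" .
        have 2: "\<delta> powr (- \<sigma>) = \<eta> powr (- \<sigma>) * U"
          using \<eta> U s0_pos by (simp add: \<delta>_def powr_mult powr_powr)
        have "A * U powr (\<gamma> * q) * (\<delta> powr d / d) = A / d * (U powr (\<gamma> * q) * \<delta> powr d)" by simp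
        then show ?thesis unfolding 1 2 by (simp add: algebra_simps)
      qed
      finally have near: "(\<integral>\<^sup>+ t\<in>{0<..r}. ennreal (m x t powr \<gamma> * t powr (- b - 1)) \<partial>lborel) \<le> ennreal ((A * \<eta> powr d / d + B * \<eta> powr (- \<sigma>) / \<sigma>) * U)" .
      have "W x \<le> ennreal ((A * \<eta> powr d / d + B * \<eta> powr (- \<sigma>) / \<sigma>) * U) + far x r"
        using W_le[OF r, of x] add_right_mono[OF near, of "far x r"] by (rule order_trans)
      then have "ennreal C * W x \<le> ennreal C * (ennreal ((A * \<eta> powr d / d + B * \<eta> powr (- \<sigma>) / \<sigma>) * U) + far x r)"
        by (rule mult_left_mono) simp
      with up have "ennreal U \<le> ennreal C * (ennreal ((A * \<eta> powr d / d + B * \<eta> powr (- \<sigma>) / \<sigma>) * U) + far x r)"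
        unfolding U_def by (rule order_trans)
      also have "\<dots> = ennreal (C * (A * \<eta> powr d / d) * U + C * (B * \<eta> powr (- \<sigma>) / \<sigma>) * U) + ennreal C * far x r"
        using C by (simp add: distrib_left ennreal_mult'[symmetric] algebra_simps)
      also have "C * (A * \<eta> powr d / d) * U + C * (B * \<eta> powr (- \<sigma>) / \<sigma>) * U = U / 2"
        unfolding \<eta>d B\<eta> by simp
      finally have main: "ennreal U \<le> ennreal (U / 2) + ennreal C * far x r" .
      show "ennreal (u x) \<le> ennreal (2 * C) * far x r"
      proof (cases "far x r")
        case (real z)
        then have "ennreal U \<le> ennreal (U / 2 + C * z)"
          using main U C by (simp add: ennreal_mult'[symmetric] ennreal_plus[symmetric] del: ennreal_plus)
        then have "U \<le> U / 2 + C * z"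
          using U C real by (subst (asm) ennreal_le_iff) auto
        then have "U \<le> 2 * C * z" by simp
        then show ?thesis using real C by (simp add: U_def ennreal_mult'[symmetric] ennreal_leI)
      next
        case top
        then show ?thesis using C by (simp add: ennreal_mult_top)
      qed
    qed
  qed
qed

text \<open>Where \<open>u > \<phi>\<close>, the far part is too small, so \<open>u powr (q * e1)\<close> is far below its maximal function.  As \<open>\<phi>\<close> varies
  slowly, this persists for the truncation of \<open>u\<close> to \<open>u > \<phi>\<close>, which must therefore vanish.\<close>

lemma u_le_weight:
  assumes D: "D > 0"
  shows "\<exists>\<epsilon>>0. \<forall>\<phi> r. \<phi> \<in> borel_measurable lebesgue \<longrightarrow> (\<forall>x. 0 < \<phi> x) \<longrightarrow>
    (AE x in lebesgue. u x \<le> \<phi> x \<or> (0 < r x \<and> mass (ball x (r x)) \<le> ennreal \<epsilon> \<and>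
       ennreal (2 * C) * far x (r x) \<le> ennreal (\<phi> x) \<and> (\<forall>y\<in>ball x (r x). \<phi> y \<le> D * \<phi> x))) \<longrightarrow>
    (AE x in lebesgue. u x \<le> \<phi> x)"
proof -
  define r1 where "r1 = s0 / (q * e1)"
  have r1: "r1 > 1" using e1 q by (simp add: r1_def)
  obtain K where K: "K > 0" and absorb: "\<And>w :: real^'n \<Rightarrow> real. w \<in> borel_measurable lebesgue \<Longrightarrow> \<forall>x. 0 \<le> w x \<Longrightarrow>
     (\<integral>\<^sup>+ x. ennreal (w x powr r1) \<partial>lebesgue) < \<infinity> \<Longrightarrow>
     (AE x in lebesgue. 0 < w x \<longrightarrow> (\<exists>t>0. ennreal (K * t powr n * w x) < (\<integral>\<^sup>+ y\<in>ball x t. ennreal (w y) \<partial>lebesgue))) \<Longrightarrow>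
     (AE x in lebesgue. w x = 0)"
    using AE_eq_0_if_below_maximal_function[OF r1, where 'a="real^'n"] by (auto simp: n_def)
  \<comment> \<open>\<open>K\<close> is the amount the absorption lemma asks for. The rest pays for
    the points \<open>y\<close> of the ball with \<open>u y \<le> \<phi> y\<close>, where
    \<open>u y \<le> D * \<phi> x \<le> D * u x\<close>.\<close>
  define L where "L = K + \<omega> * D powr (q * e1)"
  have L: "L > 0" using K params by (simp add: L_def add_pos_nonneg)
  obtain \<epsilon> where \<epsilon>: "\<epsilon> > 0" and nf: "AE x in lebesgue. \<forall>r>0. mass (ball x r) \<le> ennreal \<epsilon> \<longrightarrow>
    (\<forall>t\<in>{0<..r}. (\<integral>\<^sup>+ y\<in>ball x t. ennreal (u y powr (q * e1)) \<partial>lebesgue) \<le> ennreal (L * t powr n * u x powr (q * e1))) \<longrightarrow>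
    ennreal (u x) \<le> ennreal (2 * C) * far x r"
    using near_or_far[OF L] by blast
  show ?thesis
  proof (intro exI conjI allI impI)
    show "\<epsilon> > 0" by fact
    fix \<phi> r :: "real^'n \<Rightarrow> real"
    assume [measurable]: "\<phi> \<in> borel_measurable lebesgue" and \<phi>: "\<forall>x. 0 < \<phi> x"
      and AE: "AE x in lebesgue. u x \<le> \<phi> x \<or> (0 < r x \<and> mass (ball x (r x)) \<le> ennreal \<epsilon> \<and>
       ennreal (2 * C) * far x (r x) \<le> ennreal (\<phi> x) \<and> (\<forall>y\<in>ball x (r x). \<phi> y \<le> D * \<phi> x))"
    \<comment> \<open>The absorption lemma wants its hypothesis at almost every point where
      \<open>w\<close> is positive, and the means of \<open>u\<close> are known to be large only
      where \<open>u > \<phi>\<close>; hence the truncation.\<close>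
    define w where "w y = (if \<phi> y < u y then u y powr (q * e1) else 0)" for y
    have w_meas [measurable]: "w \<in> borel_measurable lebesgue" unfolding w_def[abs_def] by measurable
    have "AE x in lebesgue. w x = 0"
    proof (rule absorb[OF w_meas])
      show "\<forall>x. 0 \<le> w x" by (simp add: w_def)
      have "(\<integral>\<^sup>+ x. ennreal (w x powr r1) \<partial>lebesgue) \<le> (\<integral>\<^sup>+ x. ennreal (u x powr s0) \<partial>lebesgue)"
        using q e1 by (intro nn_integral_mono ennreal_leI) (auto simp: w_def powr_powr r1_def)
      then show "(\<integral>\<^sup>+ x. ennreal (w x powr r1) \<partial>lebesgue) < \<infinity>"
        using integrable by (rule le_less_trans)
      show "AE x in lebesgue. 0 < w x \<longrightarrow> (\<exists>t>0. ennreal (K * t powr n * w x) < (\<integral>\<^sup>+ y\<in>ball x t. ennreal (w y) \<partial>lebesgue))"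
        using AE nf
      proof (eventually_elim, intro impI)
        fix x :: "real^'n"
        assume A: "u x \<le> \<phi> x \<or> (0 < r x \<and> mass (ball x (r x)) \<le> ennreal \<epsilon> \<and>
             ennreal (2 * C) * far x (r x) \<le> ennreal (\<phi> x) \<and> (\<forall>y\<in>ball x (r x). \<phi> y \<le> D * \<phi> x))"
          and B: "\<forall>r>0. mass (ball x r) \<le> ennreal \<epsilon> \<longrightarrow>
            (\<forall>t\<in>{0<..r}. (\<integral>\<^sup>+ y\<in>ball x t. ennreal (u y powr (q * e1)) \<partial>lebesgue) \<le> ennreal (L * t powr n * u x powr (q * e1))) \<longrightarrow>
            ennreal (u x) \<le> ennreal (2 * C) * far x r"
          and wx: "0 < w x"
        have ux: "\<phi> x < u x" "w x = u x powr (q * e1)" using wx by (auto simp: w_def split: if_splits)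
        then have A': "0 < r x" "mass (ball x (r x)) \<le> ennreal \<epsilon>" "ennreal (2 * C) * far x (r x) \<le> ennreal (\<phi> x)"
          "\<forall>y\<in>ball x (r x). \<phi> y \<le> D * \<phi> x" using A by auto
        have "\<not> ennreal (u x) \<le> ennreal (2 * C) * far x (r x)"
        proof
          assume "ennreal (u x) \<le> ennreal (2 * C) * far x (r x)"
          then have "ennreal (u x) \<le> ennreal (\<phi> x)" using A'(3) by (rule order_trans)
          then show False using ux \<phi> less_imp_le[of 0 "\<phi> x"] by (simp add: ennreal_le_iff)
        qed
        then have "\<not> (\<forall>t\<in>{0<..r x}. (\<integral>\<^sup>+ y\<in>ball x t. ennreal (u y powr (q * e1)) \<partial>lebesgue) \<le> ennreal (L * t powr n * u x powr (q * e1)))"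
          using B A'(1,2) by blast
        then obtain t where t: "0 < t" "t \<le> r x"
          and big: "ennreal (L * t powr n * u x powr (q * e1)) < (\<integral>\<^sup>+ y\<in>ball x t. ennreal (u y powr (q * e1)) \<partial>lebesgue)"
          by (auto simp: not_le)
        have "(\<integral>\<^sup>+ y\<in>ball x t. ennreal (u y powr (q * e1)) \<partial>lebesgue) \<le>
          (\<integral>\<^sup>+ y. ennreal (w y) * indicator (ball x t) y + ennreal (D powr (q * e1) * w x) * indicator (ball x t) y \<partial>lebesgue)"
        proof (rule nn_integral_mono)
          fix y
          show "ennreal (u y powr (q * e1)) * indicator (ball x t) y \<le>
            ennreal (w y) * indicator (ball x t) y + ennreal (D powr (q * e1) * w x) * indicator (ball x t) y"
          proof (cases "y \<in> ball x t \<and> \<not> \<phi> y < u y")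
            case True
            then have "y \<in> ball x (r x)" using t by auto
            then have "u y \<le> D * \<phi> x" using A'(4) True by (meson not_le order_trans)
            also have "\<dots> \<le> D * u x" using D ux by simp
            finally have "u y powr (q * e1) \<le> (D * u x) powr (q * e1)"
              using q e1 less_imp_le[OF u_pos] by (intro powr_mono2) auto
            also have "\<dots> = D powr (q * e1) * w x"
              using D less_imp_le[OF u_pos] by (simp add: powr_mult ux(2))
            finally show ?thesis using True by (simp add: w_def ennreal_leI)
          qed (auto simp: w_def indicator_def)
        qed
        also have "\<dots> = (\<integral>\<^sup>+ y\<in>ball x t. ennreal (w y) \<partial>lebesgue) + ennreal (D powr (q * e1) * w x) * emeasure lebesgue (ball x t)"
          by (subst nn_integral_add) (auto simp: nn_integral_cmult_indicator)
        also have "ennreal (D powr (q * e1) * w x) * emeasure lebesgue (ball x t) = ennreal (\<omega> * D powr (q * e1) * t powr n * w x)"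
        proof -
          have e: "emeasure lebesgue (ball x t) = ennreal (\<omega> * t powr n)" using t by (simp add: emeasure_ball_n)
          show ?thesis unfolding e using wx by (subst ennreal_mult'[symmetric]) (auto simp: mult_ac)
        qed
        finally have s1: "ennreal (L * t powr n * w x) < (\<integral>\<^sup>+ y\<in>ball x t. ennreal (w y) \<partial>lebesgue) + ennreal (\<omega> * D powr (q * e1) * t powr n * w x)"
          using big unfolding ux(2) by (rule less_le_trans[rotated])
        have s2: "ennreal (L * t powr n * w x) = ennreal (K * t powr n * w x) + ennreal (\<omega> * D powr (q * e1) * t powr n * w x)"
          using K wx params by (subst ennreal_plus[symmetric]) (auto simp: L_def algebra_simps)
        have "ennreal (K * t powr n * w x) < (\<integral>\<^sup>+ y\<in>ball x t. ennreal (w y) \<partial>lebesgue)"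
        proof (rule ccontr)
          assume "\<not> ennreal (K * t powr n * w x) < (\<integral>\<^sup>+ y\<in>ball x t. ennreal (w y) \<partial>lebesgue)"
          then have "(\<integral>\<^sup>+ y\<in>ball x t. ennreal (w y) \<partial>lebesgue) \<le> ennreal (K * t powr n * w x)"
            by (simp only: not_less)
          then have "(\<integral>\<^sup>+ y\<in>ball x t. ennreal (w y) \<partial>lebesgue) + ennreal (\<omega> * D powr (q * e1) * t powr n * w x) \<le> ennreal (L * t powr n * w x)"
            unfolding s2 by (rule add_right_mono)
          then show False using s1 leD by blast
        qed
        then show "\<exists>t>0. ennreal (K * t powr n * w x) < (\<integral>\<^sup>+ y\<in>ball x t. ennreal (w y) \<partial>lebesgue)"
          using t by blast
      qed
    qed
    then show "AE x in lebesgue. u x \<le> \<phi> x"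
    proof eventually_elim
      case (elim x)
      then show ?case using u_pos[of x] by (auto simp: w_def split: if_splits)
    qed
  qed
qed

section \<open>Smallness of the mass and boundedness of \<open>u\<close>\<close>

lemma mass_decseq:
  assumes A: "range A \<subseteq> sets lebesgue" and dec: "decseq A" and empty: "(\<Inter>i. A i) = {}" and \<epsilon>: "\<epsilon> > 0"
  shows "\<exists>i. mass (A i) \<le> ennreal \<epsilon>"
proof -
  define N where "N = density lebesgue (\<lambda>y. ennreal (u y powr s0))"
  have NA: "emeasure N S = mass S" if "S \<in> sets lebesgue" for S
    unfolding N_def mass_def using that by (subst emeasure_density) auto
  have fin: "emeasure N S \<noteq> \<infinity>" if "S \<in> sets lebesgue" for S
  proof -
    have "mass S \<le> (\<integral>\<^sup>+ x. ennreal (u x powr s0) \<partial>lebesgue)"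
      unfolding mass_def by (intro nn_integral_mono) (auto simp: indicator_def)
    then show ?thesis using integrable NA[OF that] by (auto simp: less_top[symmetric] top_unique)
  qed
  have "(\<lambda>i. emeasure N (A i)) \<longlonglongrightarrow> emeasure N (\<Inter>i. A i)"
    using A dec fin by (intro Lim_emeasure_decseq) (auto simp: N_def)
  then have "(\<lambda>i. emeasure N (A i)) \<longlonglongrightarrow> 0" by (simp add: empty)
  then have "eventually (\<lambda>i. emeasure N (A i) < ennreal \<epsilon>) sequentially"
    using \<epsilon> by (intro order_tendstoD) auto
  then obtain i where "emeasure N (A i) < ennreal \<epsilon>" by (auto simp: eventually_sequentially)
  moreover have "A i \<in> sets lebesgue" using A by auto
  ultimately show ?thesis using NA by (metis less_imp_le)
qed

text \<open>Absolute continuity of the integral: the mass of the set \<open>u > i\<close> is small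
  for large \<open>i\<close>, and elsewhere the integrand is bounded and the volume of the ball is
  small.\<close>

lemma mass_small_balls:
  assumes \<epsilon>: "\<epsilon> > 0"
  shows "\<exists>r>0. \<forall>x. mass (ball x r) \<le> ennreal \<epsilon>"
proof -
  define A where "A i = {y. real i < u y}" for i :: nat
  have Am: "A i \<in> sets lebesgue" for i
    using borel_measurable_less[of "\<lambda>_. real i" lebesgue u] by (simp add: A_def)
  have "\<exists>i. mass (A i) \<le> ennreal (\<epsilon> / 2)"
  proof (rule mass_decseq)
    show "(\<Inter>i. A i) = {}"
    proof -
      have "\<exists>i::nat. u y \<le> real i" for y by (rule real_arch_simple)
      then have "\<exists>i. y \<notin> A i" for y by (simp add: A_def not_less)
      then show ?thesis by blast
    qed
  qed (use Am \<epsilon> in \<open>auto simp: decseq_def A_def\<close>)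
  then obtain i where i: "mass (A i) \<le> ennreal (\<epsilon> / 2)" by blast
  \<comment> \<open>Makes the bounded part contribute \<open>\<epsilon> / 2\<close>; the summand 1
    keeps the denominator positive when \<open>i = 0\<close>.\<close>
  define r where "r = (\<epsilon> / (2 * \<omega> * (real i powr s0 + 1))) powr (1 / n)"
  have pos: "2 * \<omega> * (real i powr s0 + 1) > 0" using params(8) by (simp add: add_nonneg_pos)
  have "0 < \<epsilon> / (2 * \<omega> * (real i powr s0 + 1))" using \<epsilon> pos by (rule divide_pos_pos)
  then have r: "r > 0" unfolding r_def powr_gt_zero by (rule less_imp_neq[symmetric])
  have rn: "\<omega> * (real i powr s0 + 1) * r powr n = \<epsilon> / 2"
  proof -
    have "r powr n = \<epsilon> / (2 * \<omega> * (real i powr s0 + 1))" using pos \<epsilon> params by (simp add: r_def powr_powr)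
    moreover have "real i powr s0 + 1 > 0" by (simp add: add_nonneg_pos)
    moreover have "v * P * (\<epsilon> / (2 * v * P)) = \<epsilon> / 2" if "P > 0" "v > 0" for v P :: real using that by simp
    ultimately show ?thesis using params(8) by (simp only:)
  qed
  show ?thesis
  proof (intro exI conjI allI)
    show "r > 0" by fact
    fix x
    have "mass (ball x r) \<le> (\<integral>\<^sup>+ y. ennreal (u y powr s0) * indicator (A i) y + ennreal (real i powr s0 + 1) * indicator (ball x r) y \<partial>lebesgue)"
      unfolding mass_def
    proof (rule nn_integral_mono)
      fix y
      show "ennreal (u y powr s0) * indicator (ball x r) y \<le> ennreal (u y powr s0) * indicator (A i) y + ennreal (real i powr s0 + 1) * indicator (ball x r) y"
      proof (cases "y \<in> A i")
        case True
        then show ?thesis by (auto simp: indicator_def add_increasing2)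
      next
        case False
        then have "u y powr s0 \<le> real i powr s0"
          using s0_pos less_imp_le[OF u_pos] by (intro powr_mono2) (auto simp: A_def)
        then have "ennreal (u y powr s0) \<le> ennreal (real i powr s0 + 1)" by (intro ennreal_leI) simp
        then show ?thesis using False by (auto simp: indicator_def)
      qed
    qed
    also have "\<dots> = mass (A i) + ennreal (real i powr s0 + 1) * emeasure lebesgue (ball x r)"
      unfolding mass_def using Am by (subst nn_integral_add) (auto simp: nn_integral_cmult_indicator)
    also have "ennreal (real i powr s0 + 1) * emeasure lebesgue (ball x r) = ennreal (\<omega> * (real i powr s0 + 1) * r powr n)"
    proof -
      have e: "emeasure lebesgue (ball x r) = ennreal (\<omega> * r powr n)" using r by (simp add: emeasure_ball_n)
      show ?thesis unfolding e by (subst ennreal_mult'[symmetric]) (auto simp: mult_ac)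
    qed
    also have "mass (A i) + ennreal (\<omega> * (real i powr s0 + 1) * r powr n) \<le> ennreal (\<epsilon> / 2) + ennreal (\<epsilon> / 2)"
      unfolding rn by (intro add_mono i) auto
    also have "\<dots> = ennreal \<epsilon>" using \<epsilon> by (subst ennreal_plus[symmetric]) auto
    finally show "mass (ball x r) \<le> ennreal \<epsilon>" .
  qed
qed

lemma mass_tail:
  assumes \<epsilon>: "\<epsilon> > 0"
  shows "\<exists>\<rho>\<ge>1. mass (- ball 0 \<rho>) \<le> ennreal \<epsilon>"
proof -
  have "\<exists>i. mass (- ball 0 (real i)) \<le> ennreal \<epsilon>"
  proof (rule mass_decseq)
    show "(\<Inter>i. - ball (0::real^'n) (real i)) = {}"
    proof -
      have "\<exists>i::nat. norm y < real i" for y :: "real^'n" by (rule reals_Archimedean2)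
      then have "\<exists>i. y \<notin> - ball 0 (real i)" for y :: "real^'n" by simp
      then show ?thesis by blast
    qed
  qed (use \<epsilon> in \<open>auto simp: decseq_def\<close>)
  then obtain i :: nat where i: "mass (- ball 0 (real i)) \<le> ennreal \<epsilon>" by blast
  have "mass (- ball 0 (max 1 (real i))) \<le> mass (- ball 0 (real i))"
    unfolding mass_def by (intro nn_integral_mono) (auto simp: indicator_def)
  then show ?thesis using i by (intro exI[of _ "max 1 (real i)"]) auto
qed

lemma mass_mono: "A \<subseteq> B \<Longrightarrow> mass A \<le> mass B"
  unfolding mass_def by (intro nn_integral_mono) (auto simp: indicator_def)

text \<open>Apply \<open>u_le_weight\<close> with a constant weight, hence \<open>D = 1\<close>, and
  one radius on which the mass is uniformly small. The far part is bounded by \<open>morrey\<close>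
  with the total mass, as \<open>t powr (- \<sigma> - 1)\<close> is integrable beyond a fixed
  radius.\<close>

lemma u_bounded: "\<exists>M>0. AE x in lebesgue. u x \<le> M"
proof -
  obtain \<epsilon> where \<epsilon>: "\<epsilon> > 0" and main: "\<And>\<phi> r. \<phi> \<in> borel_measurable lebesgue \<Longrightarrow> (\<forall>x. 0 < \<phi> x) \<Longrightarrow>
    (AE x in lebesgue. u x \<le> \<phi> x \<or> (0 < r x \<and> mass (ball x (r x)) \<le> ennreal \<epsilon> \<and>
       ennreal (2 * C) * far x (r x) \<le> ennreal (\<phi> x) \<and> (\<forall>y\<in>ball x (r x). \<phi> y \<le> 1 * \<phi> x))) \<Longrightarrow>
    (AE x in lebesgue. u x \<le> \<phi> x)"
    using u_le_weight[of 1] by (simp only: zero_less_one) blast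
  obtain r where r: "r > 0" and ms: "\<And>x. mass (ball x r) \<le> ennreal \<epsilon>"
    using mass_small_balls[OF \<epsilon>] by blast
  define I where "I = enn2real (mass UNIV) + 1"
  have I: "I > 0" by (simp add: I_def add_nonneg_pos)
  have mI: "mass A \<le> ennreal I" for A
  proof -
    have "mass UNIV < \<infinity>" using integrable by (simp add: mass_def)
    then have "mass UNIV = ennreal (enn2real (mass UNIV))" by (simp add: less_top)
    also have "\<dots> \<le> ennreal I" by (intro ennreal_leI) (simp add: I_def)
    finally show ?thesis using mass_mono[of A UNIV] by simp
  qed
  obtain K where K: "K > 0" and KI: "\<And>x t I. t > 0 \<Longrightarrow> I > 0 \<Longrightarrow> mass (ball x t) \<le> ennreal I \<Longrightarrow>
     m x t powr \<gamma> * t powr (- b - 1) \<le> K * I powr (\<gamma> * q / s0) * t powr (- \<sigma> - 1)"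
    using morrey by blast
  define M where "M = 2 * C * (K * I powr (\<gamma> * q / s0) * (r powr (- \<sigma>) / \<sigma>))"
  have M: "M > 0" using C K I r s0_pos by (simp add: M_def)
  have far: "ennreal (2 * C) * far x r \<le> ennreal M" for x
  proof -
    have "far x r \<le> (\<integral>\<^sup>+ t. ennreal (K * I powr (\<gamma> * q / s0)) * (ennreal (t powr (- \<sigma> - 1)) * indicator {r..} t) \<partial>lborel)"
      unfolding far_def
    proof (rule nn_integral_mono)
      fix t
      show "ennreal (m x t powr \<gamma> * t powr (- b - 1)) * indicator {r..} t \<le> ennreal (K * I powr (\<gamma> * q / s0)) * (ennreal (t powr (- \<sigma> - 1)) * indicator {r..} t)"
        using KI[of t I x] r I K mI by (auto simp: indicator_def ennreal_mult'[symmetric] intro!: ennreal_leI)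
    qed
    also have "\<dots> = ennreal (K * I powr (\<gamma> * q / s0)) * ennreal (r powr (- \<sigma>) / \<sigma>)"
      using r s0_pos by (subst nn_integral_cmult) (auto simp: nn_integral_powr_Ici)
    finally have "ennreal (2 * C) * far x r \<le> ennreal (2 * C) * (ennreal (K * I powr (\<gamma> * q / s0)) * ennreal (r powr (- \<sigma>) / \<sigma>))"
      by (rule mult_left_mono) simp
    also have "\<dots> = ennreal M" using C K by (simp add: M_def ennreal_mult'[symmetric])
    finally show ?thesis .
  qed
  have "AE x in lebesgue. u x \<le> M"
    by (rule main[of "\<lambda>_. M" "\<lambda>_. r"]) (use M r ms far in auto)
  then show ?thesis using M by blast
qed

section \<open>Upper bound of \<open>u\<close> by the tail at the origin\<close>

lemma H_meas: "(\<lambda>x. H (max (norm x) 1)) \<in> borel_measurable (lebesgue :: (real^'n) measure)"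
proof -
  have "mono (\<lambda>r. - H (max r 1))" by (intro monoI) (auto intro!: H_antimono)
  then have "(\<lambda>r. - H (max r 1)) \<in> borel_measurable borel" by (rule borel_measurable_mono)
  then have [measurable]: "(\<lambda>r. H (max r 1)) \<in> borel_measurable borel"
    using borel_measurable_uminus[of "\<lambda>r. - H (max r 1)" borel] by simp
  have "(\<lambda>x::real^'n. (\<lambda>r. H (max r 1)) (norm x)) \<in> borel_measurable lebesgue" by measurable
  then show ?thesis by simp
qed

text \<open>For \<open>t \<ge> norm x / 2\<close> the ball \<open>ball x t\<close> lies in the ball
  of radius \<open>3 * t\<close> about 0. The substitution of \<open>3 * t\<close> for
  \<open>t\<close> moves the start of the tail to \<open>3 * (norm x / 2)\<close>, which is beyond
  \<open>norm x\<close>.\<close>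

lemma far_le_H:
  assumes "x \<noteq> 0"
  shows "far x (norm x / 2) \<le> ennreal (3 powr b * H (norm x))"
proof -
  have nx: "norm x > 0" using assms by simp
  have eq: "HH (3 * (norm x / 2)) = ennreal 3 * (\<integral>\<^sup>+ t. ennreal (F (3 * t) powr \<gamma> * (3 * t) powr (- b - 1)) * indicator {3 * (norm x / 2)..} (3 * t) \<partial>lborel)"
    unfolding HH_def by (subst nn_integral_real_affine[where c = 3 and t = 0]) auto
  have "far x (norm x / 2) \<le> (\<integral>\<^sup>+ t. ennreal (3 powr b * 3) * (ennreal (F (3 * t) powr \<gamma> * (3 * t) powr (- b - 1)) * indicator {3 * (norm x / 2)..} (3 * t)) \<partial>lborel)"
    unfolding far_def
  proof (rule nn_integral_mono)
    fix t
    show "ennreal (m x t powr \<gamma> * t powr (- b - 1)) * indicator {norm x / 2..} t \<le>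
      ennreal (3 powr b * 3) * (ennreal (F (3 * t) powr \<gamma> * (3 * t) powr (- b - 1)) * indicator {3 * (norm x / 2)..} (3 * t))"
    proof (cases "norm x / 2 \<le> t")
      case True
      then have t: "t > 0" using nx by linarith
      have "ball x t \<subseteq> ball 0 (3 * t)"
      proof
        fix y assume "y \<in> ball x t"
        then show "y \<in> ball 0 (3 * t)" using True norm_triangle_ineq[of x "y - x"] by (auto simp: dist_norm norm_minus_commute)
      qed
      then have "m x t powr \<gamma> \<le> F (3 * t) powr \<gamma>"
        using params m_nonneg by (intro powr_mono2 m_le) auto
      then have "m x t powr \<gamma> * t powr (- b - 1) \<le> F (3 * t) powr \<gamma> * t powr (- b - 1)"
        by (intro mult_right_mono) auto
      also have "\<dots> = 3 powr b * 3 * (F (3 * t) powr \<gamma> * (3 * t) powr (- b - 1))"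
      proof -
        have "3 powr b * 3 * 3 powr (- b - 1) = (1::real)" by (simp add: powr_diff powr_minus)
        then have "t powr (- b - 1) = 3 powr b * 3 * (3 * t) powr (- b - 1)" using t by (simp add: powr_mult)
        then show ?thesis by (simp only: mult_ac)
      qed
      finally have "m x t powr \<gamma> * t powr (- b - 1) \<le> 3 powr b * 3 * (F (3 * t) powr \<gamma> * (3 * t) powr (- b - 1))" .
      then show ?thesis using True by (simp add: ennreal_mult'[symmetric] ennreal_leI)
    qed simp
  qed
  also have "\<dots> = ennreal (3 powr b * 3) * (\<integral>\<^sup>+ t. ennreal (F (3 * t) powr \<gamma> * (3 * t) powr (- b - 1)) * indicator {3 * (norm x / 2)..} (3 * t) \<partial>lborel)"
    by (intro nn_integral_cmult) measurable
  also have "\<dots> = ennreal (3 powr b) * HH (3 * (norm x / 2))"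
    unfolding eq by (subst ennreal_mult') (auto simp: mult.assoc)
  also have "\<dots> \<le> ennreal (3 powr b) * HH (norm x)"
    by (intro mult_left_mono HH_antimono) auto
  finally show ?thesis using nx by (simp add: HH_eq ennreal_mult'[symmetric])
qed

text \<open>The weight in \<open>u_le_weight\<close> is a multiple of \<open>H\<close> and the
  radius is \<open>norm x / 2\<close>: by doubling, \<open>H\<close> grows by at most a bounded
  factor on such balls, far out they carry little mass, and \<open>far_le_H\<close> bounds the far
  part by \<open>H\<close> itself. Further in, \<open>u_bounded\<close> suffices. The cutoff
  \<open>max (norm x) 1\<close> avoids the origin, where \<open>HH_finite\<close> says
  nothing.\<close>

lemma u_le_H: "\<exists>A>0. AE x in lebesgue. u x \<le> A * H (max (norm x) 1)"
proof -
  define D where "D = 1 + 2 powr b"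
  have D: "D > 0" by (simp add: D_def add_pos_nonneg)
  obtain \<epsilon> where \<epsilon>: "\<epsilon> > 0" and main: "\<And>\<phi> r. \<phi> \<in> borel_measurable lebesgue \<Longrightarrow> (\<forall>x. 0 < \<phi> x) \<Longrightarrow>
    (AE x in lebesgue. u x \<le> \<phi> x \<or> (0 < r x \<and> mass (ball x (r x)) \<le> ennreal \<epsilon> \<and>
       ennreal (2 * C) * far x (r x) \<le> ennreal (\<phi> x) \<and> (\<forall>y\<in>ball x (r x). \<phi> y \<le> D * \<phi> x))) \<Longrightarrow>
    (AE x in lebesgue. u x \<le> \<phi> x)"
    using u_le_weight[OF D] by blast
  obtain \<rho> where \<rho>: "\<rho> \<ge> 1" "mass (- ball 0 \<rho>) \<le> ennreal \<epsilon>" using mass_tail[OF \<epsilon>] by blast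
  obtain M where M: "M > 0" "AE x in lebesgue. u x \<le> M" using u_bounded by blast
  \<comment> \<open>The first entry serves the points with \<open>norm x < 2 * \<rho>\<close>, where
    only \<open>u x \<le> M\<close> is used; the second is the constant of the far part.\<close>
  define A where "A = max (M / H (2 * \<rho>)) (2 * C * 3 powr b)"
  have Hpos: "H (2 * \<rho>) > 0" using \<rho> by (intro H_pos) auto
  have A: "A > 0" "M \<le> A * H (2 * \<rho>)" "2 * C * 3 powr b \<le> A"
    using C Hpos by (auto simp: A_def less_max_iff_disj pos_divide_le_eq[symmetric])
  have hpos: "H (max s 1) > 0" for s by (intro H_pos) auto
  have "AE x in lebesgue. u x \<le> A * H (max (norm x) 1)"
  proof (rule main[of "\<lambda>x. A * H (max (norm x) 1)" "\<lambda>x. norm x / 2"])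
    show "(\<lambda>x::real^'n. A * H (max (norm x) 1)) \<in> borel_measurable lebesgue"
      using H_meas by measurable
    show "\<forall>x::real^'n. 0 < A * H (max (norm x) 1)" using A hpos by simp
    show "AE x in lebesgue. u x \<le> A * H (max (norm x) 1) \<or> (0 < norm x / 2 \<and> mass (ball x (norm x / 2)) \<le> ennreal \<epsilon> \<and>
       ennreal (2 * C) * far x (norm x / 2) \<le> ennreal (A * H (max (norm x) 1)) \<and>
       (\<forall>y\<in>ball x (norm x / 2). A * H (max (norm y) 1) \<le> D * (A * H (max (norm x) 1))))"
      using M(2)
    proof eventually_elim
      case (elim x)
      show ?case
      proof (cases "norm x < 2 * \<rho>")
        case True
        have "u x \<le> A * H (2 * \<rho>)" using elim A by linarith
        also have "\<dots> \<le> A * H (max (norm x) 1)"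
          using A True \<rho> by (intro mult_left_mono H_antimono) auto
        finally show ?thesis ..
      next
        case False
        then have nx: "norm x \<ge> 1" "norm x > 0" "x \<noteq> 0" "max (norm x) 1 = norm x" using \<rho> by auto
        have inb: "norm y > norm x / 2" if "y \<in> ball x (norm x / 2)" for y
          using that norm_triangle_ineq[of y "x - y"] by (auto simp: dist_norm)
        have "mass (ball x (norm x / 2)) \<le> mass (- ball 0 \<rho>)"
        proof (intro mass_mono subsetI)
          fix y assume "y \<in> ball x (norm x / 2)"
          then have "norm y > \<rho>" using inb[of y] False by linarith
          then show "y \<in> - ball 0 \<rho>" by simp
        qed
        moreover have "ennreal (2 * C) * far x (norm x / 2) \<le> ennreal (A * H (max (norm x) 1))"
        proof -
          have "ennreal (2 * C) * far x (norm x / 2) \<le> ennreal (2 * C) * ennreal (3 powr b * H (norm x))"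
            using nx by (intro mult_left_mono far_le_H) auto
          also have "\<dots> = ennreal (2 * C * 3 powr b * H (norm x))"
            using C by (simp add: ennreal_mult'[symmetric] mult_ac)
          also have "\<dots> \<le> ennreal (A * H (norm x))"
            using A H_nonneg by (intro ennreal_leI mult_right_mono) auto
          finally show ?thesis using nx by simp
        qed
        moreover have "A * H (max (norm y) 1) \<le> D * (A * H (max (norm x) 1))" if "y \<in> ball x (norm x / 2)" for y
        proof -
          have "H (max (norm y) 1) \<le> H (norm x / 2)"
            using inb[OF that] nx by (intro H_antimono) auto
          also have "\<dots> \<le> D * H (norm x)" using H_doubling[of "norm x / 2"] nx by (simp add: D_def)
          finally show ?thesis using A nx by (simp add: mult.left_commute)
        qed
        ultimately show ?thesis using nx \<rho> by auto
      qed
    qed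
  qed
  then show ?thesis using A by blast
qed

section \<open>Fast decay\<close>

lemma sigma_less_b: "\<sigma> < b"
  using n_less_b_s0[OF q_gt] s0_pos unfolding s0_def[symmetric] \<sigma>_def by (simp add: field_simps)

text \<open>As \<open>H\<close> is decreasing and bounds \<open>u\<close> from below, the shell
  inside radius \<open>r\<close> has mass at least a multiple of
  \<open>H r powr s0 * r powr n\<close>; this mass tends to 0. It is the smallness that later makes
  the contraction for \<open>F\<close> possible.\<close>

lemma H_small:
  assumes \<epsilon>: "\<epsilon> > 0"
  shows "\<exists>\<rho>\<ge>1. \<forall>r\<ge>\<rho>. H r \<le> \<epsilon> * r powr (- \<sigma>)"
proof -
  define c where "c = 2 powr b * C"
  have c: "c > 0" using C by (simp add: c_def)
  \<comment> \<open>On the shell between \<open>r / 2\<close> and \<open>r\<close>, \<open>u\<close>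
    is at least \<open>H r / c\<close>; the other factors of \<open>k\<close> come from the volume
    of that shell.\<close>
  define k where "k = (1 / c) powr s0 * (\<omega> * (2 powr n - 1)) * 2 powr (- n)"
  have "2 powr n > (1::real)" using params(7) by simp
  then have k: "k > 0" using c params(8) by (simp add: k_def)
  obtain \<rho> where \<rho>: "\<rho> \<ge> 1" "mass (- ball 0 \<rho>) \<le> ennreal (k * \<epsilon> powr s0)"
    using mass_tail[of "k * \<epsilon> powr s0"] k \<epsilon> by auto
  have "H r \<le> \<epsilon> * r powr (- \<sigma>)" if r: "r \<ge> 2 * \<rho>" for r
  proof -
    define s where "s = r / 2"
    have s: "s > 0" "s \<ge> \<rho>" "r = 2 * s" "r > 0" using r \<rho> by (auto simp: s_def)
    let ?S = "ball 0 (2 * s) - ball (0::real^'n) s"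
    have "ennreal ((H r / c) powr s0) * emeasure lebesgue ?S = (\<integral>\<^sup>+ y. ennreal ((H r / c) powr s0) * indicator ?S y \<partial>lebesgue)"
      by (intro nn_integral_cmult_indicator[symmetric]) auto
    also have "\<dots> \<le> mass ?S"
      unfolding mass_def
    proof (rule nn_integral_mono_AE)
      show "AE y in lebesgue. ennreal ((H r / c) powr s0) * indicator ?S y \<le> ennreal (u y powr s0) * indicator ?S y"
        using AE_u_ge_H
      proof eventually_elim
        case (elim y)
        show ?case
        proof (cases "y \<in> ?S")
          case True
          then have "H r \<le> H (norm y)" using s by (intro H_antimono) auto
          then have "H r \<le> c * u y" using elim by (simp add: c_def)
          then have "H r / c \<le> u y" using c by (simp add: field_simps)
          then have "(H r / c) powr s0 \<le> u y powr s0"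
            using s0_pos H_nonneg c by (intro powr_mono2) auto
          then show ?thesis using True by (simp add: ennreal_leI)
        qed simp
      qed
    qed
    also have "\<dots> \<le> mass (- ball 0 \<rho>)" using s by (intro mass_mono) auto
    also have "\<dots> \<le> ennreal (k * \<epsilon> powr s0)" by fact
    finally have "ennreal ((H r / c) powr s0 * (\<omega> * (2 powr n - 1) * s powr n)) \<le> ennreal (k * \<epsilon> powr s0)"
      unfolding emeasure_shell[OF s(1)] by (simp add: ennreal_mult')
    then have "(H r / c) powr s0 * (\<omega> * (2 powr n - 1) * s powr n) \<le> k * \<epsilon> powr s0"
      using k by (subst (asm) ennreal_le_iff) auto
    moreover have "(H r / c) powr s0 * (\<omega> * (2 powr n - 1) * s powr n) = k * (H r powr s0 * r powr n)"
    proof -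
      have "(H r / c) powr s0 = (1 / c) powr s0 * H r powr s0"
        using c H_nonneg by (simp add: powr_divide)
      moreover have "s powr n = 2 powr (- n) * r powr n"
        using s by (simp add: powr_mult mult.assoc[symmetric] powr_add[symmetric])
      ultimately show ?thesis by (simp add: k_def mult_ac)
    qed
    ultimately have "H r powr s0 * r powr n \<le> \<epsilon> powr s0" using k by simp
    then have "H r powr s0 \<le> \<epsilon> powr s0 * r powr (- n)"
      using s by (simp add: powr_minus field_simps)
    then have "(H r powr s0) powr (1 / s0) \<le> (\<epsilon> powr s0 * r powr (- n)) powr (1 / s0)"
      using s0_pos by (intro powr_mono2) auto
    then show ?thesis using s0_pos \<epsilon> s H_nonneg[of r] by (simp add: powr_mult powr_powr \<sigma>_def)
  qed
  then show ?thesis using \<rho> by (intro exI[of _ "2 * \<rho>"]) auto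
qed

text \<open>Together with \<open>H_le_of_growth\<close> this closes the one-dimensional system:
  \<open>F\<close> bounds \<open>H\<close>, and \<open>H\<close> bounds the increments of
  \<open>F\<close>.\<close>

lemma F_growth_upper: "\<exists>c>0. \<forall>r\<ge>1. F (2 * r) \<le> F r + c * r powr (n + a) * H r powr q"
proof -
  obtain A where A: "A > 0" and uH: "AE x in lebesgue. u x \<le> A * H (max (norm x) 1)" using u_le_H by blast
  obtain d where d: "d > 0" and sh: "\<And>r M. r > 0 \<Longrightarrow> M \<ge> 0 \<Longrightarrow> (AE x in lebesgue. r \<le> norm x \<and> norm x < 2 * r \<longrightarrow> u x \<le> M)
    \<Longrightarrow> F (2 * r) \<le> F r + d * r powr (n + a) * M powr q"
    using F_shell_upper by blast
  show ?thesis
  proof (intro exI conjI allI impI)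
    show "d * A powr q > 0" using d A by simp
    fix r :: real assume r: "r \<ge> 1"
    have "F (2 * r) \<le> F r + d * r powr (n + a) * (A * H r) powr q"
    proof (rule sh)
      show "AE x in lebesgue. r \<le> norm x \<and> norm x < 2 * r \<longrightarrow> u x \<le> A * H r"
        using uH
      proof (eventually_elim, intro impI)
        fix x :: "real^'n" assume x: "u x \<le> A * H (max (norm x) 1)" "r \<le> norm x \<and> norm x < 2 * r"
        have "A * H (max (norm x) 1) \<le> A * H r" using x r A by (intro mult_left_mono H_antimono) auto
        then show "u x \<le> A * H r" using x by linarith
      qed
    qed (use r A H_nonneg in auto)
    then show "F (2 * r) \<le> F r + d * A powr q * r powr (n + a) * H r powr q"
      using A H_nonneg by (simp add: powr_mult mult_ac)
  qed
qed

text \<open>The growth exponent of \<open>F\<close> that corresponds to the slow rate: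
  \<open>F r powr \<gamma> * r powr (- b)\<close> is of order \<open>r powr (- \<sigma>)\<close>
  when \<open>F r\<close> is of order \<open>r powr s1\<close>.\<close>

definition s1 :: real where "s1 = n - \<alpha> - \<sigma> / \<gamma>"

lemma s1: "s1 > 0" "s1 * \<gamma> = b - \<sigma>"
proof -
  show *: "s1 * \<gamma> = b - \<sigma>" using params by (simp add: s1_def b_def left_diff_distrib)
  then show "s1 > 0" using sigma_less_b params by (metis diff_gt_0_iff_gt zero_less_mult_pos2)
qed

lemma F_apriori: "\<exists>K>0. \<exists>\<rho>\<ge>1. \<forall>r\<ge>\<rho>. F r \<le> K * r powr s1"
proof -
  obtain \<rho> where \<rho>: "\<rho> \<ge> 1" "\<And>r. r \<ge> \<rho> \<Longrightarrow> H r \<le> 1 * r powr (- \<sigma>)" using H_small[of 1] by auto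
  have "F r \<le> b powr (1 / \<gamma>) * r powr s1" if r: "r \<ge> \<rho>" for r
  proof -
    have "F r \<le> (b * H r) powr (1 / \<gamma>) * r powr (n - \<alpha>)" using r \<rho> by (intro F_le_H_powr) auto
    also have "\<dots> \<le> (b * r powr (- \<sigma>)) powr (1 / \<gamma>) * r powr (n - \<alpha>)"
      using \<rho>(2)[OF r] params H_nonneg by (intro mult_right_mono powr_mono2 mult_left_mono) auto
    also have "\<dots> = b powr (1 / \<gamma>) * (r powr (- (\<sigma> / \<gamma>)) * r powr (n - \<alpha>))"
      using params by (simp add: powr_mult powr_powr)
    also have "r powr (- (\<sigma> / \<gamma>)) * r powr (n - \<alpha>) = r powr s1"
      by (simp add: powr_add[symmetric] s1_def)
    finally show ?thesis .
  qed
  then show ?thesis using \<rho> params by (intro exI[of _ "b powr (1 / \<gamma>)"]) auto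
qed

text \<open>The a priori bound \<open>F r = O(r powr s1)\<close> bounds \<open>F\<close> by a multiple of \<open>r powr d + \<mu> * r powr s1\<close> for every \<open>\<mu> > 0\<close>.
  Doubling contracts the constant in this bound down to one independent of \<open>\<mu>\<close>, and \<open>\<mu>\<close> then tends to 0.\<close>

lemma F_subpolynomial:
  assumes d: "0 < d" "d \<le> s1"
  shows "\<exists>B>0. \<exists>\<rho>\<ge>1. \<forall>r\<ge>\<rho>. F r \<le> B * r powr d"
proof -
  obtain c where c: "c > 0" and gr: "\<And>r. r \<ge> 1 \<Longrightarrow> F (2 * r) \<le> F r + c * r powr (n + a) * H r powr q"
    using F_growth_upper by blast
  obtain K \<rho>1 where K: "K > 0" "\<rho>1 \<ge> 1" "\<And>r. r \<ge> \<rho>1 \<Longrightarrow> F r \<le> K * r powr s1" using F_apriori by blast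
  \<comment> \<open>One doubling will multiply the bound on \<open>F\<close> by
    \<open>1 + \<kappa> = 2 powr (d / 2)\<close>, while \<open>r powr d\<close> gains
    \<open>2 powr d\<close>; the quotient is the contraction factor \<open>\<theta>\<close>.\<close>
  define \<kappa> where "\<kappa> = 2 powr (d / 2) - 1"
  have \<kappa>: "\<kappa> > 0" using d by (simp add: \<kappa>_def)
  \<comment> \<open>\<open>H r powr q\<close> is split into \<open>H r powr e\<close>, small by
    \<open>H_small\<close>, and \<open>H r powr (1 / \<gamma>)\<close>, which is linear in the bound
    on \<open>F\<close>. The powers of \<open>r\<close> cancel since
    \<open>\<sigma> * e = \<alpha> + a\<close>.\<close>
  define e where "e = q - 1 / \<gamma>"
  have e: "e > 0" "\<sigma> * e = \<alpha> + a"
  proof -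
    show "e > 0" using gamma_q params by (simp add: e_def field_simps)
    have "\<gamma> * (\<sigma> * e) = (\<gamma> * q - 1) * \<sigma>" using params by (simp add: e_def algebra_simps)
    then have "\<gamma> * (\<sigma> * e) = \<gamma> * (\<alpha> + a)" using sigma_eq by simp
    then show "\<sigma> * e = \<alpha> + a" using params by simp
  qed
  \<comment> \<open>Solved from the requirement that the increment of \<open>F\<close> be at most
    \<open>\<kappa>\<close> times the current bound.\<close>
  define \<epsilon> where "\<epsilon> = (\<kappa> * \<sigma> powr (1 / \<gamma>) / c) powr (1 / e)"
  have \<epsilon>: "\<epsilon> > 0" using \<kappa> c s0_pos by (simp add: \<epsilon>_def)
  have \<epsilon>e: "c * \<epsilon> powr e * \<sigma> powr (- (1 / \<gamma>)) = \<kappa>"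
    using \<kappa> c s0_pos e by (simp add: \<epsilon>_def powr_powr powr_minus)
  obtain \<rho>2 where \<rho>2: "\<rho>2 \<ge> 1" "\<And>r. r \<ge> \<rho>2 \<Longrightarrow> H r \<le> \<epsilon> * r powr (- \<sigma>)" using H_small[OF \<epsilon>] by blast
  define \<rho> where "\<rho> = max \<rho>1 \<rho>2"
  have \<rho>: "\<rho> \<ge> 1" "\<rho> \<ge> \<rho>1" "\<rho> \<ge> \<rho>2" using K \<rho>2 by (auto simp: \<rho>_def)
  define \<theta> where "\<theta> = 2 powr (- (d / 2))"
  have \<theta>: "0 < \<theta>" "\<theta> < 1" using d by (auto simp: \<theta>_def powr_less_one)
  define F0 where "F0 = F (2 * \<rho>)"
  have F0: "F0 > 0" using \<rho> by (simp add: F0_def m_pos)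
  have step: "F (2 * r) \<le> \<theta> * A * ((2 * r) powr d + \<mu> * (2 * r) powr s1)"
    if \<mu>: "\<mu> > 0" and A: "A > 0" and le: "\<And>t. t \<ge> \<rho> \<Longrightarrow> F t \<le> A * (t powr d + \<mu> * t powr s1)" and r: "r \<ge> \<rho>" for \<mu> A r
  proof -
    define w where "w = r powr d + \<mu> * r powr s1"
    have r0: "r > 0" "r \<ge> 1" using r \<rho> by auto
    have w: "w > 0" using \<mu> r0 by (simp add: w_def add_pos_pos)
    have "H r \<le> (A * w) powr \<gamma> * r powr (- b) / (b - s1 * \<gamma>)"
    proof (rule H_le_of_growth)
      show "s1 * \<gamma> < b" using s1 s0_pos by simp
      fix t assume t: "t \<ge> r"
      \<comment> \<open>Beyond \<open>r\<close> both terms are dominated by the growth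
        \<open>(t / r) powr s1\<close>, which suits \<open>H_le_of_growth\<close>; their values at
        \<open>r\<close> stay in \<open>w\<close>, so the gain \<open>2 powr d\<close> per doubling
        is not lost.\<close>
      have "1 \<le> t / r" using t r0 by simp
      then have "(t / r) powr d \<le> (t / r) powr s1" using d by (intro powr_mono) auto
      then have "r powr d * (t / r) powr d \<le> r powr d * (t / r) powr s1" by (intro mult_left_mono) auto
      moreover have "t powr d = r powr d * (t / r) powr d" "t powr s1 = r powr s1 * (t / r) powr s1"
        using r0 t by (auto simp: powr_divide)
      ultimately have "t powr d + \<mu> * t powr s1 \<le> w * (t / r) powr s1"
        by (simp add: w_def algebra_simps)
      then have "A * (t powr d + \<mu> * t powr s1) \<le> A * (w * (t / r) powr s1)" using A by simp
      then show "F t \<le> A * w * (t / r) powr s1" using le[of t] t r by simp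
    qed (use r0 A w in auto)
    then have "H r \<le> (A * w) powr \<gamma> * r powr (- b) / \<sigma>" using s1(2) by simp
    then have "H r powr (1 / \<gamma>) \<le> ((A * w) powr \<gamma> * r powr (- b) / \<sigma>) powr (1 / \<gamma>)"
      using params H_nonneg by (intro powr_mono2) auto
    also have "\<dots> = A * w * r powr (- (b / \<gamma>)) / \<sigma> powr (1 / \<gamma>)"
      using A w s0_pos params by (simp add: powr_mult powr_divide powr_powr)
    also have "\<dots> = A * w * r powr (- (n - \<alpha>)) * \<sigma> powr (- (1 / \<gamma>))"
      unfolding b_eq by (simp add: powr_minus[of \<sigma>] divide_inverse)
    finally have H1: "H r powr (1 / \<gamma>) \<le> A * w * r powr (- (n - \<alpha>)) * \<sigma> powr (- (1 / \<gamma>))" .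
    have "H r powr e \<le> (\<epsilon> * r powr (- \<sigma>)) powr e"
      using \<rho>2(2)[of r] r \<rho> e H_nonneg by (intro powr_mono2) auto
    also have "\<dots> = \<epsilon> powr e * r powr (- (\<alpha> + a))"
      using \<epsilon> e by (simp add: powr_mult powr_powr)
    finally have H2: "H r powr e \<le> \<epsilon> powr e * r powr (- (\<alpha> + a))" .
    have "H r powr q = H r powr e * H r powr (1 / \<gamma>)" by (simp add: powr_add[symmetric] e_def)
    also have "\<dots> \<le> (\<epsilon> powr e * r powr (- (\<alpha> + a))) * (A * w * r powr (- (n - \<alpha>)) * \<sigma> powr (- (1 / \<gamma>)))"
      using H1 H2 by (intro mult_mono) auto
    finally have "c * r powr (n + a) * H r powr q \<le> c * r powr (n + a) * ((\<epsilon> powr e * r powr (- (\<alpha> + a))) * (A * w * r powr (- (n - \<alpha>)) * \<sigma> powr (- (1 / \<gamma>))))"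
      using c by (intro mult_left_mono) auto
    also have "\<dots> = (c * \<epsilon> powr e * \<sigma> powr (- (1 / \<gamma>))) * (A * w) * (r powr (n + a) * r powr (- (\<alpha> + a)) * r powr (- (n - \<alpha>)))"
      by (simp only: mult_ac)
    also have "r powr (n + a) * r powr (- (\<alpha> + a)) * r powr (- (n - \<alpha>)) = 1"
      using r0 by (simp add: powr_add[symmetric])
    finally have "F (2 * r) \<le> F r + \<kappa> * (A * w)"
      using gr[of r] r0 unfolding \<epsilon>e by simp
    also have "\<dots> \<le> (1 + \<kappa>) * (A * w)" using le[OF r] by (simp add: w_def algebra_simps)
    also have "\<dots> = 2 powr (d / 2) * (A * w)" by (simp add: \<kappa>_def)
    also have "\<dots> \<le> 2 powr (d / 2) * (A * (2 powr (- d) * ((2 * r) powr d + \<mu> * (2 * r) powr s1)))"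
    proof -
      have "2 powr d * w \<le> (2 * r) powr d + \<mu> * (2 * r) powr s1"
      proof -
        have "2 powr d \<le> (2::real) powr s1" using d by simp
        then have "\<mu> * r powr s1 * 2 powr d \<le> \<mu> * r powr s1 * 2 powr s1" using \<mu> by (intro mult_left_mono) auto
        then show ?thesis using r0 by (simp add: w_def powr_mult algebra_simps)
      qed
      then have "2 powr (- d) * (2 powr d * w) \<le> 2 powr (- d) * ((2 * r) powr d + \<mu> * (2 * r) powr s1)"
        by (intro mult_left_mono) auto
      moreover have "2 powr (- d) * (2 powr d * w) = w" by (simp add: mult.assoc[symmetric] powr_add[symmetric])
      ultimately show ?thesis using A by (intro mult_left_mono) auto
    qed
    also have "\<dots> = (2 powr (d / 2) * 2 powr (- d)) * A * ((2 * r) powr d + \<mu> * (2 * r) powr s1)" by simp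
    also have "2 powr (d / 2) * 2 powr (- d) = \<theta>" by (simp add: \<theta>_def powr_add[symmetric])
    finally show ?thesis .
  qed
  have mu: "F t \<le> F0 * (t powr d + \<mu> * t powr s1)" if \<mu>: "\<mu> > 0" and t: "t \<ge> \<rho>" for \<mu> t
  proof -
    \<comment> \<open>The maximum with \<open>F0\<close> comes from the radii between
      \<open>\<rho>\<close> and \<open>2 * \<rho>\<close>, which doubling does not reach: there
      \<open>F t \<le> F0\<close> and the other factor is at least 1.\<close>
    have it: "\<forall>t\<ge>\<rho>. F t \<le> max F0 (\<theta> ^ i * (K / \<mu>)) * (t powr d + \<mu> * t powr s1)" for i :: nat
    proof (induction i)
      case 0
      show ?case
      proof (intro allI impI)
        fix t assume t: "t \<ge> \<rho>"
        have "F t \<le> K * t powr s1" using K t \<rho> by simp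
        also have "\<dots> = K / \<mu> * (\<mu> * t powr s1)" using \<mu> by simp
        also have "\<dots> \<le> max F0 (\<theta> ^ 0 * (K / \<mu>)) * (t powr d + \<mu> * t powr s1)"
          using K \<mu> F0 by (intro mult_mono) (auto simp: le_max_iff_disj)
        finally show "F t \<le> \<dots>" .
      qed
    next
      case (Suc i)
      let ?A = "max F0 (\<theta> ^ i * (K / \<mu>))"
      have A: "?A > 0" using F0 by simp
      have A': "\<theta> * ?A \<le> max F0 (\<theta> ^ Suc i * (K / \<mu>))"
      proof (cases "F0 \<le> \<theta> ^ i * (K / \<mu>)")
        case True then show ?thesis by (simp add: max_def mult.assoc)
      next
        case False
        then have "\<theta> * ?A \<le> 1 * F0" using \<theta> F0 by (intro mult_mono) auto
        then show ?thesis by simp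
      qed
      show ?case
      proof (intro allI impI)
        fix t assume t: "t \<ge> \<rho>"
        have w0: "t powr d + \<mu> * t powr s1 \<ge> 0" using \<mu> by simp
        show "F t \<le> max F0 (\<theta> ^ Suc i * (K / \<mu>)) * (t powr d + \<mu> * t powr s1)"
        proof (cases "t \<le> 2 * \<rho>")
          case True
          then have "F t \<le> F0 * 1" unfolding F0_def by (simp add: m_mono)
          also have "\<dots> \<le> max F0 (\<theta> ^ Suc i * (K / \<mu>)) * (t powr d + \<mu> * t powr s1)"
          proof (intro mult_mono)
            show "1 \<le> t powr d + \<mu> * t powr s1"
              using ge_one_powr_ge_zero[of t d] t \<rho> d \<mu> by (simp add: add_increasing2)
          qed (use F0 in \<open>auto simp: le_max_iff_disj\<close>)
          finally show ?thesis .
        next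
          case False
          have "F (2 * (t / 2)) \<le> \<theta> * ?A * ((2 * (t / 2)) powr d + \<mu> * (2 * (t / 2)) powr s1)"
            using Suc False by (intro step[OF \<mu> A]) auto
          then have "F t \<le> \<theta> * ?A * (t powr d + \<mu> * t powr s1)" by simp
          also have "\<dots> \<le> max F0 (\<theta> ^ Suc i * (K / \<mu>)) * (t powr d + \<mu> * t powr s1)"
            using A' w0 by (rule mult_right_mono)
          finally show ?thesis .
        qed
      qed
    qed
    obtain i :: nat where i: "\<theta> ^ i < F0 / (K / \<mu>)"
      using real_arch_pow_inv[of "F0 / (K / \<mu>)" \<theta>] F0 K \<mu> \<theta> by auto
    then have "\<theta> ^ i * (K / \<mu>) < F0" using K \<mu> by (subst (asm) pos_less_divide_eq) auto
    then have "max F0 (\<theta> ^ i * (K / \<mu>)) = F0" by simp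
    then show ?thesis using it[of i] t by simp
  qed
  have "F t \<le> F0 * t powr d" if t: "t \<ge> \<rho>" for t
  proof (rule field_le_epsilon)
    fix e' :: real assume e': "e' > 0"
    have "t > 0" using t \<rho> by linarith
    then have p: "F0 * t powr s1 > 0" using F0 by simp
    have "F t \<le> F0 * (t powr d + e' / (F0 * t powr s1) * t powr s1)"
      using e' p t by (intro mu divide_pos_pos) auto
    also have "\<dots> = F0 * t powr d + e'" using F0 \<open>t > 0\<close> by (simp add: distrib_left)
    finally show "F t \<le> F0 * t powr d + e'" .
  qed
  then show ?thesis using F0 \<rho> by blast
qed

text \<open>Growth of \<open>F\<close> with a small exponent \<open>d\<close> gives \<open>H\<close>
  almost the fast rate. By supercriticality the increment of \<open>F\<close> over a doubling is
  then of order \<open>r powr (- k)\<close> with \<open>k > 0\<close>, and these increments form a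
  convergent geometric series.\<close>

lemma F_bounded: "\<exists>B>0. \<forall>t. F t \<le> B"
proof -
  \<comment> \<open>At most half of the gap \<open>q * b - (n + a)\<close> is spent on
    \<open>q * d * \<gamma>\<close>; the rest keeps \<open>k\<close> positive. The minimum makes
    \<open>F_subpolynomial\<close> applicable.\<close>
  define d where "d = min s1 ((q * b - (n + a)) / (2 * q * \<gamma>))"
  have d: "0 < d" "d \<le> s1" using s1 exponent_supercritical q params by (auto simp: d_def)
  have d2: "q * d * \<gamma> \<le> (q * b - (n + a)) / 2"
  proof -
    have "d \<le> (q * b - (n + a)) / (2 * q * \<gamma>)" by (simp add: d_def)
    then have "d * (2 * q * \<gamma>) \<le> q * b - (n + a)" using q params by (subst (asm) pos_le_divide_eq) auto
    then show ?thesis by (simp add: mult_ac)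
  qed
  have d3: "d * \<gamma> < b"
  proof -
    have "d * \<gamma> \<le> s1 * \<gamma>" using d params by (intro mult_right_mono) auto
    then show ?thesis using s1 s0_pos by simp
  qed
  define k where "k = q * b - (n + a) - q * d * \<gamma>"
  have k: "k > 0" using d2 exponent_supercritical by (simp add: k_def field_simps)
  obtain B \<rho> where B: "B > 0" "\<rho> \<ge> 1" "\<And>r. r \<ge> \<rho> \<Longrightarrow> F r \<le> B * r powr d" using F_subpolynomial[OF d] by blast
  obtain c where c: "c > 0" and gr: "\<And>r. r \<ge> 1 \<Longrightarrow> F (2 * r) \<le> F r + c * r powr (n + a) * H r powr q"
    using F_growth_upper by blast
  define c1 where "c1 = c * (B powr \<gamma> / (b - d * \<gamma>)) powr q"
  have c1: "c1 > 0" using c B d3 by (simp add: c1_def)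
  have gr1: "F (2 * r) \<le> F r + c1 * r powr (- k)" if r: "r \<ge> \<rho>" for r
  proof -
    have r0: "r > 0" "r \<ge> 1" using r B by auto
    have "H r \<le> (B * r powr d) powr \<gamma> * r powr (- b) / (b - d * \<gamma>)"
    proof (rule H_le_of_growth[OF r0(1) d3])
      fix t assume "r \<le> t"
      then show "F t \<le> B * r powr d * (t / r) powr d" using B(3)[of t] r r0 by (simp add: powr_divide)
    qed (use B in auto)
    also have "\<dots> = B powr \<gamma> / (b - d * \<gamma>) * r powr (d * \<gamma> - b)"
      using B r0 by (simp add: powr_mult powr_powr powr_diff powr_minus field_simps)
    finally have "H r powr q \<le> (B powr \<gamma> / (b - d * \<gamma>) * r powr (d * \<gamma> - b)) powr q"
      using q H_nonneg by (intro powr_mono2) auto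
    also have "\<dots> = (B powr \<gamma> / (b - d * \<gamma>)) powr q * r powr (q * (d * \<gamma> - b))"
      using d3 by (subst powr_mult) (auto simp: powr_powr mult.commute)
    finally have "c * r powr (n + a) * H r powr q \<le> c * r powr (n + a) * ((B powr \<gamma> / (b - d * \<gamma>)) powr q * r powr (q * (d * \<gamma> - b)))"
      using c by (intro mult_left_mono) auto
    also have "\<dots> = c1 * (r powr (n + a) * r powr (q * (d * \<gamma> - b)))" by (simp add: c1_def)
    also have "r powr (n + a) * r powr (q * (d * \<gamma> - b)) = r powr (- k)"
      by (simp add: powr_add[symmetric] k_def algebra_simps)
    finally show ?thesis using gr[OF r0(2)] by simp
  qed
  \<comment> \<open>The geometric series of the increments, that is, the solution of
    \<open>c1 + c2 * 2 powr (- k) = c2\<close>; it makes \<open>\<Phi>\<close> nonincreasing under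
    doubling.\<close>
  define c2 where "c2 = c1 / (1 - 2 powr (- k))"
  have k1: "2 powr (- k) < (1::real)" using k by (simp add: powr_less_one)
  have "c1 + c1 / (1 - z) * z = c1 / (1 - z)" if "z < 1" for z :: real
    using that by (simp add: field_simps)
  from this[OF k1] have c2: "c2 > 0" "c1 + c2 * 2 powr (- k) = c2"
    using c1 k1 unfolding c2_def by simp_all
  define \<Phi> where "\<Phi> r = F r + c2 * r powr (- k)" for r
  have \<Phi>: "\<Phi> (2 * r) \<le> \<Phi> r" if r: "r \<ge> \<rho>" for r
  proof -
    have "\<Phi> (2 * r) \<le> F r + (c1 + c2 * 2 powr (- k)) * r powr (- k)"
      using gr1[OF r] r B by (simp add: \<Phi>_def powr_mult algebra_simps)
    then show ?thesis unfolding c2(2) \<Phi>_def .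
  qed
  have it: "\<Phi> (2 ^ i * \<rho>) \<le> \<Phi> \<rho>" for i :: nat
  proof (induction i)
    case (Suc i)
    have "\<rho> \<le> 2 ^ i * \<rho>" using B by (simp add: mult_le_cancel_right1)
    then have "\<Phi> (2 * (2 ^ i * \<rho>)) \<le> \<Phi> (2 ^ i * \<rho>)" by (rule \<Phi>)
    then show ?case using Suc by (simp add: mult.assoc)
  qed simp
  have "F t \<le> \<Phi> \<rho>" for t
  proof -
    obtain i :: nat where "t / \<rho> < 2 ^ i" using real_arch_pow[of 2] by auto
    then have "t \<le> 2 ^ i * \<rho>" using B by (simp add: field_simps)
    then have "F t \<le> F (2 ^ i * \<rho>)" by (rule m_mono)
    also have "\<dots> \<le> \<Phi> (2 ^ i * \<rho>)" using c2 by (simp add: \<Phi>_def)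
    also have "\<dots> \<le> \<Phi> \<rho>" by (rule it)
    finally show ?thesis .
  qed
  moreover have "\<Phi> \<rho> > 0" using m_pos[of \<rho> 0] B c2 by (simp add: \<Phi>_def add_pos_nonneg)
  ultimately show ?thesis by blast
qed

text \<open>With \<open>F\<close> bounded, \<open>H_le_of_growth\<close> with exponent 0 gives
  \<open>H\<close> the rate \<open>b\<close>; from below, \<open>F\<close> is at least
  \<open>F 1 > 0\<close> outside the unit ball.\<close>

lemma fast_decay: "decays_with_rate b u"
proof -
  obtain A where A: "A > 0" and uH: "AE x in lebesgue. u x \<le> A * H (max (norm x) 1)" using u_le_H by blast
  obtain B where B: "B > 0" "\<And>t. F t \<le> B" using F_bounded by blast
  obtain c where c: "c > 0" and lo: "AE x in lebesgue. c * F (norm x) powr \<gamma> * norm x powr (- b) \<le> u x"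
    using AE_u_ge_F by blast
  have Hle: "H r \<le> B powr \<gamma> * r powr (- b) / b" if r: "r > 0" for r
    using H_le_of_growth[of r 0 B] r B params by simp
  define k where "k = A * B powr \<gamma> / b"
  define c' where "c' = c * F 1 powr \<gamma>"
  have c': "c' > 0" using c m_pos[of 1 0] by (simp add: c'_def)
  show ?thesis
    unfolding decays_with_rate_def
  proof (intro exI conjI)
    show "0 < c'" by fact
    show "c' \<le> max c' k" by simp
    show "(0::real) < 1" by simp
    show "AE x in lebesgue. 1 < norm x \<longrightarrow> c' * norm x powr (- b) \<le> u x \<and> u x \<le> max c' k * norm x powr (- b)"
      using uH lo
    proof (eventually_elim, intro impI conjI)
      fix x :: "real^'n"
      assume x: "u x \<le> A * H (max (norm x) 1)" "c * F (norm x) powr \<gamma> * norm x powr (- b) \<le> u x" "1 < norm x"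
      have "c' * norm x powr (- b) \<le> c * F (norm x) powr \<gamma> * norm x powr (- b)"
        unfolding c'_def using c params x m_nonneg by (intro mult_right_mono mult_left_mono powr_mono2 m_mono) auto
      then show "c' * norm x powr (- b) \<le> u x" using x by linarith
      have "u x \<le> A * H (norm x)" using x by simp
      also have "\<dots> \<le> A * (B powr \<gamma> * norm x powr (- b) / b)"
        using A x by (intro mult_left_mono Hle) auto
      also have "\<dots> = k * norm x powr (- b)" by (simp add: k_def)
      also have "\<dots> \<le> max c' k * norm x powr (- b)" by (intro mult_right_mono) auto
      finally show "u x \<le> max c' k * norm x powr (- b)" .
    qed
  qed
qed

end

section \<open>From the integral equation to the theorem\<close>

lemma positive_solution_imp_wolff_solution:
  fixes u R :: "real^'n \<Rightarrow> real"
  assumes "\<beta> > 0" "1 < p" "0 \<le> - a" "- a < p * \<beta>" "p * \<beta> < real CARD('n)" "q > 0"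
    and R: "double_bounded R" and sol: "positive_solution \<beta> p a q R u"
  shows "\<exists>C. wolff_solution \<beta> p a q C (real CARD('n)) u"
proof -
  obtain C where C: "C > 0" "\<And>x. 1 / C \<le> R x" "\<And>x. R x \<le> C" using R by (auto simp: double_bounded_def)
  let ?W = "wolff_potential \<beta> p (\<lambda>y. norm y powr a * u y powr q)"
  have eq: "AE x in lebesgue. ennreal (u x) = ennreal (R x) * ?W x"
    using sol by (simp add: positive_solution_def)
  have "wolff_solution \<beta> p a q C (real CARD('n)) u"
  proof
    show "AE x in lebesgue. ennreal (u x) \<le> ennreal C * ?W x"
      using eq by eventually_elim (simp add: C(3) mult_right_mono ennreal_leI)
    show "AE x in lebesgue. ?W x \<le> ennreal C * ennreal (u x)"
      using eq
    proof eventually_elim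
      case (elim x)
      have "1 \<le> C * R x" using C(2)[of x] C(1) by (simp add: field_simps)
      then have "1 * ?W x \<le> ennreal (C * R x) * ?W x"
        by (intro mult_right_mono) (simp_all flip: ennreal_1 add: ennreal_leI)
      also have "\<dots> = ennreal C * ennreal (u x)"
        using C(1) by (simp add: elim ennreal_mult' mult.assoc)
      finally show ?case by simp
    qed
  qed (use assms C sol in \<open>auto simp: positive_solution_def\<close>)
  then show ?thesis by blast
qed

theorem theorem1p1:
  fixes \<beta> p a q :: real
  assumes "CARD('n::finite) \<ge> 3"
    and "\<beta> > 0" and "1 < p" and "p \<le> 2"
    and "0 \<le> - a" and "- a < p * \<beta>" and "p * \<beta> < real CARD('n)"
    and "q > 0"
  shows
    "(q \<le> (real CARD('n) + a) * (p - 1) / (real CARD('n) - p * \<beta>) \<longrightarrow>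
        (\<forall>R :: real^'n \<Rightarrow> real. double_bounded R \<longrightarrow>
           \<not> (\<exists>u. positive_solution \<beta> p a q R u))) \<and>
     (q > p - 1 \<longrightarrow>
        (\<forall>(R :: real^'n \<Rightarrow> real) u s\<^sub>0.
           double_bounded R \<longrightarrow> positive_solution \<beta> p a q R u \<longrightarrow>
           s\<^sub>0 = real CARD('n) * (q - p + 1) / (p * \<beta> + a) \<longrightarrow>
             (in_L_infinity u \<and> decays_with_rate ((real CARD('n) - p * \<beta>) / (p - 1)) u
                \<longleftrightarrow> in_L s\<^sub>0 u) \<and>
             (\<forall>\<theta>>0. in_L_infinity u \<and> \<not> in_L s\<^sub>0 u \<and> decays_with_rate \<theta> u \<longrightarrow>
                \<theta> = (p * \<beta> + a) / (q - p + 1))))"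
proof (intro conjI impI allI notI)
  fix R :: "real^'n \<Rightarrow> real"
  assume le: "q \<le> (real CARD('n) + a) * (p - 1) / (real CARD('n) - p * \<beta>)" and R: "double_bounded R"
    and "\<exists>u. positive_solution \<beta> p a q R u"
  then obtain u where sol: "positive_solution \<beta> p a q R u" by blast
  obtain C where "wolff_solution \<beta> p a q C (real CARD('n)) u"
    using positive_solution_imp_wolff_solution[OF assms(2,3,5,6,7,8) R sol] by blast
  then interpret wolff_solution \<beta> p a q C "real CARD('n)" u .
  \<comment> \<open>Multiplied out, the assumption on \<open>q\<close> is
    \<open>q * b \<le> n + a\<close>, contrary to \<open>exponent_supercritical\<close>.\<close>
  have "q * (real CARD('n) - p * \<beta>) \<le> (real CARD('n) + a) * (p - 1)"
    using le assms by (subst (asm) pos_le_divide_eq) auto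
  moreover have "q * b = q * (real CARD('n) - p * \<beta>) / (p - 1)"
    by (simp add: b_def \<gamma>_def \<alpha>_def)
  ultimately have "q * b \<le> real CARD('n) + a"
    using assms by (simp add: pos_divide_le_eq)
  then show False using exponent_supercritical by simp
next
  fix R u :: "real^'n \<Rightarrow> real" and s\<^sub>0 :: real
  assume qp: "q > p - 1" and R: "double_bounded R" and sol: "positive_solution \<beta> p a q R u"
    and s0: "s\<^sub>0 = real CARD('n) * (q - p + 1) / (p * \<beta> + a)"
  obtain C where "wolff_solution \<beta> p a q C (real CARD('n)) u"
    using positive_solution_imp_wolff_solution[OF assms(2,3,5,6,7,8) R sol] by blast
  then interpret wolff_solution \<beta> p a q C "real CARD('n)" u .
  have b: "b = (real CARD('n) - p * \<beta>) / (p - 1)" by (simp add: b_def \<gamma>_def \<alpha>_def)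
  have s0_pos: "s\<^sub>0 > 0"
    unfolding s0 using qp assms by (intro divide_pos_pos mult_pos_pos) auto
  show "in_L_infinity u \<and> decays_with_rate ((real CARD('n) - p * \<beta>) / (p - 1)) u \<longleftrightarrow> in_L s\<^sub>0 u"
  proof (intro iffI conjI)
    assume "in_L_infinity u \<and> decays_with_rate ((real CARD('n) - p * \<beta>) / (p - 1)) u"
    then show "in_L s\<^sub>0 u"
      using n_less_b_s0[OF qp] s0_pos unfolding b[symmetric] s0[symmetric]
      by (intro in_L_if_fast_decay) auto
  next
    assume L: "in_L s\<^sub>0 u"
    interpret integrable_wolff_solution \<beta> p a q C "real CARD('n)" u s\<^sub>0
    proof
      show "(\<integral>\<^sup>+ x. ennreal (u x powr s\<^sub>0) \<partial>lebesgue) < \<infinity>"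
        using L u_pos by (simp add: in_L_def abs_of_pos)
    qed (use qp s0 in auto)
    show "decays_with_rate ((real CARD('n) - p * \<beta>) / (p - 1)) u"
      using fast_decay by (simp add: b)
    obtain M where "AE x in lebesgue. u x \<le> M" using u_bounded by blast
    then have "AE x in lebesgue. \<bar>u x\<bar> \<le> M"
      by eventually_elim (simp add: u_pos abs_of_pos)
    then show "in_L_infinity u" using u_meas by (auto simp: in_L_infinity_def)
  qed
  fix \<theta> :: real
  assume \<theta>: "\<theta> > 0" and h: "in_L_infinity u \<and> \<not> in_L s\<^sub>0 u \<and> decays_with_rate \<theta> u"
  \<comment> \<open>A bounded solution decaying faster than the slow rate would be in
    \<open>L\<close> with exponent \<open>s\<^sub>0\<close>, so \<open>\<theta>\<close> is at most
    the slow rate; \<open>decay_rate_ge\<close> supplies the opposite inequality.\<close>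
  have "\<not> real CARD('n) < \<theta> * s\<^sub>0"
    using in_L_if_fast_decay[of \<theta> s\<^sub>0] h s0_pos by blast
  then have "\<theta> * (real CARD('n) * (q - p + 1)) / (p * \<beta> + a) \<le> real CARD('n)" by (simp add: s0)
  then have "\<theta> * (real CARD('n) * (q - p + 1)) \<le> real CARD('n) * (p * \<beta> + a)"
    using assms by (subst (asm) pos_divide_le_eq) auto
  then have "real CARD('n) * (\<theta> * (q - p + 1)) \<le> real CARD('n) * (p * \<beta> + a)"
    by (simp only: mult.left_commute)
  then have "\<theta> * (q - p + 1) \<le> p * \<beta> + a"
    using assms(1) by (subst (asm) mult_le_cancel_left_pos) auto
  moreover have "p * \<beta> + a \<le> (q - (p - 1)) * \<theta>"
    using decay_rate_ge[of \<theta>] h by (simp add: \<alpha>_def)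
  ultimately have "\<theta> * (q - p + 1) = p * \<beta> + a" by (simp add: algebra_simps)
  then show "\<theta> = (p * \<beta> + a) / (q - p + 1)" using qp by (simp add: eq_divide_eq)
qed

end
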